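(* Let $G$ be a $3$-edge-connected graph with two root vertices, where $|V(G)|\ge 4$. Then $G$ has no rooted immersion of $D_3$ (that is, $G\nsucc_r D_3$) if and only if one of the following occurs: (i) $G$ is a doubled cycle; (ii) $G$ has a segmentation of width $3$ relative to some $(X_0,X_1)$ with the added property that, for $i=0,1$, if $|X_i|\ge 3$ then $X_i$ does not contain a root vertex.
   Context: All graphs are finite, loopless and undirected, and parallel edges are permitted. For $X\subseteq V(G)$, $d(X)$ is the number of edges with exactly one endpoint in $X$. $G$ is $k$-edge-connected if $d(X)\ge k$ whenever $|X|,|V(G)\setminus X|\ge 1$. $D_3$ is the complete graph $K_4$ with two of its vertices designated as roots. Rooted immersion: if $xy,yz$ are two distinct edges sharing the vertex $y$, splitting them off at $y$ means deleting both and adding a new edge $xz$ (a loop, if $x=z$, is discarded). For $G$ with roots $x_0,x_1$ and $H$ with roots $y_0,y_1$, $G\succ_r H$ means a sequence of splits and (vertex or edge) deletions transforms $G$ into a graph isomorphic to $H$ by an isomorphism sending $x_i$ to $y_i$ for $i=0,1$. Equivalently, there is an injection $V(H)\to V(G)$ sending $y_i$ to $x_i$, and pairwise edge-disjoint paths of $G$, one for each edge of $H$, joining the images of the endpoints of that edge. (For $H=D_3$ the order of the roots is irrelevant by symmetry.) A doubled cycle is a graph obtained from a cycle by adding a second copy of each edge. For disjoint $X,Y\subseteq V(G)$, a segmentation of $G$ relative to $(X,Y)$ is a nested family $X_1\subset X_2\subset\dots\subset X_k$ of vertex sets with $X_1=X$, $V(G)\setminus X_k=Y$, and $|X_{i+1}\setminus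 X_i|=1$ for $1\le i\le k-1$. It has width $w$ if $d(X_i)=w$ for every $1\le i\le k$. *)

theory Defs
  imports "HOL-Library.Multiset"
begin

text \<open>
  Finite loopless undirected graphs with parallel edges. An edge is the two-element set of its
  endpoints, and parallel edges are repeated occurrences in the multiset of edges, so that two
  edges are distinct if they are distinct occurrences.
\<close>

record 'a mgraph =
  verts :: "'a set"
  edges :: "'a set multiset"

locale multigraph =
  fixes G :: "'a mgraph" (structure)
  assumes finite_verts: "finite (verts G)"
    and edge_ends: "\<And>e. e \<in># edges G \<Longrightarrow> e \<subseteq> verts G \<and> card e = 2"

definition cut_degree :: "'a mgraph \<Rightarrow> 'a set \<Rightarrow> nat" where
  "cut_degree G X = size {#e \<in># edges G. card (e \<inter> X) = 1#}"

definition edge_connected :: "nat \<Rightarrow> 'a mgraph \<Rightarrow> bool" where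
  "edge_connected k G \<longleftrightarrow>
    (\<forall>X \<subseteq> verts G. card X \<ge> 1 \<and> card (verts G - X) \<ge> 1 \<longrightarrow> cut_degree G X \<ge> k)"

definition graph_iso :: "('a \<Rightarrow> 'b) \<Rightarrow> 'a mgraph \<Rightarrow> 'b mgraph \<Rightarrow> bool" where
  "graph_iso f G H \<longleftrightarrow>
    bij_betw f (verts G) (verts H) \<and> image_mset (\<lambda>e. f ` e) (edges G) = edges H"

text \<open>
  In the rule for splitting off, the multiset inclusion says that \<open>xy\<close> and \<open>yz\<close> are two distinct
  edges; when \<open>x = z\<close> they are parallel and the resulting loop is discarded.
\<close>

inductive immersion_step :: "'a mgraph \<Rightarrow> 'a mgraph \<Rightarrow> bool" where
  split_off: "{#{x, y}, {y, z}#} \<subseteq># edges G \<Longrightarrow>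
    immersion_step G (G\<lparr>edges :=
      edges G - {#{x, y}, {y, z}#} + (if x = z then {#} else {#{x, z}#})\<rparr>)"
| delete_edge: "e \<in># edges G \<Longrightarrow> immersion_step G (G\<lparr>edges := edges G - {#e#}\<rparr>)"
| delete_vertex: "v \<in> verts G \<Longrightarrow>
    immersion_step G \<lparr>verts = verts G - {v}, edges = {#e \<in># edges G. v \<notin> e#}\<rparr>"

type_synonym 'a rooted_graph = "'a mgraph \<times> 'a \<times> 'a"

text \<open>
  The roots of the first graph have to survive the deletions, since otherwise the value of \<open>f\<close>
  on them would be arbitrary.
\<close>

fun rooted_immersion :: "'a rooted_graph \<Rightarrow> 'b rooted_graph \<Rightarrow> bool" where
  "rooted_immersion (G, x0, x1) (H, y0, y1) \<longleftrightarrow>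
    (\<exists>G' f. immersion_step\<^sup>*\<^sup>* G G' \<and> graph_iso f G' H \<and>
      x0 \<in> verts G' \<and> x1 \<in> verts G' \<and> f x0 = y0 \<and> f x1 = y1)"

definition complete_graph :: "'a set \<Rightarrow> 'a mgraph" where
  "complete_graph S = \<lparr>verts = S, edges = mset_set {e. e \<subseteq> S \<and> card e = 2}\<rparr>"

definition D3 :: "nat rooted_graph" where
  "D3 = (complete_graph {0, 1, 2, 3}, 0, 1)"

text \<open>A cycle of length two consists of two parallel edges.\<close>

definition cycle_graph :: "'a mgraph \<Rightarrow> bool" where
  "cycle_graph C \<longleftrightarrow>
    (\<exists>vs. distinct vs \<and> length vs \<ge> 2 \<and> verts C = set vs \<and>
      edges C = {#{vs ! i, vs ! (Suc i mod length vs)}. i \<in># mset [0..<length vs]#})"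

definition doubled_cycle :: "'a mgraph \<Rightarrow> bool" where
  "doubled_cycle G \<longleftrightarrow>
    (\<exists>C. cycle_graph C \<and> verts G = verts C \<and> edges G = edges C + edges C)"

text \<open>The list \<open>Xs\<close> holds the nested sets in increasing order.\<close>

definition segmentation :: "'a mgraph \<Rightarrow> 'a set \<Rightarrow> 'a set \<Rightarrow> 'a set list \<Rightarrow> bool" where
  "segmentation G X Y Xs \<longleftrightarrow>
    X \<subseteq> verts G \<and> Y \<subseteq> verts G \<and> X \<inter> Y = {} \<and>
    Xs \<noteq> [] \<and> (\<forall>Z \<in> set Xs. Z \<subseteq> verts G) \<and>
    hd Xs = X \<and> verts G - last Xs = Y \<and>
    (\<forall>i. Suc i < length Xs \<longrightarrow> Xs ! i \<subset> Xs ! Suc i \<and> card (Xs ! Suc i - Xs ! i) = 1)"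

definition has_width :: "'a mgraph \<Rightarrow> 'a set list \<Rightarrow> nat \<Rightarrow> bool" where
  "has_width G Xs w \<longleftrightarrow> (\<forall>Z \<in> set Xs. cut_degree G Z = w)"

end

theory Submission
  imports Defs
begin

text \<open>
  Immersion never increases a cut, so the branch vertices of an immersed \<open>K\<^sub>4\<close> cannot be split two and
  two by a cut of size three; in a doubled cycle, two overlapping intervals with tight cuts of size
  four leave no room for the odd degree of the branch vertex in their intersection.

  For the converse, contracting a side of a 3-edge-cut preserves all hypotheses by Menger's theorem.
  Refining a chain of 3-edge-cuts between the roots by such contractions leaves two situations. If
  both roots have degree three and no \<open>D3\<close> is immersed, then all other degrees are even: deleting an
  edge between two inner vertices and suppressing vertices of degree two gives a smaller graph of the
  same kind, so the ends of this edge are the only odd inner vertices, and counting edges leaves only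
  graphs on four vertices or with a nontrivial 3-edge-cut between the roots. If no nontrivial
  3-edge-cut separates the roots and the roots together are left by at least four edges, then there
  is an immersed \<open>D3\<close> or the graph is a doubled cycle: in a minimal counterexample a nontrivial
  4-edge-cut between the roots can be contracted to a doubled cycle, and otherwise the same deletion
  produces a doubled cycle, whose even degrees determine the parities of all inner degrees.
\<close>

section \<open>Cuts of multigraphs\<close>

text \<open>The case split follows from what the two operations endanger. Contracting a side of a
  cut to a vertex in it is an immersion if no smaller cut within that side surrounds the vertex. For
  cuts of size three this is automatic in a 3-edge-connected graph; for a cut of size four the
  absorbed root must itself have degree at least four. Deleting an edge may leave an end with degree
  two, which is then suppressed. A root cannot be suppressed, so an edge at a root of degree three
  is never deleted; hence two cubic roots need an argument that touches only edges between inner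
  vertices.

  Lower bounds of four on cuts mean three plus one, the slack that one deleted edge consumes. Most
  contradictions are parities: all cuts of a doubled cycle are even, so contracting a side of an odd
  cut never yields one. For cubic roots the evenness of the inner degrees plays this role, which is
  why it is proved in the same induction as the separating cut.\<close>

definition between :: "'a mgraph \<Rightarrow> 'a set \<Rightarrow> 'a set \<Rightarrow> nat" where
  "between G A B = size {#e \<in># edges G. e \<inter> A \<noteq> {} \<and> e \<inter> B \<noteq> {}#}"

lemma size_filter_mset_sum: "size {#x \<in># M. P x#} = (\<Sum>x\<in>#M. of_bool (P x))"
  by (induction M) auto

lemma card_pair_Int_eq_1:
  assumes "a \<noteq> b"
  shows "card ({a, b} \<inter> X) = 1 \<longleftrightarrow> (a \<in> X) \<noteq> (b \<in> X)"
  using assms by (auto simp: Int_insert_left)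

lemma multigraph_edgeE:
  assumes "multigraph G" "e \<in># edges G"
  obtains a b where "e = {a, b}" "a \<noteq> b" "a \<in> verts G" "b \<in> verts G"
  using multigraph.edge_ends[OF assms] by (auto simp: card_2_iff)

lemma multigraph_pairD:
  assumes "multigraph G" "{a, b} \<in># edges G"
  shows "a \<noteq> b" "a \<in> verts G" "b \<in> verts G"
  using multigraph.edge_ends[OF assms] by (auto simp: card_insert_if split: if_splits)

text \<open>An edge joining \<open>A\<close> to \<open>B\<close> crosses both cuts but lies inside
  the union, whence the factor two. The identity is used for counting as well as for parity.\<close>

lemma cut_degree_Un:
  assumes G: "multigraph G" and "A \<inter> B = {}"
  shows "cut_degree G (A \<union> B) + 2 * between G A B = cut_degree G A + cut_degree G B"
proof -
  have *: "of_bool (card (e \<inter> (A \<union> B)) = 1) + 2 * of_bool (e \<inter> A \<noteq> {} \<and> e \<inter> B \<noteq> {}) =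
      (of_bool (card (e \<inter> A) = 1) + of_bool (card (e \<inter> B) = 1) :: nat)" if "e \<in># edges G" for e
  proof -
    obtain a b where e: "e = {a, b}" and ab: "a \<noteq> b"
      using multigraph_edgeE[OF G \<open>e \<in># edges G\<close>] by metis
    show ?thesis
      unfolding e card_pair_Int_eq_1[OF ab] using \<open>A \<inter> B = {}\<close> by (auto simp: of_bool_def)
  qed
  show ?thesis
    unfolding cut_degree_def between_def size_filter_mset_sum sum_mset_distrib_left
      sum_mset.distrib[symmetric]
    by (intro arg_cong[where f = sum_mset] image_mset_cong *)
qed

lemma between_commute: "between G A B = between G B A"
  unfolding between_def by (simp add: conj_commute)

lemma between_Un:
  assumes G: "multigraph G" and "A \<inter> (B \<union> C) = {}" "B \<inter> C = {}"
  shows "between G A (B \<union> C) = between G A B + between G A C"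
proof -
  have *: "of_bool (e \<inter> A \<noteq> {} \<and> e \<inter> (B \<union> C) \<noteq> {}) =
      (of_bool (e \<inter> A \<noteq> {} \<and> e \<inter> B \<noteq> {}) + of_bool (e \<inter> A \<noteq> {} \<and> e \<inter> C \<noteq> {}) :: nat)"
    if "e \<in># edges G" for e
  proof -
    obtain a b where e: "e = {a, b}" and ab: "a \<noteq> b"
      using multigraph_edgeE[OF G \<open>e \<in># edges G\<close>] by metis
    show ?thesis
      unfolding e using assms(2,3) by (auto simp: of_bool_def)
  qed
  show ?thesis
    unfolding between_def size_filter_mset_sum sum_mset.distrib[symmetric]
    by (intro arg_cong[where f = sum_mset] image_mset_cong *)
qed

lemma cut_degree_eq_between:
  assumes G: "multigraph G"
  shows "cut_degree G X = between G X (verts G - X)"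
proof -
  have "card (e \<inter> X) = 1 \<longleftrightarrow> e \<inter> X \<noteq> {} \<and> e \<inter> (verts G - X) \<noteq> {}" if e: "e \<in># edges G" for e
  proof -
    obtain a b where "e = {a, b}" "a \<noteq> b" "a \<in> verts G" "b \<in> verts G"
      using multigraph_edgeE[OF G e] by metis
    then show ?thesis
      using card_pair_Int_eq_1[of a b X] by auto
  qed
  then show ?thesis
    unfolding cut_degree_def between_def
    by (intro arg_cong[where f = size] filter_mset_cong) auto
qed

lemma cut_degree_compl:
  assumes G: "multigraph G"
  shows "cut_degree G (verts G - X) = cut_degree G X"
proof -
  have "card (e \<inter> (verts G - X)) = 1 \<longleftrightarrow> card (e \<inter> X) = 1" if e: "e \<in># edges G" for e
  proof -
    obtain a b where "e = {a, b}" "a \<noteq> b" "a \<in> verts G" "b \<in> verts G"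
      using multigraph_edgeE[OF G e] by metis
    then show ?thesis
      using card_pair_Int_eq_1[of a b] by auto
  qed
  then show ?thesis
    unfolding cut_degree_def
    by (intro arg_cong[where f = size] filter_mset_cong) auto
qed

lemma cut_degree_eqI_compl:
  assumes "multigraph G" "X \<inter> Y = {}" "X \<union> Y = verts G"
  shows "cut_degree G X = cut_degree G Y"
proof -
  have "Y = verts G - X" using assms by auto
  then show ?thesis using cut_degree_compl[OF assms(1), of X] by simp
qed

lemma between_pos_edge:
  assumes G: "multigraph G" and "A \<inter> B = {}" "between G A B \<noteq> 0"
  obtains a b where "a \<in> A" "b \<in> B" "{a, b} \<in># edges G"
proof -
  have "{#e \<in># edges G. e \<inter> A \<noteq> {} \<and> e \<inter> B \<noteq> {}#} \<noteq> {#}"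
    using assms(3) unfolding between_def by auto
  then obtain e where "e \<in># {#e \<in># edges G. e \<inter> A \<noteq> {} \<and> e \<inter> B \<noteq> {}#}"
    by (meson multiset_nonemptyE)
  then have e: "e \<in># edges G" "e \<inter> A \<noteq> {}" "e \<inter> B \<noteq> {}" by auto
  obtain a b where ab: "a \<in> e" "a \<in> A" "b \<in> e" "b \<in> B" using e by blast
  obtain x y where "e = {x, y}" using multigraph_edgeE[OF G e(1)] by metis
  then have "e = {a, b}" using ab assms(2) by auto
  then show thesis using that ab e by auto
qed

lemma between_eq_0_iff:
  assumes G: "multigraph G" and "A \<inter> B = {}"
  shows "between G A B = 0 \<longleftrightarrow> (\<forall>a\<in>A. \<forall>b\<in>B. {a, b} \<notin># edges G)"
proof
  assume *: "between G A B = 0"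
  show "\<forall>a\<in>A. \<forall>b\<in>B. {a, b} \<notin># edges G"
  proof (intro ballI notI)
    fix a b assume "a \<in> A" "b \<in> B" "{a, b} \<in># edges G"
    then have "{a, b} \<in># {#e \<in># edges G. e \<inter> A \<noteq> {} \<and> e \<inter> B \<noteq> {}#}" by auto
    then show False using * unfolding between_def by auto
  qed
next
  assume "\<forall>a\<in>A. \<forall>b\<in>B. {a, b} \<notin># edges G"
  then show "between G A B = 0"
    by (metis between_pos_edge[OF G assms(2)])
qed

lemma between_singletons:
  assumes G: "multigraph G" and "a \<noteq> b"
  shows "between G {a} {b} = count (edges G) {a, b}"
proof -
  have "e \<inter> {a} \<noteq> {} \<and> e \<inter> {b} \<noteq> {} \<longleftrightarrow> e = {a, b}" if e: "e \<in># edges G" for e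
  proof -
    obtain x y where "e = {x, y}" using multigraph_edgeE[OF G e] by metis
    then show ?thesis using assms(2) by auto
  qed
  then have "{#e \<in># edges G. e \<inter> {a} \<noteq> {} \<and> e \<inter> {b} \<noteq> {}#} = {#e \<in># edges G. e = {a, b}#}"
    by (intro filter_mset_cong) auto
  then show ?thesis
    unfolding between_def by (simp add: filter_eq_replicate_mset)
qed

lemma between_edge_pos:
  assumes "multigraph G" "{a, b} \<in># edges G" "a \<in> A" "b \<in> B"
  shows "between G A B > 0"
proof -
  have "{a, b} \<in># {#e \<in># edges G. e \<inter> A \<noteq> {} \<and> e \<inter> B \<noteq> {}#}" using assms by auto
  then have "{#e \<in># edges G. e \<inter> A \<noteq> {} \<and> e \<inter> B \<noteq> {}#} \<noteq> {#}" by auto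
  then show ?thesis unfolding between_def by (simp only: nonempty_has_size)
qed

lemma edge_connectedD:
  assumes "edge_connected k G" "finite (verts G)" "X \<subseteq> verts G" "X \<noteq> {}" "X \<noteq> verts G"
  shows "cut_degree G X \<ge> k"
proof -
  have "finite X" using assms(2,3) finite_subset by auto
  then have "card X \<ge> 1" using assms(4) by (simp add: Suc_leI card_gt_0_iff)
  moreover have "card (verts G - X) \<ge> 1"
    using assms by (metis Diff_eq_empty_iff Suc_leI One_nat_def card_gt_0_iff finite_Diff subset_antisym)
  ultimately show ?thesis using assms unfolding edge_connected_def by auto
qed

section \<open>Immersion steps\<close>

abbreviation immerses :: "'a mgraph \<Rightarrow> 'a mgraph \<Rightarrow> bool" where
  "immerses \<equiv> immersion_step\<^sup>*\<^sup>*"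

lemma subseteq_mset_pairE:
  assumes "{#a, b#} \<subseteq># M"
  obtains N where "M = add_mset a (add_mset b N)"
  using assms by (auto simp: mset_subset_eq_exists_conv)

lemma immersion_step_multigraph:
  assumes "immersion_step G G'" "multigraph G"
  shows "multigraph G'"
  using assms(1)
proof (cases rule: immersion_step.cases)
  case (split_off x y z)
  obtain N where N: "edges G = add_mset {x, y} (add_mset {y, z} N)"
    using subseteq_mset_pairE[OF split_off(2)] by metis
  then have xyz: "x \<in> verts G" "z \<in> verts G"
    using multigraph_pairD[OF assms(2), of x y] multigraph_pairD[OF assms(2), of y z] by auto
  show ?thesis
  proof
    show "finite (verts G')" using multigraph.finite_verts[OF assms(2)] split_off(1) by simp
    fix e assume "e \<in># edges G'"
    then have "e \<in># N \<or> x \<noteq> z \<and> e = {x, z}"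
      using split_off(1) N by (auto split: if_splits)
    then show "e \<subseteq> verts G' \<and> card e = 2"
      using multigraph.edge_ends[OF assms(2), of e] xyz split_off(1) N by auto
  qed
next
  case (delete_edge e)
  then show ?thesis
    using assms(2) unfolding multigraph_def by (auto dest: in_diffD)
next
  case (delete_vertex v)
  then show ?thesis
    using assms(2) unfolding multigraph_def by auto
qed

lemma immerses_multigraph:
  assumes "immerses G G'" "multigraph G"
  shows "multigraph G'"
  using assms by (induction rule: rtranclp_induct) (auto intro: immersion_step_multigraph)

lemma immersion_step_verts: "immersion_step G G' \<Longrightarrow> verts G' \<subseteq> verts G"
  by (auto elim: immersion_step.cases)

lemma immerses_verts: "immerses G G' \<Longrightarrow> verts G' \<subseteq> verts G"
  by (induction rule: rtranclp_induct) (auto dest: immersion_step_verts)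

section \<open>Contracting a vertex set\<close>

definition collapse :: "'a set \<Rightarrow> 'a \<Rightarrow> 'a \<Rightarrow> 'a" where
  "collapse B b x = (if x \<in> B then b else x)"

text \<open>The new vertex is a chosen member \<open>b\<close> of \<open>B\<close>, so a set
  contracted to a root keeps the name of the root. Edges inside \<open>B\<close> are dropped instead
  of becoming loops.\<close>

definition contract :: "'a set \<Rightarrow> 'a \<Rightarrow> 'a mgraph \<Rightarrow> 'a mgraph" where
  "contract B b G = \<lparr>verts = insert b (verts G - B),
     edges = {#collapse B b ` e. e \<in># {#e \<in># edges G. \<not> e \<subseteq> B#}#}\<rparr>"

lemma verts_contract [simp]: "verts (contract B b G) = insert b (verts G - B)"
  unfolding contract_def by simp

lemma contract_multigraph:
  assumes "multigraph G" "b \<in> B" "B \<subseteq> verts G"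
  shows "multigraph (contract B b G)"
proof
  show "finite (verts (contract B b G))"
    using multigraph.finite_verts[OF assms(1)] by simp
  fix e assume "e \<in># edges (contract B b G)"
  then obtain e' where e': "e' \<in># edges G" "\<not> e' \<subseteq> B" "e = collapse B b ` e'"
    unfolding contract_def by auto
  obtain x y where xy: "e' = {x, y}" "x \<noteq> y" "x \<in> verts G" "y \<in> verts G"
    using multigraph_edgeE[OF assms(1) e'(1)] by metis
  have e: "e = {collapse B b x, collapse B b y}" using e' xy by simp
  have "collapse B b x \<noteq> collapse B b y" using xy(1,2) e'(2) assms(2) unfolding collapse_def by auto
  then show "e \<subseteq> verts (contract B b G) \<and> card e = 2"
    unfolding e using xy assms by (auto simp: collapse_def)
qed

text \<open>Pulling \<open>X\<close> back along \<open>collapse\<close> shows that the cuts of the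
  contraction are the cuts of \<open>G\<close> that do not split \<open>B\<close>; lower bounds on
  cuts are therefore inherited.\<close>

lemma cut_degree_contract:
  assumes G: "multigraph G" and b: "b \<in> B"
  shows "cut_degree (contract B b G) X = cut_degree G (if b \<in> X then X \<union> B else X - B)"
proof -
  have X: "{x. collapse B b x \<in> X} = (if b \<in> X then X \<union> B else X - B)"
    using b unfolding collapse_def by auto
  have *: "card (collapse B b ` e \<inter> X) = 1 \<and> \<not> e \<subseteq> B \<longleftrightarrow> card (e \<inter> {x. collapse B b x \<in> X}) = 1"
    if e: "e \<in># edges G" for e
  proof -
    obtain x y where xy: "e = {x, y}" "x \<noteq> y"
      using multigraph_edgeE[OF G e] by metis
    show ?thesis
    proof (cases "collapse B b x = collapse B b y")
      case True
      then have "e \<subseteq> B" using xy b unfolding collapse_def by (auto split: if_splits)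
      moreover have "\<not> card (e \<inter> {x. collapse B b x \<in> X}) = 1"
        unfolding xy(1) card_pair_Int_eq_1[OF xy(2)] using True by simp
      ultimately show ?thesis by simp
    next
      case False
      then have "\<not> e \<subseteq> B" using xy unfolding collapse_def by auto
      then show ?thesis
        unfolding xy(1) card_pair_Int_eq_1[OF xy(2)] using card_pair_Int_eq_1[OF False, of X] by simp
    qed
  qed
  have "cut_degree (contract B b G) X =
      size {#e \<in># edges G. card (collapse B b ` e \<inter> X) = 1 \<and> \<not> e \<subseteq> B#}"
    unfolding cut_degree_def contract_def
    by (simp add: filter_mset_image_mset filter_filter_mset conj_commute)
  also have "\<dots> = cut_degree G {x. collapse B b x \<in> X}"
    unfolding cut_degree_def by (intro arg_cong[where f = size] filter_mset_cong refl *)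
  finally show ?thesis unfolding X .
qed

lemma size_edges_contract: "size (edges (contract B b G)) \<le> size (edges G)"
  unfolding contract_def by (simp add: size_filter_mset_lesseq)

lemma card_verts_contract:
  assumes "finite (verts G)" "B \<subseteq> verts G" "b \<in> B"
  shows "card (verts (contract B b G)) = card (verts G) - card B + 1"
proof -
  have "b \<notin> verts G - B" using assms by auto
  then show ?thesis
    using assms by (simp add: card_Diff_subset finite_subset)
qed

text \<open>Lets the induction in \<open>immerses_contract\<close> contract an inner set
  \<open>Z\<close> first and the rest of \<open>Y\<close> afterwards.\<close>

lemma contract_contract:
  assumes "t \<in> Z" "Z \<subseteq> Y"
  shows "contract (insert t (Y - Z)) t (contract Z t G) = contract Y t G"
proof -
  have 1: "collapse (insert t (Y - Z)) t (collapse Z t x) = collapse Y t x" for x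
    using assms unfolding collapse_def by auto
  have 2: "\<not> e \<subseteq> Z \<and> \<not> collapse Z t ` e \<subseteq> insert t (Y - Z) \<longleftrightarrow> \<not> e \<subseteq> Y" for e
    using assms unfolding collapse_def by (auto split: if_splits)
  have 3: "verts G - Z - insert t (Y - Z) = verts G - Y - {t}" using assms by auto
  have "{#e \<in># edges G. \<not> e \<subseteq> Z \<and> \<not> collapse Z t ` e \<subseteq> insert t (Y - Z)#} = {#e \<in># edges G. \<not> e \<subseteq> Y#}"
    by (intro filter_mset_cong refl 2)
  then show ?thesis
    unfolding contract_def using 3 assms
    by (auto simp: filter_mset_image_mset filter_filter_mset conj_commute image_mset.compositionality
        comp_def image_image 1)
qed

lemma filter_mset_id: "(\<And>x. x \<in># M \<Longrightarrow> P x) \<Longrightarrow> filter_mset P M = M"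
  by (induction M) auto

lemma contract_singleton:
  assumes "multigraph G" "t \<in> verts G"
  shows "contract {t} t G = G"
proof -
  have "collapse {t} t = id" unfolding collapse_def by auto
  moreover have "\<not> e \<subseteq> {t}" if "e \<in># edges G" for e
    using multigraph_edgeE[OF assms(1) that] by fastforce
  then have "{#e \<in># edges G. \<not> e \<subseteq> {t}#} = edges G"
    by (intro filter_mset_id) auto
  ultimately show ?thesis
    unfolding contract_def using assms(2) by (simp add: insert_absorb)
qed

lemma cut_degree_add_mset:
  assumes "edges G = add_mset e N"
  shows "cut_degree G X = cut_degree (G\<lparr>edges := N\<rparr>) X + of_bool (card (e \<inter> X) = 1)"
  unfolding cut_degree_def assms by simp

lemma immersion_step_delete:
  assumes "edges G = add_mset e N"
  shows "immersion_step G (G\<lparr>edges := N\<rparr>)"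
  using immersion_step.delete_edge[of e G] assms by simp

lemma immersion_step_split:
  assumes "edges G = add_mset {x, y} (add_mset {y, z} N)"
  shows "immersion_step G (G\<lparr>edges := if x = z then N else add_mset {x, z} N\<rparr>)"
  using immersion_step.split_off[of x y z G] assms by (auto split: if_splits)

text \<open>
  Menger's theorem in terms of immersions: if no cut between \<open>t\<close> and the complement of \<open>Y\<close> is
  smaller than the one around \<open>Y\<close>, the edges leaving \<open>Y\<close> can be rerouted to \<open>t\<close>.
\<close>

theorem immerses_contract:
  assumes "multigraph G" "Y \<subseteq> verts G" "t \<in> Y"
    and "\<And>Z. t \<in> Z \<Longrightarrow> Z \<subseteq> Y \<Longrightarrow> cut_degree G Y \<le> cut_degree G Z"
  shows "immerses G (contract Y t G)"
  using assms
proof (induction "card (verts G) + size (edges G) + card Y" arbitrary: G Y rule: less_induct)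
  case less
  note G = less.prems(1) and Y = less.prems(2) and t = less.prems(3) and cut = less.prems(4)
  have fin: "finite (verts G)" "finite Y"
    using multigraph.finite_verts[OF G] Y finite_subset by auto
  note pair = card_pair_Int_eq_1
  show ?case
  proof (cases "Y = {t}")
    case True
    then show ?thesis using contract_singleton[OF G] Y by auto
  next
    case not1: False
    show ?thesis
    \<comment> \<open>An intermediate set with a cut no larger than that of \<open>Y\<close> allows
      a contraction in two smaller stages. Without one, every intermediate cut has an edge to spare,
      which pays for a deletion.\<close>
    proof (cases "\<exists>Z. t \<in> Z \<and> Z \<subset> Y \<and> Z \<noteq> {t} \<and> cut_degree G Z \<le> cut_degree G Y")
      case True
      then obtain Z where Z: "t \<in> Z" "Z \<subset> Y" "Z \<noteq> {t}" "cut_degree G Z \<le> cut_degree G Y" by auto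
      have finZ: "finite Z" using Z fin finite_subset by auto
      have ZV: "Z \<subseteq> verts G" using Z Y by auto
      have "{t} \<subset> Z" using Z by auto
      then have cZ: "card Z > 1" using psubset_card_mono[OF finZ, of "{t}"] by simp
      have cZY: "card Z < card Y" using Z(2) fin(2) psubset_card_mono by auto
      have step1: "immerses G (contract Z t G)"
      proof (rule less.hyps)
        show "card (verts G) + size (edges G) + card Z < card (verts G) + size (edges G) + card Y"
          using cZY by simp
        show "multigraph G" "Z \<subseteq> verts G" "t \<in> Z" using G Y Z by auto
        fix Z' assume "t \<in> Z'" "Z' \<subseteq> Z"
        then have "cut_degree G Y \<le> cut_degree G Z'" using cut Z(2) by auto
        then show "cut_degree G Z \<le> cut_degree G Z'" using Z(4) by simp
      qed
      let ?G = "contract Z t G" and ?Y = "insert t (Y - Z)"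
      have mG: "multigraph ?G" using contract_multigraph[OF G Z(1)] Z Y by auto
      have "card (verts ?G) < card (verts G)"
        using card_verts_contract[OF fin(1) ZV Z(1)] cZ card_mono[OF fin(1) ZV] by linarith
      moreover have "card ?Y \<le> card Y" using Z t fin by (intro card_mono) auto
      ultimately have "card (verts ?G) + size (edges ?G) + card ?Y < card (verts G) + size (edges G) +
        card Y"
        using size_edges_contract[of Z t G] by linarith
      then have "immerses ?G (contract ?Y t ?G)"
      proof (rule less.hyps[OF _ mG])
        show "?Y \<subseteq> verts ?G" using Y by auto
        show "t \<in> ?Y" by simp
        fix Z' assume Z': "t \<in> Z'" "Z' \<subseteq> ?Y"
        have "?Y \<union> Z = Y" using Z by auto
        then have "cut_degree ?G ?Y = cut_degree G Y"
          using cut_degree_contract[OF G Z(1), of ?Y] by simp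
        also have "\<dots> \<le> cut_degree G (Z' \<union> Z)" using Z' Z by (intro cut) auto
        also have "\<dots> = cut_degree ?G Z'" using cut_degree_contract[OF G Z(1), of Z'] Z' by simp
        finally show "cut_degree ?G ?Y \<le> cut_degree ?G Z'" .
      qed
      then show ?thesis using step1 contract_contract[OF Z(1), of Y G] Z by auto
    next
      case False
      then have tight: "cut_degree G Y < cut_degree G Z" if "t \<in> Z" "Z \<subset> Y" "Z \<noteq> {t}" for Z
        using that by (meson not_le_imp_less)
      \<comment> \<open>A step is harmless if the contraction of \<open>Y\<close> does not see it
        and the cut hypothesis survives; an edge has been lost, so the induction applies.\<close>
      have via: ?thesis if st: "immersion_step G G'" and eqc: "contract Y t G' = contract Y t G"
        and vs: "verts G' = verts G" and sz: "size (edges G') < size (edges G)"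
        and c: "\<And>Z. t \<in> Z \<Longrightarrow> Z \<subseteq> Y \<Longrightarrow> cut_degree G Y \<le> cut_degree G' Z"
        and cY: "cut_degree G' Y = cut_degree G Y" for G'
      proof -
        have "immerses G' (contract Y t G')"
        proof (rule less.hyps)
          show "card (verts G') + size (edges G') + card Y < card (verts G) + size (edges G) + card Y"
            using vs sz by simp
          show "multigraph G'" using immersion_step_multigraph[OF st G] .
          show "Y \<subseteq> verts G'" using Y vs by simp
          show "t \<in> Y" by (rule t)
          show "cut_degree G' Y \<le> cut_degree G' Z" if "t \<in> Z" "Z \<subseteq> Y" for Z
            using c[OF that] cY by simp
        qed
        then show ?thesis using st eqc by (metis converse_rtranclp_into_rtranclp)
      qed
      have del: ?thesis if e: "{a, b} \<in># edges G" "a \<in> Y" "b \<in> Y"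
        and c: "\<And>Z. t \<in> Z \<Longrightarrow> Z \<subseteq> Y \<Longrightarrow> (a \<in> Z) \<noteq> (b \<in> Z) \<Longrightarrow> cut_degree G Y < cut_degree G Z" for a b
      proof -
        have ab: "a \<noteq> b" using multigraph_pairD[OF G e(1)] by simp
        obtain N where N: "edges G = add_mset {a, b} N" using e(1) by (metis insert_DiffM)
        note cd = cut_degree_add_mset[OF N, unfolded pair[OF ab]]
        show ?thesis
        proof (rule via[OF immersion_step_delete[OF N]])
          show "contract Y t (G\<lparr>edges := N\<rparr>) = contract Y t G"
            using N e unfolding contract_def by simp
          show "cut_degree G Y \<le> cut_degree (G\<lparr>edges := N\<rparr>) Z" if "t \<in> Z" "Z \<subseteq> Y" for Z
            using c[OF that] cut[OF that] cd[of Z] by (cases "(a \<in> Z) \<noteq> (b \<in> Z)") auto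
          show "cut_degree (G\<lparr>edges := N\<rparr>) Y = cut_degree G Y" using cd[of Y] e by auto
        qed (use N in auto)
      qed
      show ?thesis
      proof (cases "\<exists>a\<in>Y - {t}. \<exists>b\<in>Y - {t}. {a, b} \<in># edges G")
        case True
        then obtain a b where ab: "a \<in> Y - {t}" "b \<in> Y - {t}" "{a, b} \<in># edges G" by auto
        show ?thesis
        proof (rule del[OF ab(3)])
          \<comment> \<open>A set that separates \<open>a\<close> from \<open>b\<close> is neither
            \<open>{t}\<close> nor \<open>Y\<close>, so it has an edge to spare.\<close>
          fix Z assume "t \<in> Z" "Z \<subseteq> Y" "(a \<in> Z) \<noteq> (b \<in> Z)"
          then show "cut_degree G Y < cut_degree G Z" using ab by (intro tight) auto
        qed (use ab in auto)
      next
        case noinner: False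
        show ?thesis
        proof (cases "\<exists>v\<in>Y - {t}. \<exists>w. w \<notin> Y \<and> {t, v} \<in># edges G \<and> {v, w} \<in># edges G")
          case True
          then obtain v w where vw: "v \<in> Y" "v \<noteq> t" "w \<notin> Y" "{t, v} \<in># edges G" "{v, w} \<in># edges G"
            by auto
          have ne: "t \<noteq> w" "v \<noteq> w" "{t, v} \<noteq> {v, w}" using vw t by auto
          obtain N' where N': "edges G = add_mset {t, v} N'" using vw(4) by (metis insert_DiffM)
          then obtain N where N: "edges G = add_mset {t, v} (add_mset {v, w} N)"
            using vw(5) ne(3) by (metis insert_DiffM insert_noteq_member)
          let ?G' = "G\<lparr>edges := add_mset {t, w} N\<rparr>"
          \<comment> \<open>When \<open>t\<close> is in \<open>Z\<close> and \<open>w\<close> is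
            not, exactly one of \<open>tv\<close> and \<open>vw\<close> crosses, wherever
            \<open>v\<close> lies, and so does the new edge \<open>tw\<close>: the relevant cuts do
            not change.\<close>
          have cd: "cut_degree ?G' Z + of_bool ((t \<in> Z) \<noteq> (v \<in> Z)) + of_bool ((v \<in> Z) \<noteq> (w \<in> Z))
              = cut_degree G Z + of_bool ((t \<in> Z) \<noteq> (w \<in> Z))" for Z
            unfolding cut_degree_def N using pair[of t v Z] pair[of v w Z] pair[of t w Z] vw ne by simp
          show ?thesis
          proof (rule via)
            show "immersion_step G ?G'" using immersion_step_split[OF N] ne by simp
            show "contract Y t ?G' = contract Y t G"
              unfolding contract_def using N vw t by (simp add: collapse_def)
            show "cut_degree G Y \<le> cut_degree ?G' Z" if "t \<in> Z" "Z \<subseteq> Y" for Z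
              using cut[OF that] cd[of Z] that vw by (auto split: if_splits simp: of_bool_def)
            show "cut_degree ?G' Y = cut_degree G Y" using cd[of Y] vw t by (auto simp: of_bool_def)
          qed (use N in auto)
        next
          case nosplit: False
          \<comment> \<open>All edges at \<open>v\<close> now lead to \<open>t\<close>, or all of
            them leave \<open>Y\<close>.\<close>
          obtain v where v: "v \<in> Y" "v \<noteq> t" using not1 t by auto
          have nbr: "y = t \<or> y \<notin> Y" if "{v, y} \<in># edges G" for y
            using noinner that v by auto
          show ?thesis
          proof (cases "{t, v} \<in># edges G")
            case True
            then have out: "y = t" if "{v, y} \<in># edges G" for y
              using nbr[OF that] nosplit that v by auto
            show ?thesis
            proof (rule del[OF True t v(1)])
              \<comment> \<open>All edges at \<open>v\<close> end in \<open>t\<close>, so moving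
                \<open>v\<close> into \<open>Z\<close> lowers the cut by the degree of
                \<open>v\<close>, and the result is still at least the cut of
                \<open>Y\<close>.\<close>
              fix Z assume Z: "t \<in> Z" "Z \<subseteq> Y" "(t \<in> Z) \<noteq> (v \<in> Z)"
              have "between G Z {v} > 0" using between_edge_pos[OF G True] Z by auto
              moreover have "cut_degree G (Z \<union> {v}) + 2 * between G Z {v}
                = cut_degree G Z + cut_degree G {v}"
                using cut_degree_Un[OF G, of Z "{v}"] Z by auto
              moreover have "cut_degree G {v} = between G {v} Z"
              proof -
                have "between G {v} (Z \<union> (verts G - insert v Z))
                  = between G {v} Z + between G {v} (verts G - insert v Z)"
                  using Z by (intro between_Un[OF G]) auto
                moreover have "Z \<union> (verts G - insert v Z) = verts G - {v}" using Z Y by auto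
                moreover have "between G {v} (verts G - insert v Z) = 0"
                  using out Z by (subst between_eq_0_iff[OF G]) auto
                ultimately show ?thesis using cut_degree_eq_between[OF G, of "{v}"] by simp
              qed
              moreover have "cut_degree G Y \<le> cut_degree G (Z \<union> {v})" using Z v by (intro cut) auto
              ultimately show "cut_degree G Y < cut_degree G Z"
                using between_commute[of G Z "{v}"] by linarith
            qed
          next
            case False
            \<comment> \<open>All edges at \<open>v\<close> leave \<open>Y\<close>, so omitting
              \<open>v\<close> lowers the cut by its degree. The cut of \<open>Y\<close> being
              minimum, \<open>v\<close> is isolated and can be deleted.\<close>
            have "cut_degree G (Y - {v} \<union> {v}) + 2 * between G (Y - {v}) {v}
              = cut_degree G (Y - {v}) + cut_degree G {v}"
              by (intro cut_degree_Un[OF G]) auto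
            moreover have Yv: "Y - {v} \<union> {v} = Y" using v by auto
            moreover have "between G (Y - {v}) {v} = 0"
              using nbr False by (subst between_eq_0_iff[OF G]) (auto simp: insert_commute)
            moreover have "cut_degree G Y \<le> cut_degree G (Y - {v})" using v t by (intro cut) auto
            ultimately have c0: "cut_degree G {v} = 0" and cY: "cut_degree G (Y - {v}) = cut_degree G Y"
              by simp_all
            have iso: "v \<notin> e" if e: "e \<in># edges G" for e
            proof
              assume "v \<in> e"
              moreover obtain x y where "e = {x, y}" "x \<noteq> y" using multigraph_edgeE[OF G e] by metis
              ultimately have "card (e \<inter> {v}) = 1" by auto
              then have "e \<in># {#e \<in># edges G. card (e \<inter> {v}) = 1#}" using e by simp
              then show False using c0 unfolding cut_degree_def by auto
            qed
            let ?G' = "\<lparr>verts = verts G - {v}, edges = edges G\<rparr>"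
            have "{#e \<in># edges G. v \<notin> e#} = edges G" using iso by (intro filter_mset_id) auto
            then have st: "immersion_step G ?G'" using immersion_step.delete_vertex[of v G] v Y by auto
            have cd: "cut_degree ?G' Z = cut_degree G Z" for Z unfolding cut_degree_def by simp
            have "immerses ?G' (contract (Y - {v}) t ?G')"
            proof (rule less.hyps)
              show "card (verts ?G') + size (edges ?G') + card (Y - {v}) < card (verts G) + size (edges
                G) + card Y"
                using card_Diff1_less[OF fin(1), of v] card_Diff1_le[of Y v] v Y
                unfolding mgraph.select_convs
                  by (simp add: subset_iff add_less_le_mono del: card_Diff_insert)
              show "multigraph ?G'" using immersion_step_multigraph[OF st G] .
              show "Y - {v} \<subseteq> verts ?G'" "t \<in> Y - {v}" using Y v t by auto
              show "cut_degree ?G' (Y - {v}) \<le> cut_degree ?G' Z" if "t \<in> Z" "Z \<subseteq> Y - {v}" for Z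
                unfolding cd cY using that by (intro cut) auto
            qed
            moreover have "contract (Y - {v}) t ?G' = contract Y t G"
            proof -
              have 1: "\<not> e \<subseteq> Y - {v} \<longleftrightarrow> \<not> e \<subseteq> Y" and 2: "collapse (Y - {v}) t ` e = collapse Y t ` e"
                if "e \<in># edges G" for e
                using iso[OF that] unfolding collapse_def by (auto split: if_splits)
              have "{#e \<in># edges G. \<not> e \<subseteq> Y - {v}#} = {#e \<in># edges G. \<not> e \<subseteq> Y#}"
                by (intro filter_mset_cong refl 1)
              moreover have "verts G - {v} - (Y - {v}) = verts G - Y" using v by auto
              moreover have "{#collapse (Y - {v}) t ` e. e \<in># {#e \<in># edges G. \<not> e \<subseteq> Y#}#} =
                  {#collapse Y t ` e. e \<in># {#e \<in># edges G. \<not> e \<subseteq> Y#}#}"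
                by (intro image_mset_cong 2) simp
              ultimately show ?thesis unfolding contract_def by simp
            qed
            ultimately show ?thesis using st by (metis converse_rtranclp_into_rtranclp)
          qed
        qed
      qed
    qed
  qed
qed

section \<open>Deleting an edge and suppressing its ends\<close>

text \<open>
  \<open>S\<close> is the set of suppressed vertices; a cut of \<open>G'\<close> agrees with the cut of \<open>G\<close> in which they are
  placed on suitable sides.
\<close>

definition reduces :: "'a mgraph \<Rightarrow> 'a set \<Rightarrow> 'a mgraph \<Rightarrow> bool" where
  "reduces G S G' \<longleftrightarrow> immerses G G' \<and> verts G' = verts G - S \<and> size (edges G') \<le> size (edges G) \<and>
    (\<forall>B \<subseteq> verts G - S. (\<exists>A \<subseteq> S. cut_degree G' B = cut_degree G (B \<union> A)) \<and>
      cut_degree G' B \<le> cut_degree G B \<and> (even (cut_degree G' B) \<longleftrightarrow> even (cut_degree G B)))"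

lemma reduces_refl: "reduces G {} G"
  unfolding reduces_def by auto

lemma reduces_trans:
  assumes "reduces G S G1" "reduces G1 T G2" "T \<subseteq> verts G1"
  shows "reduces G (S \<union> T) G2"
  unfolding reduces_def
proof (intro conjI allI impI)
  show "immerses G G2" using assms unfolding reduces_def by (meson rtranclp_trans)
  have v: "verts G1 = verts G - S" "verts G2 = verts G1 - T" using assms unfolding reduces_def by auto
  then show "verts G2 = verts G - (S \<union> T)" by auto
  show "size (edges G2) \<le> size (edges G)" using assms unfolding reduces_def by auto
  fix B assume B: "B \<subseteq> verts G - (S \<union> T)"
  have B1: "B \<subseteq> verts G1 - T" "B \<subseteq> verts G - S" using B v by auto
  obtain A2 where A2: "A2 \<subseteq> T" "cut_degree G2 B = cut_degree G1 (B \<union> A2)"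
    using assms(2) B1(1) unfolding reduces_def by blast
  have "B \<union> A2 \<subseteq> verts G - S" using B v A2 assms(3) by auto
  then obtain A1 where A1: "A1 \<subseteq> S" "cut_degree G1 (B \<union> A2) = cut_degree G (B \<union> A2 \<union> A1)"
    using assms(1) unfolding reduces_def by blast
  show "\<exists>A \<subseteq> S \<union> T. cut_degree G2 B = cut_degree G (B \<union> A)"
    using A1 A2 by (intro exI[of _ "A1 \<union> A2"]) (auto simp: Un_ac)
  have "cut_degree G2 B \<le> cut_degree G1 B \<and> (even (cut_degree G2 B) \<longleftrightarrow> even (cut_degree G1 B))"
    using assms(2) B1(1) unfolding reduces_def by blast
  moreover have "cut_degree G1 B \<le> cut_degree G B \<and> (even (cut_degree G1 B) \<longleftrightarrow> even (cut_degree G B))"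
    using assms(1) B1(2) unfolding reduces_def by blast
  ultimately show "cut_degree G2 B \<le> cut_degree G B" "even (cut_degree G2 B) \<longleftrightarrow> even (cut_degree G B)"
    by simp_all
qed

lemma size_2_msetE:
  assumes "size M = 2"
  obtains a b where "M = {#a, b#}"
proof -
  obtain a N where N: "M = add_mset a N" "size N = 1"
    using assms size_eq_Suc_imp_eq_union[of M 1] by auto
  obtain b where "N = {#b#}" using N(2) size_1_singleton_mset by blast
  then show thesis using that N(1) by simp
qed

text \<open>The path \<open>avb\<close> becomes one edge \<open>ab\<close>, or disappears if
  \<open>a = b\<close>. A cut of the new graph is the old cut with \<open>v\<close> placed where the
  path crosses least.\<close>

lemma reduces_suppress:
  assumes G: "multigraph G" and v: "v \<in> verts G" and "cut_degree G {v} = 2"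
  shows "\<exists>G'. reduces G {v} G'"
proof -
  have card: "card (e \<inter> {v}) = 1 \<longleftrightarrow> v \<in> e" for e :: "'a set" by (cases "v \<in> e") auto
  have "size {#e \<in># edges G. v \<in> e#} = 2" using assms(3) unfolding cut_degree_def card .
  then obtain e1 e2 where e12: "{#e \<in># edges G. v \<in> e#} = {#e1, e2#}" by (metis size_2_msetE)
  define N where "N = {#e \<in># edges G. v \<notin> e#}"
  have E: "edges G = add_mset e1 (add_mset e2 N)"
    using multiset_partition[of "edges G" "\<lambda>e. v \<in> e"] e12 unfolding N_def by simp
  have "e1 \<in># {#e1, e2#}" "e2 \<in># {#e1, e2#}" by auto
  then have e: "e1 \<in># edges G" "v \<in> e1" "e2 \<in># edges G" "v \<in> e2" unfolding e12[symmetric] by auto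
  obtain a where a: "e1 = {a, v}" "a \<noteq> v" using multigraph_edgeE[OF G e(1)] e(2)
    by (metis doubleton_eq_iff insertE singletonD)
  obtain b where b: "e2 = {v, b}" "b \<noteq> v" using multigraph_edgeE[OF G e(3)] e(4)
    by (metis doubleton_eq_iff insertE singletonD)
  let ?N = "if a = b then N else add_mset {a, b} N"
  let ?G1 = "G\<lparr>edges := ?N\<rparr>" and ?G' = "\<lparr>verts = verts G - {v}, edges = ?N\<rparr>"
  have "immersion_step G ?G1" using immersion_step_split E a b by metis
  moreover have vN: "v \<notin> e" if "e \<in># ?N" for e using that a b unfolding N_def by (auto split: if_splits)
  then have "{#e \<in># ?N. v \<notin> e#} = ?N" by (intro filter_mset_id) auto
  then have "immersion_step ?G1 ?G'" using immersion_step.delete_vertex[of v ?G1] v by simp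
  ultimately have "immerses G ?G'" by (meson converse_rtranclp_into_rtranclp r_into_rtranclp)
  moreover have sz: "size ?N \<le> size (edges G)" using E by auto
  moreover have cd: "cut_degree ?G' B = cut_degree ?G' (insert v B)" for B
    unfolding cut_degree_def using vN by (intro arg_cong[where f = size] filter_mset_cong) auto
  have c: "cut_degree G B + of_bool ((a \<in> B) \<noteq> (b \<in> B)) =
      cut_degree ?G' B + of_bool ((a \<in> B) \<noteq> (v \<in> B)) + of_bool ((b \<in> B) \<noteq> (v \<in> B))" for B
    unfolding cut_degree_def E a b
    using card_pair_Int_eq_1[of a v B] card_pair_Int_eq_1[of v b B] card_pair_Int_eq_1[of a b B] a b by auto
  have "(\<exists>A \<subseteq> {v}. cut_degree ?G' B = cut_degree G (B \<union> A)) \<and>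
      cut_degree ?G' B \<le> cut_degree G B \<and> (even (cut_degree ?G' B) \<longleftrightarrow> even (cut_degree G B))"
    if "B \<subseteq> verts G - {v}" for B
  proof -
    have vB: "v \<notin> B" using that by auto
    have 1: "cut_degree G B + of_bool ((a \<in> B) \<noteq> (b \<in> B))
      = cut_degree ?G' B + of_bool (a \<in> B) + of_bool (b \<in> B)"
      using c[of B] vB by simp
    have 2: "cut_degree G (insert v B) + of_bool ((a \<in> B) \<noteq> (b \<in> B))
      = cut_degree ?G' B + of_bool (a \<notin> B) + of_bool (b \<notin> B)"
      using c[of "insert v B"] cd[of B] a b by simp
    have "cut_degree ?G' B = cut_degree G B \<or> cut_degree ?G' B = cut_degree G (insert v B)"
      using 1 2 by (cases "a \<in> B"; cases "b \<in> B") auto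
    then have "\<exists>A \<subseteq> {v}. cut_degree ?G' B = cut_degree G (B \<union> A)"
      by (metis Un_empty_right Un_insert_right empty_subsetI subset_refl)
    moreover have "cut_degree ?G' B \<le> cut_degree G B" "even (cut_degree ?G' B) \<longleftrightarrow> even (cut_degree G B)"
      using 1 by (cases "a \<in> B"; cases "b \<in> B"; auto)+
    ultimately show ?thesis by blast
  qed
  ultimately show ?thesis unfolding reduces_def by (intro exI[of _ ?G']) simp
qed

text \<open>\<open>R\<close> collects vertices that must survive; it is later the set of roots. If
  both ends have degree three, the bound on the cut of \<open>{u, v}\<close> excludes three parallel
  edges \<open>uv\<close>, so \<open>v\<close> still has degree two after \<open>u\<close> has been
  suppressed.\<close>

lemma delete_suppress:
  assumes G: "multigraph G" and E: "edges G = add_mset {u, v} N"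
    and "cut_degree G {u, v} \<ge> 2"
  shows "\<exists>G'. reduces (G\<lparr>edges := N\<rparr>) {w \<in> {u, v} - R. cut_degree G {w} = 3} G'"
proof -
  let ?D = "G\<lparr>edges := N\<rparr>"
  have uv: "u \<noteq> v" "u \<in> verts G" "v \<in> verts G" using multigraph_pairD[OF G, of u v] E by auto
  note cd = cut_degree_add_mset[OF E, unfolded card_pair_Int_eq_1[OF uv(1)]]
  have D: "multigraph ?D" using immersion_step_multigraph[OF immersion_step_delete[OF E] G] .
  have c: "cut_degree ?D {u} + 1 = cut_degree G {u}" "cut_degree ?D {v} + 1 = cut_degree G {v}"
    "cut_degree ?D {u, v} \<ge> 2" using cd[of "{u}"] cd[of "{v}"] cd[of "{u, v}"] uv assms(3) by auto
  let ?P = "\<lambda>w. w \<notin> R \<and> cut_degree G {w} = 3"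
  obtain G1 where G1: "reduces ?D (if ?P u then {u} else {}) G1"
    using reduces_suppress[OF D, of u] reduces_refl[of ?D] uv c by (cases "?P u") auto
  have mG1: "multigraph G1" using G1 D immerses_multigraph unfolding reduces_def by blast
  have vG1: "v \<in> verts G1" using G1 uv unfolding reduces_def by (auto split: if_splits)
  obtain G2 where G2: "reduces G1 (if ?P v then {v} else {}) G2"
  proof (cases "?P v")
    case True
    have *: "{v} \<subseteq> verts ?D - (if ?P u then {u} else {})" using uv by auto
    obtain A where A: "A \<subseteq> (if ?P u then {u} else {})" "cut_degree G1 {v} = cut_degree ?D ({v} \<union> A)"
      using G1 * unfolding reduces_def by blast
    have le: "cut_degree G1 {v} \<le> cut_degree ?D {v}" using G1 * unfolding reduces_def by blast
    have "A = {} \<or> A = {u}" using A(1) by (auto split: if_splits)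
    then have "cut_degree G1 {v} = 2"
      using A(2) le c True by (auto simp: insert_commute)
    then show ?thesis using that reduces_suppress[OF mG1 vG1] True by auto
  next
    case False
    then have *: "(if ?P v then {v} else {}) = {}" by (simp only: if_False)
    show ?thesis by (rule that[of G1, unfolded *]) (rule reduces_refl)
  qed
  have "reduces ?D ((if ?P u then {u} else {}) \<union> (if ?P v then {v} else {})) G2"
    using reduces_trans[OF G1 G2] vG1 by auto
  moreover have "(if ?P u then {u} else {}) \<union> (if ?P v then {v} else {})
    = {w \<in> {u, v} - R. cut_degree G {w} = 3}"
    by auto
  ultimately show ?thesis by metis
qed

section \<open>Graphs on four vertices\<close>

text \<open>Opposite edges have mirrored positions among the multiplicities: \<open>a\<close> and
  \<open>f\<close>, \<open>b\<close> and \<open>e\<close>, \<open>c\<close> and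
  \<open>d\<close>.\<close>

definition four_graph :: "'a \<Rightarrow> 'a \<Rightarrow> 'a \<Rightarrow> 'a \<Rightarrow> nat \<Rightarrow> nat \<Rightarrow> nat \<Rightarrow> nat \<Rightarrow> nat \<Rightarrow> nat \<Rightarrow> 'a mgraph" where
  "four_graph x y z w a b c d e f = \<lparr>verts = {x, y, z, w}, edges =
     replicate_mset a {x, y} + replicate_mset b {x, z} + replicate_mset c {x, w} +
     replicate_mset d {y, z} + replicate_mset e {y, w} + replicate_mset f {z, w}\<rparr>"

text \<open>On four vertices every vertex is a branch vertex, so the analysis need not say which two
  are the roots.\<close>

definition completes :: "'a mgraph \<Rightarrow> bool" where
  "completes G \<longleftrightarrow> immerses G (complete_graph (verts G))"

lemma completes_step:
  assumes "immersion_step G G'" "verts G' = verts G" "completes G'"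
  shows "completes G"
  using assms unfolding completes_def by (simp add: converse_rtranclp_into_rtranclp)

lemma immerses_subset_edges:
  assumes "N \<subseteq># edges G"
  shows "immerses G (G\<lparr>edges := N\<rparr>)"
proof -
  have "immerses (G\<lparr>edges := N + M\<rparr>) (G\<lparr>edges := N\<rparr>)" for M
  proof (induction M)
    case (add e M)
    have "immersion_step (G\<lparr>edges := N + add_mset e M\<rparr>) (G\<lparr>edges := N + M\<rparr>)"
      using immersion_step_delete[of "G\<lparr>edges := N + add_mset e M\<rparr>" e "N + M"] by simp
    then show ?case using add.IH by (rule converse_rtranclp_into_rtranclp)
  qed simp
  from this[of "edges G - N"] show ?thesis using assms by simp
qed

lemma two_subsets_of_four:
  assumes "distinct [x, y, z, w]"
  shows "{e. e \<subseteq> {x, y, z, w} \<and> card e = 2} = {{x, y}, {x, z}, {x, w}, {y, z}, {y, w}, {z, w}}"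
    (is "?L = ?R")
proof
  show "?L \<subseteq> ?R"
  proof
    fix e assume "e \<in> ?L"
    then obtain a b where e: "e = {a, b}" "a \<noteq> b" "a \<in> {x, y, z, w}" "b \<in> {x, y, z, w}"
      by (auto simp: card_2_iff)
    show "e \<in> ?R" unfolding e(1) using e(2-4)
      by (elim insertE emptyE) (simp_all add: insert_commute)
  qed
  show "?R \<subseteq> ?L" using assms by auto
qed

lemma complete_graph_four:
  assumes "distinct [x, y, z, w]"
  shows "complete_graph {x, y, z, w} = four_graph x y z w 1 1 1 1 1 1"
proof -
  have "mset_set {{x, y}, {x, z}, {x, w}, {y, z}, {y, w}, {z, w}} =
      {#{x, y}, {x, z}, {x, w}, {y, z}, {y, w}, {z, w}#}"
    using assms by (simp add: doubleton_eq_iff)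
  then show ?thesis
    unfolding complete_graph_def four_graph_def two_subsets_of_four[OF assms] by simp
qed

context
  fixes x y z w :: 'a
  assumes dist: "distinct [x, y, z, w]"
begin

abbreviation (input) Q where "Q a b c d e f \<equiv> completes (four_graph x y z w a b c d e f)"

lemma Q_one: "Q 1 1 1 1 1 1"
proof -
  have "verts (four_graph x y z w 1 1 1 1 1 1) = {x, y, z, w}" unfolding four_graph_def by simp
  then show ?thesis unfolding completes_def by (simp add: complete_graph_four[OF dist])
qed

lemma Q_mono:
  assumes "Q a b c d e f" "a \<le> a'" "b \<le> b'" "c \<le> c'" "d \<le> d'" "e \<le> e'" "f \<le> f'"
  shows "Q a' b' c' d' e' f'"
proof -
  let ?G = "four_graph x y z w a' b' c' d' e' f'" and ?H = "four_graph x y z w a b c d e f"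
  have "edges ?H \<subseteq># edges ?G"
    unfolding four_graph_def mgraph.select_convs
    by (intro subset_mset.add_mono) (use assms in \<open>auto simp: replicate_mset_msubseteq_iff\<close>)
  then have "immerses ?G (?G\<lparr>edges := edges ?H\<rparr>)" by (rule immerses_subset_edges)
  moreover have "?G\<lparr>edges := edges ?H\<rparr> = ?H" "verts ?G = verts ?H" unfolding four_graph_def by simp_all
  ultimately show ?thesis using assms(1) unfolding completes_def by simp
qed

text \<open>Splits read backwards: the third edge of a triangle is exchanged for the other two. Four
  triangles with three choices of the middle vertex give twelve rules.\<close>

lemma Q_split:
  shows "Q a b c (Suc d) e f \<Longrightarrow> Q (Suc a) (Suc b) c d e f"
    and "Q a b c d (Suc e) f \<Longrightarrow> Q (Suc a) b (Suc c) d e f"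
    and "Q a b c d e (Suc f) \<Longrightarrow> Q a (Suc b) (Suc c) d e f"
    and "Q a (Suc b) c d e f \<Longrightarrow> Q (Suc a) b c (Suc d) e f"
    and "Q a b (Suc c) d e f \<Longrightarrow> Q (Suc a) b c d (Suc e) f"
    and "Q a b c d e (Suc f) \<Longrightarrow> Q a b c (Suc d) (Suc e) f"
    and "Q (Suc a) b c d e f \<Longrightarrow> Q a (Suc b) c (Suc d) e f"
    and "Q a b (Suc c) d e f \<Longrightarrow> Q a (Suc b) c d e (Suc f)"
    and "Q a b c d (Suc e) f \<Longrightarrow> Q a b c (Suc d) e (Suc f)"
    and "Q (Suc a) b c d e f \<Longrightarrow> Q a b (Suc c) d (Suc e) f"
    and "Q a (Suc b) c d e f \<Longrightarrow> Q a b (Suc c) d e (Suc f)"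
    and "Q a b c (Suc d) e f \<Longrightarrow> Q a b c d (Suc e) (Suc f)"
proof -
  have *: "completes G" if "edges G = add_mset {p, q} (add_mset {q, r} N)" "p \<noteq> r"
    "verts G' = verts G" "edges G' = add_mset {p, r} N" "completes G'" for G G' :: "'a mgraph" and p q r N
  proof (rule completes_step[OF _ _ that(5)])
    have "G' = G\<lparr>edges := add_mset {p, r} N\<rparr>" using that by (cases G; cases G') simp
    then show "immersion_step G G'" using immersion_step_split[OF that(1)] that(2) by simp
  qed (rule that(3))
  let ?N = "replicate_mset a {x, y} + replicate_mset b {x, z} + replicate_mset c {x, w} +
     replicate_mset d {y, z} + replicate_mset e {y, w} + replicate_mset f {z, w}"
  show "Q a b c (Suc d) e f \<Longrightarrow> Q (Suc a) (Suc b) c d e f"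
    by (rule *[of _ y x z ?N]) (use dist in \<open>auto simp: four_graph_def insert_commute\<close>)
  show "Q a b c d (Suc e) f \<Longrightarrow> Q (Suc a) b (Suc c) d e f"
    by (rule *[of _ y x w ?N]) (use dist in \<open>auto simp: four_graph_def insert_commute\<close>)
  show "Q a b c d e (Suc f) \<Longrightarrow> Q a (Suc b) (Suc c) d e f"
    by (rule *[of _ z x w ?N]) (use dist in \<open>auto simp: four_graph_def insert_commute\<close>)
  show "Q a (Suc b) c d e f \<Longrightarrow> Q (Suc a) b c (Suc d) e f"
    by (rule *[of _ x y z ?N]) (use dist in \<open>auto simp: four_graph_def insert_commute\<close>)
  show "Q a b (Suc c) d e f \<Longrightarrow> Q (Suc a) b c d (Suc e) f"
    by (rule *[of _ x y w ?N]) (use dist in \<open>auto simp: four_graph_def insert_commute\<close>)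
  show "Q a b c d e (Suc f) \<Longrightarrow> Q a b c (Suc d) (Suc e) f"
    by (rule *[of _ z y w ?N]) (use dist in \<open>auto simp: four_graph_def insert_commute\<close>)
  show "Q (Suc a) b c d e f \<Longrightarrow> Q a (Suc b) c (Suc d) e f"
    by (rule *[of _ x z y ?N]) (use dist in \<open>auto simp: four_graph_def insert_commute\<close>)
  show "Q a b (Suc c) d e f \<Longrightarrow> Q a (Suc b) c d e (Suc f)"
    by (rule *[of _ x z w ?N]) (use dist in \<open>auto simp: four_graph_def insert_commute\<close>)
  show "Q a b c d (Suc e) f \<Longrightarrow> Q a b c (Suc d) e (Suc f)"
    by (rule *[of _ y z w ?N]) (use dist in \<open>auto simp: four_graph_def insert_commute\<close>)
  show "Q (Suc a) b c d e f \<Longrightarrow> Q a b (Suc c) d (Suc e) f"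
    by (rule *[of _ x w y ?N]) (use dist in \<open>auto simp: four_graph_def insert_commute\<close>)
  show "Q a (Suc b) c d e f \<Longrightarrow> Q a b (Suc c) d e (Suc f)"
    by (rule *[of _ x w z ?N]) (use dist in \<open>auto simp: four_graph_def insert_commute\<close>)
  show "Q a b c (Suc d) e f \<Longrightarrow> Q a b c d (Suc e) (Suc f)"
    by (rule *[of _ y w z ?N]) (use dist in \<open>auto simp: four_graph_def insert_commute\<close>)
qed

text \<open>Thresholds for the case distinctions to come, found by undoing splits from K4. The
  missing edge \<open>xy\<close> is the outcome of a split at \<open>z\<close> or
  \<open>w\<close>.\<close>

lemma Q_one_missing:
  shows "Q 0 2 1 2 1 1" "Q 0 1 2 1 2 1" "Q 0 2 1 1 2 2" "Q 0 1 2 2 1 2"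
proof -
  show 1: "Q 0 2 1 2 1 1" using Q_split(7)[of 0 1 1 1 1 1] Q_one by (simp add: numeral_2_eq_2)
  show 2: "Q 0 1 2 1 2 1" using Q_split(10)[of 0 1 1 1 1 1] Q_one by (simp add: numeral_2_eq_2)
  show "Q 0 2 1 1 2 2" using Q_split(8)[of 0 1 1 1 2 1] 2 by (simp add: numeral_2_eq_2)
  show "Q 0 1 2 2 1 2" using Q_split(11)[of 0 1 1 2 1 1] 1 by (simp add: numeral_2_eq_2)
qed

text \<open>All edges at \<open>x\<close> go to \<open>w\<close>: of the three, one stays and the
  other two are rerouted into \<open>xy\<close> and \<open>xz\<close>.\<close>

lemma Q_two_adjacent_missing:
  shows "Q 0 0 3 1 2 2" "Q 0 0 3 2 1 3" "Q 0 0 3 2 3 1" "Q 0 0 3 0 3 3" "Q 0 0 3 3 0 4" "Q 0 0 3 3 4 0"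
proof -
  have "Q 1 0 2 1 1 2" using Q_split(11)[of 1 0 1 1 1 1] Q_one by (simp add: numeral_2_eq_2)
  then show 1: "Q 0 0 3 1 2 2" using Q_split(10)[of 0 0 2 1 1 2] by (simp add: eval_nat_numeral)
  show 2: "Q 0 0 3 2 1 3" using Q_split(11)[of 0 0 2 2 1 2] Q_one_missing(4) by (simp add: eval_nat_numeral)
  have "Q 2 0 1 2 1 1" using Q_split(4)[of 1 0 1 1 1 1] Q_one by (simp add: eval_nat_numeral)
  then have "Q 1 0 2 2 2 1" using Q_split(10)[of 1 0 1 2 1 1] by (simp add: eval_nat_numeral)
  then show 3: "Q 0 0 3 2 3 1" using Q_split(10)[of 0 0 2 2 2 1] by (simp add: eval_nat_numeral)
  show "Q 0 0 3 0 3 3" using Q_split(12)[of 0 0 3 0 2 2] 1 by (simp add: eval_nat_numeral)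
  show "Q 0 0 3 3 0 4" using Q_split(9)[of 0 0 3 2 0 3] 2 by (simp add: eval_nat_numeral)
  show "Q 0 0 3 3 4 0" using Q_split(6)[of 0 0 3 2 3 0] 3 by (simp add: eval_nat_numeral)
qed

text \<open>Each vector has eight edges, as many as the doubled cycle \<open>0 2 2 2 2 0\<close>,
  but distributed with a multiplicity three.\<close>

lemma Q_two_opposite_missing:
  shows "Q 0 3 2 2 1 0" "Q 0 2 1 3 2 0" "Q 0 2 3 1 2 0" "Q 0 1 2 2 3 0"
proof -
  show "Q 0 3 2 2 1 0" using Q_split(3)[of 0 2 1 2 1 0] Q_one_missing(1) by (simp add: eval_nat_numeral)
  show "Q 0 2 1 3 2 0" using Q_split(6)[of 0 2 1 2 1 0] Q_one_missing(1) by (simp add: eval_nat_numeral)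
  show "Q 0 2 3 1 2 0" using Q_split(3)[of 0 1 2 1 2 0] Q_one_missing(2) by (simp add: eval_nat_numeral)
  show "Q 0 1 2 2 3 0" using Q_split(6)[of 0 1 2 1 2 0] Q_one_missing(2) by (simp add: eval_nat_numeral)
qed

end

section \<open>Cut conditions on four vertices\<close>

lemma cut_degree_four:
  assumes G: "multigraph G" and V: "verts G = {x, y, z, w}" and dist: "distinct [x, y, z, w]"
  defines "m \<equiv> \<lambda>u v. count (edges G) {u, v}"
  shows "cut_degree G {x} = m x y + m x z + m x w"
    and "cut_degree G {x, y} = m x z + m x w + m y z + m y w"
proof -
  have b3: "between G {p} {q, r, s} = m p q + m p r + m p s" and b2: "between G {p} {q, r} = m p q + m p r"
    if "distinct [p, q, r, s]" for p q r s
    using that between_Un[OF G, of "{p}" "{q}" "{r, s}"] between_Un[OF G, of "{p}" "{r}" "{s}"]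
      between_Un[OF G, of "{p}" "{q}" "{r}"]
    by (simp_all add: between_singletons[OF G] m_def insert_commute)
  have "verts G - {x} = {y, z, w}" "verts G - {x, y} = {z, w}" using V dist by auto
  then show "cut_degree G {x} = m x y + m x z + m x w"
    using b3[OF dist] cut_degree_eq_between[OF G, of "{x}"] by simp
  have "{x} \<union> {y} = {x, y}" "{z, w} \<inter> ({x} \<union> {y}) = {}" "{x} \<inter> {y} = {}" using dist by auto
  then have "between G {z, w} {x, y} = between G {z, w} {x} + between G {z, w} {y}"
    using between_Un[OF G, of "{z, w}" "{x}" "{y}"] by simp
  moreover have "between G {z, w} {x} = m x z + m x w" "between G {z, w} {y} = m y z + m y w"
    using b2[of x z w y] b2[of y z w x] dist between_commute[of G "{z, w}"] by force+
  ultimately show "cut_degree G {x, y} = m x z + m x w + m y z + m y w"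
    using cut_degree_eq_between[OF G, of "{x, y}"] \<open>verts G - {x, y} = {z, w}\<close>
      between_commute[of G "{x, y}" "{z, w}"] by simp
qed

lemma eq_four_graph:
  assumes G: "multigraph G" and V: "verts G = {x, y, z, w}" and dist: "distinct [x, y, z, w]"
  defines "m \<equiv> \<lambda>u v. count (edges G) {u, v}"
  shows "G = four_graph x y z w (m x y) (m x z) (m x w) (m y z) (m y w) (m z w)"
proof -
  let ?H = "four_graph x y z w (m x y) (m x z) (m x w) (m y z) (m y w) (m z w)"
  have "count (edges G) e = count (edges ?H) e" for e
  proof (cases "e \<in># edges G \<or> e \<in># edges ?H")
    case True
    then have "e \<in> {e. e \<subseteq> {x, y, z, w} \<and> card e = 2}"
      using multigraph.edge_ends[OF G, of e] V dist unfolding four_graph_def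
      by (auto split: if_splits)
    then have "e \<in> {{x, y}, {x, z}, {x, w}, {y, z}, {y, w}, {z, w}}"
      unfolding two_subsets_of_four[OF dist] .
    then show ?thesis
      using dist unfolding four_graph_def m_def by (auto simp: doubleton_eq_iff)
  next
    case False
    then show ?thesis by (metis count_eq_zero_iff)
  qed
  then have "edges G = edges ?H" by (rule multiset_eqI)
  then show ?thesis using V unfolding four_graph_def by (cases G) simp
qed

text \<open>Internal four-connectivity spelled out for four vertices, where every nontrivial cut is
  the cut around one or two vertices.\<close>

definition well_cut_four :: "'a mgraph \<Rightarrow> bool" where
  "well_cut_four G \<longleftrightarrow> multigraph G \<and> (\<forall>x\<in>verts G. cut_degree G {x} \<ge> 3) \<and>
     (\<forall>x\<in>verts G. \<forall>y\<in>verts G. x \<noteq> y \<longrightarrow> cut_degree G {x, y} \<ge> 4)"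

lemma well_cut_fourD:
  assumes W: "well_cut_four G" and V: "verts G = {x, y, z, w}" and dist: "distinct [x, y, z, w]"
  defines "m \<equiv> \<lambda>u v. count (edges G) {u, v}"
  shows "m x y + m x z + m x w \<ge> 3" "m x y + m y z + m y w \<ge> 3" "m x z + m y z + m z w \<ge> 3"
    "m x w + m y w + m z w \<ge> 3" "m x z + m x w + m y z + m y w \<ge> 4"
    "m x y + m x w + m y z + m z w \<ge> 4" "m x y + m x z + m y w + m z w \<ge> 4"
proof -
  have G: "multigraph G" using W unfolding well_cut_four_def by simp
  have c: "m u v = m v u" for u v unfolding m_def by (simp add: insert_commute)
  note d = cut_degree_four[OF G]
  have "cut_degree G {x} = m x y + m x z + m x w" unfolding m_def by (rule d(1)[OF V dist])
  moreover have "cut_degree G {y} = m y x + m y z + m y w" unfolding m_def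
    by (rule d(1)) (use V dist in auto)
  moreover have "cut_degree G {z} = m z x + m z y + m z w" unfolding m_def
    by (rule d(1)) (use V dist in auto)
  moreover have "cut_degree G {w} = m w x + m w y + m w z" unfolding m_def
    by (rule d(1)) (use V dist in auto)
  moreover have "cut_degree G {x, y} = m x z + m x w + m y z + m y w" unfolding m_def
    by (rule d(2)[OF V dist])
  moreover have "cut_degree G {x, z} = m x y + m x w + m z y + m z w" unfolding m_def
    by (rule d(2)) (use V dist in auto)
  moreover have "cut_degree G {x, w} = m x y + m x z + m w y + m w z" unfolding m_def
    by (rule d(2)) (use V dist in auto)
  moreover have "cut_degree G {x} \<ge> 3" "cut_degree G {y} \<ge> 3" "cut_degree G {z} \<ge> 3" "cut_degree G {w} \<ge> 3"
    "cut_degree G {x, y} \<ge> 4" "cut_degree G {x, z} \<ge> 4" "cut_degree G {x, w} \<ge> 4"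
    using W V dist unfolding well_cut_four_def by auto
  ultimately show "m x y + m x z + m x w \<ge> 3" "m x y + m y z + m y w \<ge> 3" "m x z + m y z + m z w \<ge> 3"
    "m x w + m y w + m z w \<ge> 3" "m x z + m x w + m y z + m y w \<ge> 4"
    "m x y + m x w + m y z + m z w \<ge> 4" "m x y + m x z + m y w + m z w \<ge> 4"
    using c[of x y] c[of x z] c[of x w] c[of y z] c[of y w] c[of z w] by linarith+
qed

text \<open>The cut around \<open>x\<close> puts at least three edges on \<open>xw\<close>. What
  remains is a triangle \<open>yzw\<close>, and the cases differ in which of its edges is
  scarce.\<close>

lemma four_two_adjacent_missing:
  assumes W: "well_cut_four G" and V: "verts G = {x, y, z, w}" and dist: "distinct [x, y, z, w]"
    and "{x, y} \<notin># edges G" "{x, z} \<notin># edges G"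
  shows "completes G"
proof -
  define c d e f where "c = count (edges G) {x, w}" "d = count (edges G) {y, z}"
    "e = count (edges G) {y, w}" "f = count (edges G) {z, w}"
  have G: "multigraph G" using W unfolding well_cut_four_def by simp
  have z: "count (edges G) {x, y} = 0" "count (edges G) {x, z} = 0"
    using assms(4,5) by (auto simp: count_eq_zero_iff)
  have eq: "G = four_graph x y z w 0 0 c d e f"
    using eq_four_graph[OF G V dist] z unfolding c_d_e_f_def by simp
  have ineq: "c \<ge> 3" "d + e \<ge> 3" "d + f \<ge> 3" "e + f \<ge> 4"
    using well_cut_fourD[OF W V dist] z unfolding c_d_e_f_def by simp_all
  note Q = Q_two_adjacent_missing[OF dist] and mono = Q_mono[OF dist]
  consider "e \<ge> 2" "f \<ge> 2" "d \<ge> 1" | "d = 0" | "e = 1" | "f = 1" | "e = 0" | "f = 0" by linarith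
  then show ?thesis
  proof cases
    case 1
    then show ?thesis unfolding eq using ineq by (intro mono[OF Q(1)]) auto
  next
    case 2
    then show ?thesis unfolding eq using ineq by (intro mono[OF Q(4)]) auto
  next
    case 3
    then show ?thesis unfolding eq using ineq by (intro mono[OF Q(2)]) auto
  next
    case 4
    then show ?thesis unfolding eq using ineq by (intro mono[OF Q(3)]) auto
  next
    case 5
    then show ?thesis unfolding eq using ineq by (intro mono[OF Q(5)]) auto
  next
    case 6
    then show ?thesis unfolding eq using ineq by (intro mono[OF Q(6)]) auto
  qed
qed

text \<open>The absent pairs \<open>xy\<close> and \<open>zw\<close> are the diagonals of the cycle
  \<open>x z y w\<close>.\<close>

lemma doubled_four_cycle:
  assumes "distinct [x, y, z, w]"
  shows "doubled_cycle (four_graph x y z w 0 2 2 2 2 0)"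
proof -
  let ?vs = "[x, z, y, w]"
  let ?C = "\<lparr>verts = set ?vs, edges
    = {#{?vs ! i, ?vs ! (Suc i mod length ?vs)}. i \<in># mset [0..<length ?vs]#}\<rparr>"
  have "cycle_graph ?C" unfolding cycle_graph_def using assms by (intro exI[of _ ?vs]) auto
  moreover have "verts (four_graph x y z w 0 2 2 2 2 0) = verts ?C"
    unfolding four_graph_def by auto
  moreover have "edges (four_graph x y z w 0 2 2 2 2 0) = edges ?C + edges ?C"
    unfolding four_graph_def by (simp add: numeral_2_eq_2 upt_rec insert_commute)
  ultimately show ?thesis unfolding doubled_cycle_def by blast
qed

text \<open>If \<open>zw\<close> is present, one of the thresholds is met. If it is absent too, the
  cut inequalities leave either a multiplicity of at least three that meets a threshold or exactly
  the doubled cycle.\<close>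

lemma four_one_missing:
  assumes W: "well_cut_four G" and V: "verts G = {x, y, z, w}" and dist: "distinct [x, y, z, w]"
    and "{x, y} \<notin># edges G"
      and pos: "{x, z} \<in># edges G" "{x, w} \<in># edges G" "{y, z} \<in># edges G" "{y, w} \<in># edges G"
  shows "completes G \<or> doubled_cycle G"
proof -
  define b c d e f where "b = count (edges G) {x, z}" "c = count (edges G) {x, w}"
    "d = count (edges G) {y, z}" "e = count (edges G) {y, w}" "f = count (edges G) {z, w}"
  note defs = b_c_d_e_f_def
  have G: "multigraph G" using W unfolding well_cut_four_def by simp
  have z: "count (edges G) {x, y} = 0"
    using assms(4) by (auto simp: count_eq_zero_iff)
  have eq: "G = four_graph x y z w 0 b c d e f"
    using eq_four_graph[OF G V dist] z unfolding defs by simp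
  have ineq: "b + c \<ge> 3" "d + e \<ge> 3" "b + d + f \<ge> 3" "c + e + f \<ge> 3" "c + d + f \<ge> 4" "b + e + f \<ge> 4"
    using well_cut_fourD[OF W V dist] z unfolding defs by simp_all
  have p: "b \<ge> 1" "c \<ge> 1" "d \<ge> 1" "e \<ge> 1" using pos unfolding defs by (simp_all add: Suc_le_eq)
  note mono = Q_mono[OF dist]
  show ?thesis
  proof (cases "f = 0")
    case False
    note Q = Q_one_missing[OF dist]
    consider "b \<ge> 2" "d \<ge> 2" | "c \<ge> 2" "e \<ge> 2" | "b \<ge> 2" "e \<ge> 2" "f \<ge> 2" | "c \<ge> 2" "d \<ge> 2" "f \<ge> 2"
      using ineq p False by linarith
    then have "completes G"
    proof cases
      case 1
      then show ?thesis unfolding eq using p False by (intro mono[OF Q(1)]) auto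
    next
      case 2
      then show ?thesis unfolding eq using p False by (intro mono[OF Q(2)]) auto
    next
      case 3
      then show ?thesis unfolding eq using p False by (intro mono[OF Q(3)]) auto
    next
      case 4
      then show ?thesis unfolding eq using p False by (intro mono[OF Q(4)]) auto
    qed
    then show ?thesis ..
  next
    case True
    note Q = Q_two_opposite_missing[OF dist]
    consider "b \<ge> 3" "c \<ge> 2" "d \<ge> 2" | "d \<ge> 3" "b \<ge> 2" "e \<ge> 2" | "c \<ge> 3" "b \<ge> 2" "e \<ge> 2" |
      "e \<ge> 3" "c \<ge> 2" "d \<ge> 2" | "b = 2" "c = 2" "d = 2" "e = 2"
      using ineq p True by linarith
    then show ?thesis
    proof cases
      case 1
      then show ?thesis unfolding eq using p True by (intro disjI1 mono[OF Q(1)]) auto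
    next
      case 2
      then show ?thesis unfolding eq using p True by (intro disjI1 mono[OF Q(2)]) auto
    next
      case 3
      then show ?thesis unfolding eq using p True by (intro disjI1 mono[OF Q(3)]) auto
    next
      case 4
      then show ?thesis unfolding eq using p True by (intro disjI1 mono[OF Q(4)]) auto
    next
      case 5
      then show ?thesis unfolding eq using True doubled_four_cycle[OF dist] by simp
    qed
  qed
qed

lemma four_missing:
  assumes W: "well_cut_four G" and V: "verts G = {x, y, z, w}" and dist: "distinct [x, y, z, w]"
    and xy: "{x, y} \<notin># edges G"
  shows "completes G \<or> doubled_cycle G"
proof -
  have sym: "{u, v} = {v, u}" for u v :: 'a by auto
  consider "{x, z} \<notin># edges G" | "{x, w} \<notin># edges G" | "{y, z} \<notin># edges G" | "{y, w} \<notin># edges G" |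
    "{x, z} \<in># edges G" "{x, w} \<in># edges G" "{y, z} \<in># edges G" "{y, w} \<in># edges G" by blast
  then show ?thesis
  proof cases
    case 1
    then show ?thesis using four_two_adjacent_missing[OF W V dist xy] by simp
  next
    case 2
    have "completes G" by (rule four_two_adjacent_missing[OF W, of x y w z]) (use V dist xy 2 in auto)
    then show ?thesis ..
  next
    case 3
    have "completes G"
      by (rule four_two_adjacent_missing[OF W, of y x z w]) (use V dist xy 3 sym[of x y] in auto)
    then show ?thesis ..
  next
    case 4
    have "completes G"
      by (rule four_two_adjacent_missing[OF W, of y x w z]) (use V dist xy 4 sym[of x y] in auto)
    then show ?thesis ..
  next
    case 5
    then show ?thesis using four_one_missing[OF W V dist xy] by simp
  qed
qed

theorem four_vertices:
  assumes W: "well_cut_four G" and "card (verts G) = 4"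
  shows "completes G \<or> doubled_cycle G"
proof -
  obtain x y z w where V: "verts G = {x, y, z, w}" and dist: "distinct [x, y, z, w]"
  proof -
    obtain x B where B: "verts G = insert x B" "x \<notin> B" "card B = 3"
      using assms(2) card_eq_SucD[of "verts G" 3] by auto
    obtain y z w where "B = {y, z, w}" "y \<noteq> z" "z \<noteq> w" "y \<noteq> w"
      using B(3) unfolding card_3_iff by metis
    then show thesis using that[of x y z w] B by auto
  qed
  have sym: "{u, v} = {v, u}" for u v :: 'a by auto
  have G: "multigraph G" using W unfolding well_cut_four_def by simp
  have "completes G \<or> doubled_cycle G"
    if "{u, v} \<notin># edges G" "{u, v, s, t} = {x, y, z, w}" "distinct [u, v, s, t]" for u v s t
    by (rule four_missing[OF W _ that(3,1)]) (use V that(2) in simp)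
  note * = this
  consider "{x, y} \<notin># edges G" | "{x, z} \<notin># edges G" | "{x, w} \<notin># edges G" | "{y, z} \<notin># edges G" |
    "{y, w} \<notin># edges G" | "{z, w} \<notin># edges G" |
    "{x, y} \<in># edges G" "{x, z} \<in># edges G" "{x, w} \<in># edges G" "{y, z} \<in># edges G"
    "{y, w} \<in># edges G" "{z, w} \<in># edges G" by blast
  then show ?thesis
  proof cases
    case 1 then show ?thesis by (rule *[of x y z w]) (use dist in auto)
  next
    case 2 then show ?thesis by (rule *[of x z y w]) (use dist in auto)
  next
    case 3 then show ?thesis by (rule *[of x w y z]) (use dist in auto)
  next
    case 4 then show ?thesis by (rule *[of y z x w]) (use dist in auto)
  next
    case 5 then show ?thesis by (rule *[of y w x z]) (use dist in auto)
  next
    case 6 then show ?thesis by (rule *[of z w x y]) (use dist in auto)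
  next
    case 7
    have "completes (four_graph x y z w (count (edges G) {x, y}) (count (edges G) {x, z})
        (count (edges G) {x, w}) (count (edges G) {y, z}) (count (edges G) {y, w}) (count (edges G) {z,
          w}))"
      using 7 by (intro Q_mono[OF dist Q_one[OF dist]]) (simp_all add: Suc_le_eq)
    then show ?thesis using eq_four_graph[OF G V dist] by simp
  qed
qed

section \<open>Roots of degree three\<close>

definition three_connected :: "'a mgraph \<Rightarrow> bool" where
  "three_connected G \<longleftrightarrow> multigraph G \<and>
     (\<forall>X \<subseteq> verts G. X \<noteq> {} \<and> X \<noteq> verts G \<longrightarrow> cut_degree G X \<ge> 3)"

definition internally_four_connected :: "'a mgraph \<Rightarrow> bool" where
  "internally_four_connected G \<longleftrightarrow> three_connected G \<and>
     (\<forall>X \<subseteq> verts G. card X \<ge> 2 \<and> card (verts G - X) \<ge> 2 \<longrightarrow> cut_degree G X \<ge> 4)"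

text \<open>K4 sits on vertices of \<open>G\<close> itself, so no isomorphism has to be carried
  along; \<open>rooted_immersion_D3_iff\<close> makes the connection with the rooted notion.\<close>

definition has_D3 :: "'a mgraph \<Rightarrow> 'a \<Rightarrow> 'a \<Rightarrow> bool" where
  "has_D3 G s t \<longleftrightarrow> (\<exists>y z. distinct [s, t, y, z] \<and> immerses G (complete_graph {s, t, y, z}))"

lemma has_D3_immerses: "immerses G G' \<Longrightarrow> has_D3 G' s t \<Longrightarrow> has_D3 G s t"
  unfolding has_D3_def by (meson rtranclp_trans)

lemma has_D3_sym: "has_D3 G s t \<Longrightarrow> has_D3 G t s"
proof -
  assume "has_D3 G s t"
  then obtain y z where "distinct [s, t, y, z]" "immerses G (complete_graph {s, t, y, z})"
    unfolding has_D3_def by auto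
  moreover have "{s, t, y, z} = {t, s, y, z}" by auto
  ultimately show ?thesis unfolding has_D3_def by (intro exI[of _ y] exI[of _ z]) auto
qed

lemma three_connectedD:
  assumes "three_connected G"
  shows "multigraph G" "finite (verts G)"
    and "X \<subseteq> verts G \<Longrightarrow> X \<noteq> {} \<Longrightarrow> X \<noteq> verts G \<Longrightarrow> cut_degree G X \<ge> 3"
  using assms multigraph.finite_verts unfolding three_connected_def by auto

lemma completes_has_D3:
  assumes "completes G" "card (verts G) = 4" "s \<in> verts G" "t \<in> verts G" "s \<noteq> t"
  shows "has_D3 G s t"
proof -
  have "card (verts G - {s, t}) = 2" using assms by (simp add: card_Diff_subset)
  then obtain y z where yz: "verts G - {s, t} = {y, z}" "y \<noteq> z" by (auto simp: card_2_iff)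
  then have "y \<in> verts G - {s, t}" "z \<in> verts G - {s, t}" by auto
  then have "distinct [s, t, y, z]" using yz assms by auto
  moreover have "verts G = {s, t, y, z}" using yz(1) assms by auto
  ultimately show ?thesis using assms(1) unfolding has_D3_def completes_def by auto
qed

lemma singleton_neq: "card A \<ge> 2 \<Longrightarrow> {x} \<noteq> A"
  by auto

text \<open>This excludes doubled cycles after a side of an odd cut has been contracted, since the
  new vertex has odd degree.\<close>

lemma even_cut_degree_doubled_cycle:
  assumes "doubled_cycle G"
  shows "even (cut_degree G X)"
  using assms unfolding doubled_cycle_def cut_degree_def by auto

lemma internally_four_connected_four:
  assumes I: "internally_four_connected G" and "card (verts G) = 4"
  shows "completes G \<or> doubled_cycle G"
proof (rule four_vertices)
  have three: "three_connected G" using I unfolding internally_four_connected_def by simp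
  show "well_cut_four G" unfolding well_cut_four_def
  proof (intro conjI ballI impI)
    show "multigraph G" using three_connectedD[OF three] by simp
    fix x assume x: "x \<in> verts G"
    have "{x} \<noteq> verts G" using assms(2) by (intro singleton_neq) simp
    then show "3 \<le> cut_degree G {x}" using three_connectedD(3)[OF three, of "{x}"] x by simp
    fix y assume "y \<in> verts G" "x \<noteq> y"
    then have "{x, y} \<subseteq> verts G" "card {x, y} = 2" "card (verts G - {x, y}) = 2"
      using x assms(2) by (auto simp: card_Diff_subset)
    then show "4 \<le> cut_degree G {x, y}" using I unfolding internally_four_connected_def by simp
  qed
qed (rule assms(2))

section \<open>Contractions and edge deletions that keep three-connectivity\<close>

lemma contract_three_connected:
  assumes G: "three_connected G" and "b \<in> B" "B \<subseteq> verts G"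
  shows "three_connected (contract B b G)"
  unfolding three_connected_def
proof (intro conjI allI impI)
  note m = three_connectedD(1)[OF G]
  show "multigraph (contract B b G)" using contract_multigraph[OF m assms(2,3)] .
  fix X assume X: "X \<subseteq> verts (contract B b G)" "X \<noteq> {} \<and> X \<noteq> verts (contract B b G)"
  have "(if b \<in> X then X \<union> B else X - B) \<subseteq> verts G"
    "(if b \<in> X then X \<union> B else X - B) \<noteq> {}" "(if b \<in> X then X \<union> B else X - B) \<noteq> verts G"
    using X assms(2,3) by auto
  then show "3 \<le> cut_degree (contract B b G) X"
    unfolding cut_degree_contract[OF m assms(2)] by (rule three_connectedD(3)[OF G])
qed

text \<open>A cut of size three is minimum here, so the condition of
  \<open>immerses_contract\<close> holds automatically.\<close>

lemma immerses_contract_three: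
  assumes G: "three_connected G" and "b \<in> B" "B \<subseteq> verts G" "B \<noteq> verts G" "cut_degree G B = 3"
  shows "immerses G (contract B b G)"
proof (rule immerses_contract[OF three_connectedD(1)[OF G] assms(3,2)])
  fix Z assume "b \<in> Z" "Z \<subseteq> B"
  then show "cut_degree G B \<le> cut_degree G Z"
    unfolding assms(5) using assms(3,4) by (intro three_connectedD(3)[OF G]) auto
qed

text \<open>\<open>reduces\<close> combined with the deletion of \<open>uv\<close>: the
  \<open>of_bool\<close> terms record whether the deleted edge crosses the cut.\<close>

definition edge_reduction :: "'a mgraph \<Rightarrow> 'a \<Rightarrow> 'a \<Rightarrow> 'a set \<Rightarrow> 'a mgraph \<Rightarrow> bool" where
  "edge_reduction G u v S G' \<longleftrightarrow> immerses G G' \<and> three_connected G' \<and> verts G' = verts G - S \<and>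
     size (edges G') < size (edges G) \<and>
     (\<forall>B \<subseteq> verts G - S.
       (\<exists>A \<subseteq> S. cut_degree G' B + of_bool ((u \<in> B \<union> A) \<noteq> (v \<in> B \<union> A)) = cut_degree G (B \<union> A)) \<and>
       cut_degree G' B + of_bool ((u \<in> B) \<noteq> (v \<in> B)) \<le> cut_degree G B \<and>
       (even (cut_degree G' B + of_bool ((u \<in> B) \<noteq> (v \<in> B))) \<longleftrightarrow> even (cut_degree G B)))"

lemma edge_reductionD:
  assumes "edge_reduction G u v S G'"
  shows "immerses G G'" "three_connected G'" "verts G' = verts G - S" "size (edges G') < size (edges G)"
    and "B \<subseteq> verts G' \<Longrightarrow>
      \<exists>A \<subseteq> S. cut_degree G' B + of_bool ((u \<in> B \<union> A) \<noteq> (v \<in> B \<union> A)) = cut_degree G (B \<union> A)"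
    and "B \<subseteq> verts G' \<Longrightarrow> cut_degree G' B + of_bool ((u \<in> B) \<noteq> (v \<in> B)) \<le> cut_degree G B"
    and "B \<subseteq> verts G' \<Longrightarrow>
      even (cut_degree G' B + of_bool ((u \<in> B) \<noteq> (v \<in> B))) \<longleftrightarrow> even (cut_degree G B)"
  using assms unfolding edge_reduction_def by simp_all

text \<open>Lift a cut of \<open>G'\<close> to \<open>G\<close>. With two vertices on both sides it
  has at least four edges and survives the loss of \<open>uv\<close>. Otherwise one side is a single
  unsuppressed vertex, which is no end of \<open>uv\<close> or has degree at least four.\<close>

lemma reduce_edge:
  assumes I: "internally_four_connected G" and V: "card (verts G) \<ge> 4" and uv: "{u, v} \<in># edges G"
    and R: "\<And>w. w \<in> {u, v} \<inter> R \<Longrightarrow> cut_degree G {w} \<ge> 4"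
  defines "S \<equiv> {w \<in> {u, v} - R. cut_degree G {w} = 3}"
  shows "\<exists>G'. edge_reduction G u v S G'"
proof -
  have three: "three_connected G" using I unfolding internally_four_connected_def by simp
  note G = three_connectedD(1)[OF three] and fin = three_connectedD(2)[OF three]
  have uv': "u \<noteq> v" "u \<in> verts G" "v \<in> verts G" using multigraph_pairD[OF G uv] by auto
  have SV: "S \<subseteq> verts G" using uv' unfolding S_def by auto
  obtain N where N: "edges G = add_mset {u, v} N" using uv by (metis insert_DiffM)
  have "card (verts G - {u, v}) \<ge> 2" using V uv' fin by (simp add: card_Diff_subset)
  then have "cut_degree G {u, v} \<ge> 4"
    using I uv' unfolding internally_four_connected_def by auto
  then obtain G' where G': "reduces (G\<lparr>edges := N\<rparr>) S G'"
    using delete_suppress[OF G N, of R] unfolding S_def by auto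
  note cd = cut_degree_add_mset[OF N, unfolded card_pair_Int_eq_1[OF uv'(1)]]
  have verts: "verts G' = verts G - S" using G' unfolding reduces_def by simp
  have imm: "immerses G G'"
    using G' immersion_step_delete[OF N] unfolding reduces_def
      by (simp add: converse_rtranclp_into_rtranclp)
  have size: "size (edges G') < size (edges G)" using G' N unfolding reduces_def by auto
  have ex: "\<exists>A \<subseteq> S. cut_degree G' B + of_bool ((u \<in> B \<union> A) \<noteq> (v \<in> B \<union> A)) = cut_degree G (B \<union> A)"
    and le: "cut_degree G' B + of_bool ((u \<in> B) \<noteq> (v \<in> B)) \<le> cut_degree G B"
    and par: "even (cut_degree G' B + of_bool ((u \<in> B) \<noteq> (v \<in> B))) \<longleftrightarrow> even (cut_degree G B)"
    if "B \<subseteq> verts G - S" for B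
  proof -
    have B: "(\<exists>A \<subseteq> S. cut_degree G' B = cut_degree (G\<lparr>edges := N\<rparr>) (B \<union> A)) \<and>
      cut_degree G' B \<le> cut_degree (G\<lparr>edges := N\<rparr>) B \<and>
      (even (cut_degree G' B) \<longleftrightarrow> even (cut_degree (G\<lparr>edges := N\<rparr>) B))"
      using G' that unfolding reduces_def by simp
    then obtain A where A: "A \<subseteq> S" "cut_degree G' B = cut_degree (G\<lparr>edges := N\<rparr>) (B \<union> A)" by blast
    show "\<exists>A \<subseteq> S. cut_degree G' B + of_bool ((u \<in> B \<union> A) \<noteq> (v \<in> B \<union> A)) = cut_degree G (B \<union> A)"
      using A cd[of "B \<union> A"] by (intro exI[of _ A]) simp
    show "cut_degree G' B + of_bool ((u \<in> B) \<noteq> (v \<in> B)) \<le> cut_degree G B"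
      "even (cut_degree G' B + of_bool ((u \<in> B) \<noteq> (v \<in> B))) \<longleftrightarrow> even (cut_degree G B)"
      using B cd[of B] by simp_all
  qed
  have single: "cut_degree G {x} \<ge> 3 + of_bool ((u \<in> {x}) \<noteq> (v \<in> {x}))" if "x \<in> verts G - S" for x
  proof -
    have "{x} \<noteq> verts G" using V by (intro singleton_neq) simp
    then have "cut_degree G {x} \<ge> 3" using three_connectedD(3)[OF three, of "{x}"] that by auto
    moreover have "cut_degree G {x} \<noteq> 3" if "x \<in> {u, v}"
      using \<open>x \<in> verts G - S\<close> that R[of x] unfolding S_def by auto
    ultimately show ?thesis by (cases "x \<in> {u, v}") auto
  qed
  have "three_connected G'" unfolding three_connected_def
  proof (intro conjI allI impI)
    show "multigraph G'" using immerses_multigraph[OF imm G] .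
    fix B assume B: "B \<subseteq> verts G'" "B \<noteq> {} \<and> B \<noteq> verts G'"
    then obtain A where A: "A \<subseteq> S"
      "cut_degree G' B + of_bool ((u \<in> B \<union> A) \<noteq> (v \<in> B \<union> A)) = cut_degree G (B \<union> A)"
      using ex[of B] verts by auto
    let ?C = "B \<union> A"
    have C: "?C \<subseteq> verts G" using A SV B verts by auto
    have finC: "finite ?C" "finite (verts G - ?C)" using C fin finite_subset by auto
    have B2: "verts G' - B \<noteq> {}" "B \<noteq> {}" using B by auto
    have D: "verts G' - B \<subseteq> verts G - ?C" using A verts by auto
    have "card ?C > 0" "card (verts G - ?C) > 0"
      using B2 D finC by (auto simp: card_gt_0_iff)
    then consider "card ?C \<ge> 2" "card (verts G - ?C) \<ge> 2" | "card ?C = 1" | "card (verts G - ?C) = 1"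
      by linarith
    then show "3 \<le> cut_degree G' B"
    proof cases
      case 1
      then have "cut_degree G ?C \<ge> 4" using I C unfolding internally_four_connected_def by auto
      then show ?thesis using A(2) by (auto simp: of_bool_def split: if_splits)
    next
      case 2
      then obtain x where x: "?C = {x}" by (auto simp: card_1_singleton_iff)
      then have "x \<in> verts G - S" using B2(2) B(1) verts by auto
      then show ?thesis using single[of x] A(2) unfolding x by simp
    next
      case 3
      then obtain x where x: "verts G - ?C = {x}" by (auto simp: card_1_singleton_iff)
      then have xV: "x \<in> verts G - S" using B2(1) D verts by auto
      have "cut_degree G ?C = cut_degree G {x}" using cut_degree_compl[OF G, of ?C] x by simp
      moreover have "(u \<in> ?C) = (u \<notin> {x})" "(v \<in> ?C) = (v \<notin> {x})" using x uv' by blast+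
      ultimately show ?thesis using single[OF xV] A(2) by simp
    qed
  qed
  then show ?thesis
    unfolding edge_reduction_def using imm verts size ex le par by (intro exI[of _ G']) simp
qed

text \<open>Parity carries the induction. Contracting a rootless 3-cut would create an inner vertex
  of degree three, so there is none, and without a separating 3-cut \<open>G\<close> is internally
  four-connected. Then any edge between inner vertices can be deleted, and evenness in the smaller
  graph makes its ends the only odd inner vertices of \<open>G\<close>.\<close>

lemma cubic_roots:
  assumes "three_connected G" "s \<in> verts G" "t \<in> verts G" "s \<noteq> t"
    and "cut_degree G {s} = 3" "cut_degree G {t} = 3" "\<not> has_D3 G s t"
  shows "(\<forall>x \<in> verts G - {s, t}. even (cut_degree G {x})) \<and>
    (card (verts G) \<ge> 4 \<longrightarrow> (\<exists>X \<subseteq> verts G. s \<in> X \<and> t \<notin> X \<and> card X \<ge> 2 \<and> card (verts G - X) \<ge> 2 \<and>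
      cut_degree G X = 3))"
  using assms
proof (induction "card (verts G) + size (edges G)" arbitrary: G rule: less_induct)
  case less
  note three = less.prems(1) and st = less.prems(2-4) and deg = less.prems(5,6) and noD3 = less.prems(7)
  note G = three_connectedD(1)[OF three] and fin = three_connectedD(2)[OF three]
  \<comment> \<open>\<open>B\<close> contains at most one root and is then contracted to it, so both
    roots keep degree three.\<close>
  have contr: "\<forall>x \<in> verts (contract B b G) - {s, t}. even (cut_degree (contract B b G) {x})"
    if B: "b \<in> B" "B \<subseteq> verts G" "B \<noteq> verts G" "cut_degree G B = 3" "card B \<ge> 2"
      "s \<in> B \<Longrightarrow> b = s" "t \<in> B \<Longrightarrow> b = t" for B b
  proof -
    let ?G = "contract B b G"
    have "card (verts ?G) < card (verts G)"
      using card_verts_contract[OF fin B(2,1)] card_mono[OF fin B(2)] B(5) by linarith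
    then have lt: "card (verts ?G) + size (edges ?G) < card (verts G) + size (edges G)"
      using size_edges_contract[of B b G] by linarith
    have "{s} \<union> B = B" if "b = s" using that B(1) by auto
    moreover have "{t} \<union> B = B" if "b = t" using that B(1) by auto
    moreover have "{s} - B = {s}" if "b \<noteq> s" using that B(6) by auto
    moreover have "{t} - B = {t}" if "b \<noteq> t" using that B(7) by auto
    ultimately have d: "cut_degree ?G {s} = 3" "cut_degree ?G {t} = 3"
      using cut_degree_contract[OF G B(1), of "{s}"] cut_degree_contract[OF G B(1), of "{t}"] deg B(4)
      by (cases "b = s"; cases "b = t"; simp)+
    have "\<not> has_D3 ?G s t"
      using has_D3_immerses[OF immerses_contract_three[OF three B(1-4)]] noD3 by blast
    then show ?thesis
      using less.hyps[OF lt contract_three_connected[OF three B(1,2)] _ _ st(3) d] st B(6,7) by auto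
  qed
  show ?case
  proof (cases "card (verts G) \<ge> 4")
    case False
    have "even (cut_degree G {x})" if x: "x \<in> verts G - {s, t}" for x
    proof -
      \<comment> \<open>With fewer than four vertices, \<open>x\<close> is the only inner vertex,
        and its degree is six minus twice the number of edges \<open>st\<close>.\<close>
      have "{s, t, x} = verts G"
        using False st x fin by (intro card_seteq) auto
      then have "cut_degree G {x} = cut_degree G ({s} \<union> {t})"
        using x by (intro cut_degree_eqI_compl[OF G]) auto
      moreover have "cut_degree G ({s} \<union> {t}) + 2 * between G {s} {t} = 6"
        using cut_degree_Un[OF G, of "{s}" "{t}"] st deg by simp
      ultimately show ?thesis by presburger
    qed
    then show ?thesis using False by simp
  next
    case V4: True
    show ?thesis
    proof (cases "\<exists>X \<subseteq> verts G. s \<in> X \<and> t \<notin> X \<and> card X \<ge> 2 \<and> card (verts G - X) \<ge> 2 \<and> cut_degree G X = 3")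
      case True
      then obtain X where X: "X \<subseteq> verts G" "s \<in> X" "t \<notin> X" "card X \<ge> 2" "card (verts G - X) \<ge> 2"
        "cut_degree G X = 3" by auto
      \<comment> \<open>Contract the side of the cut that does not contain \<open>x\<close>; this
        leaves the degree of \<open>x\<close> unchanged.\<close>
      have "even (cut_degree G {x})" if x: "x \<in> verts G - {s, t}" for x
      proof (cases "x \<in> X")
        case False
        have "even (cut_degree (contract X s G) {x})"
          using contr[of s X] X st x False by auto
        moreover have "{x} - X = {x}" "s \<noteq> x" using x False by auto
        ultimately show ?thesis using cut_degree_contract[OF G X(2), of "{x}"] by simp
      next
        case True
        have tX: "t \<in> verts G - X" using X st by auto
        have "cut_degree G (verts G - X) = 3" using X(6) cut_degree_compl[OF G] by simp
        then have "even (cut_degree (contract (verts G - X) t G) {x})"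
          using contr[of t "verts G - X"] X st x True by auto
        moreover have "{x} - (verts G - X) = {x}" "t \<noteq> x" using x True by auto
        ultimately show ?thesis using cut_degree_contract[OF G tX, of "{x}"] by simp
      qed
      then show ?thesis using True by simp
    next
      case nosep: False
      have rootless: "cut_degree G B \<ge> 4" if B: "B \<subseteq> verts G - {s, t}" "card B \<ge> 2" for B
      proof (rule ccontr)
        assume c: "\<not> 4 \<le> cut_degree G B"
        obtain b where b: "b \<in> B" using B(2) by fastforce
        have "cut_degree G B \<ge> 3" using B b st by (intro three_connectedD(3)[OF three]) auto
        then have c3: "cut_degree G B = 3" using c by simp
        then have "even (cut_degree (contract B b G) {b})"
          using contr[of b B] B b st by auto
        moreover have "{b} \<union> B = B" using b by auto
        ultimately show False using cut_degree_contract[OF G b, of "{b}"] c3 by simp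
      qed
      have I: "internally_four_connected G" unfolding internally_four_connected_def
      proof (intro conjI three allI impI)
        fix X assume X: "X \<subseteq> verts G" "2 \<le> card X \<and> 2 \<le> card (verts G - X)"
        have ne: "X \<noteq> {}" "X \<noteq> verts G" using X by auto
        have c3: "cut_degree G X \<ge> 3" using three_connectedD(3)[OF three X(1) ne] .
        have VX: "verts G - (verts G - X) = X" using X by auto
        show "4 \<le> cut_degree G X"
        proof (cases "s \<in> X"; cases "t \<in> X")
          assume "s \<in> X" "t \<notin> X"
          then show ?thesis using nosep X c3 by (cases "cut_degree G X = 3") auto
        next
          assume "s \<notin> X" "t \<in> X"
          then have "verts G - X \<subseteq> verts G \<and> s \<in> verts G - X \<and> t \<notin> verts G - X \<and>
              card (verts G - X) \<ge> 2 \<and> card (verts G - (verts G - X)) \<ge> 2"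
            using X st VX by simp
          then have "cut_degree G (verts G - X) \<noteq> 3" using nosep by blast
          then show ?thesis using c3 cut_degree_compl[OF G, of X] by simp
        next
          assume "s \<in> X" "t \<in> X"
          then have "4 \<le> cut_degree G (verts G - X)" using X by (intro rootless) auto
          then show ?thesis using cut_degree_compl[OF G, of X] by simp
        next
          assume "s \<notin> X" "t \<notin> X"
          then show ?thesis using X by (intro rootless) auto
        qed
      qed
      have False
      proof (cases "card (verts G) = 4")
        case True
        then have "doubled_cycle G"
          using internally_four_connected_four[OF I] completes_has_D3[of G s t] st noD3 by auto
        then show False using even_cut_degree_doubled_cycle[of G "{s}"] deg by simp
      next
        case False
        let ?M = "verts G - {s, t}"
        have V5: "card (verts G) \<ge> 5" using V4 False by simp
        have cM: "card ?M \<ge> 3" using V5 st fin by (simp add: card_Diff_subset)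
        have finM: "finite ?M" using fin by simp
        \<comment> \<open>The bound to be contradicted: both ways of splitting the inner vertices
          below give at least 3 + 4 edges.\<close>
        have dM: "cut_degree G ?M \<le> 6"
        proof -
          have "cut_degree G ?M = cut_degree G ({s} \<union> {t})"
            using cut_degree_compl[OF G, of "{s, t}"] by (simp add: insert_commute)
          then show ?thesis using cut_degree_Un[OF G, of "{s}" "{t}"] st deg by simp
        qed
        \<comment> \<open>In the reduced graph all inner degrees are even, so a surviving vertex is
          odd in \<open>G\<close> iff it lost the edge \<open>uv\<close>; suppressed vertices have
          degree three.\<close>
        have odd: "odd (cut_degree G {x}) \<longleftrightarrow> x \<in> {u, v}"
          if uv: "{u, v} \<in># edges G" "u \<in> ?M" "v \<in> ?M" and x: "x \<in> ?M" for u v x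
        proof -
          have uvn: "u \<noteq> v" using multigraph_pairD[OF G uv(1)] by simp
          let ?S = "{w \<in> {u, v} - {s, t}. cut_degree G {w} = 3}"
          obtain G' where R: "edge_reduction G u v ?S G'"
            using reduce_edge[OF I V4 uv(1), of "{s, t}"] uv by auto
          note G' = edge_reductionD(1-4)[OF R] and le = edge_reductionD(6)[OF R]
            and par = edge_reductionD(7)[OF R]
          have st': "s \<in> verts G'" "t \<in> verts G'" using st G'(3) by auto
          have "{s} \<noteq> verts G'" "{t} \<noteq> verts G'" using st' st(3) by auto
          then have "cut_degree G' {s} \<ge> 3" "cut_degree G' {t} \<ge> 3"
            using three_connectedD(3)[OF G'(2), of "{s}"] three_connectedD(3)[OF G'(2), of "{t}"] st'
              by simp_all
          moreover have "cut_degree G' {s} \<le> 3" "cut_degree G' {t} \<le> 3"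
            using le[of "{s}"] le[of "{t}"] st' G'(3) deg by auto
          ultimately have "cut_degree G' {s} = 3" "cut_degree G' {t} = 3" by simp_all
          moreover have "\<not> has_D3 G' s t" using has_D3_immerses[OF G'(1)] noD3 by blast
          moreover have "card (verts G') \<le> card (verts G)" using G'(3) fin by (auto intro: card_mono)
          then have "card (verts G') + size (edges G') < card (verts G) + size (edges G)" using G'(4)
            by simp
          ultimately have ev: "\<forall>x \<in> verts G' - {s, t}. even (cut_degree G' {x})"
            using less.hyps[of G'] G'(2) st' st(3) by blast
          show ?thesis
          proof (cases "x \<in> ?S")
            case True
            then have "cut_degree G {x} = 3" "x \<in> {u, v}" by auto
            then show ?thesis by simp
          next
            case False
            then have "x \<in> verts G' - {s, t}" using x G'(3) by auto
            then have "even (cut_degree G' {x})" "{x} \<subseteq> verts G'" using ev by auto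
            then show ?thesis using par[of "{x}"] uvn by (auto simp: of_bool_def split: if_splits)
          qed
        qed
        show False
        proof (cases "\<exists>u\<in>?M. \<exists>v\<in>?M. {u, v} \<in># edges G")
          case True
          then obtain u v where uv: "u \<in> ?M" "v \<in> ?M" "{u, v} \<in># edges G" by auto
          have uvn: "u \<noteq> v" using multigraph_pairD[OF G uv(3)] by simp
          let ?Z = "?M - {u, v}"
          have cZ: "card ?Z \<ge> 1" using cM uv uvn fin by (simp add: card_Diff_subset)
          then have "?Z \<noteq> {}" by (metis card.empty not_one_le_zero)
          \<comment> \<open>An edge from \<open>u\<close> or \<open>v\<close> to a third inner
            vertex \<open>z\<close> would make \<open>z\<close> odd, while the edge
            \<open>uv\<close> makes it even.\<close>
          have "between G {u, v} ?Z = 0"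
          proof (rule ccontr)
            assume "between G {u, v} ?Z \<noteq> 0"
            then obtain a z where az: "a \<in> {u, v}" "z \<in> ?Z" "{a, z} \<in># edges G"
              using between_pos_edge[OF G, of "{u, v}" ?Z] by auto
            have "odd (cut_degree G {z})" using odd[OF az(3), of z] az uv by auto
            then show False using odd[OF uv(3,1,2), of z] az(2) by auto
          qed
          then have "cut_degree G ({u, v} \<union> ?Z) = cut_degree G {u, v} + cut_degree G ?Z"
            using cut_degree_Un[OF G, of "{u, v}" ?Z] by auto
          moreover have "{u, v} \<union> ?Z = ?M" using uv by auto
          moreover have "cut_degree G {u, v} \<ge> 4" using uv uvn by (intro rootless) auto
          moreover have "cut_degree G ?Z \<ge> 3"
            using \<open>?Z \<noteq> {}\<close> st by (intro three_connectedD(3)[OF three]) auto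
          ultimately show False using dM by simp
        next
          case False
          have "?M \<noteq> {}" using cM by (metis card.empty not_numeral_le_zero)
          then obtain x where x: "x \<in> ?M" by blast
          let ?Z = "?M - {x}"
          have "between G {x} ?Z = 0"
            using False x by (subst between_eq_0_iff[OF G]) auto
          then have "cut_degree G ({x} \<union> ?Z) = cut_degree G {x} + cut_degree G ?Z"
            using cut_degree_Un[OF G, of "{x}" ?Z] by auto
          moreover have "{x} \<union> ?Z = ?M" using x by auto
          moreover have "cut_degree G ?Z \<ge> 4" using x cM finM
            by (intro rootless) (auto simp: card_Diff_singleton)
          moreover have "cut_degree G {x} \<ge> 3" using x st by (intro three_connectedD(3)[OF three]) auto
          ultimately show False using dM by simp
        qed
      qed
      then show ?thesis ..
    qed
  qed
qed

section \<open>Doubled cycles\<close>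

text \<open>Structural recursion replaces the index arithmetic modulo the length in
  \<open>cycle_graph\<close>; a cycle becomes the closed walk \<open>vs @ [hd vs]\<close>.\<close>

fun path_edges :: "'a list \<Rightarrow> 'a set multiset" where
  "path_edges [] = {#}"
| "path_edges [x] = {#}"
| "path_edges (x # y # xs) = add_mset {x, y} (path_edges (y # xs))"

lemma path_edges_join:
  assumes "xs \<noteq> []" "ys \<noteq> []"
  shows "path_edges (xs @ ys) = path_edges xs + {#{last xs, hd ys}#} + path_edges ys"
  using assms
proof (induction xs rule: path_edges.induct)
  case (2 y)
  then show ?case by (cases ys) auto
qed (auto simp: neq_Nil_conv)

lemma path_edges_append:
  "path_edges (xs @ y # ys) = path_edges (xs @ [y]) + path_edges (y # ys)"
  by (induction xs rule: path_edges.induct) auto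

lemma path_edges_rev: "path_edges (rev xs) = path_edges xs"
proof (induction xs rule: path_edges.induct)
  case (3 x y xs)
  have "path_edges (rev (x # y # xs)) = path_edges (rev xs @ [y]) + path_edges [y, x]"
    using path_edges_append[of "rev xs" y "[x]"] by simp
  then show ?case using 3 by (simp add: insert_commute)
qed auto

lemma path_edges_subset: "e \<in># path_edges xs \<Longrightarrow> e \<subseteq> set xs"
  by (induction xs rule: path_edges.induct) auto

lemma path_edges_conv_nth:
  "path_edges xs = mset (map (\<lambda>i. {xs ! i, xs ! Suc i}) [0..<length xs - 1])"
proof (induction xs rule: path_edges.induct)
  case (3 x y xs)
  have "[0..<length (x # y # xs) - 1] = 0 # map Suc [0..<length (y # xs) - 1]"
    by (simp add: map_Suc_upt upt_conv_Cons del: upt_Suc)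
  then show ?case using 3 by (simp add: comp_def del: upt_Suc)
qed auto

lemma cycle_edges_conv:
  assumes "vs \<noteq> []"
  shows "{#{vs ! i, vs ! (Suc i mod length vs)}. i \<in># mset [0..<length vs]#} = path_edges (vs @ [hd vs])"
  unfolding path_edges_conv_nth mset_map length_append_singleton diff_Suc_1
proof (rule image_mset_cong)
  fix i assume "i \<in># mset [0..<length vs]"
  then have i: "i < length vs" by simp
  show "{vs ! i, vs ! (Suc i mod length vs)} = {(vs @ [hd vs]) ! i, (vs @ [hd vs]) ! Suc i}"
  proof (cases "Suc i < length vs")
    case True
    then show ?thesis by (simp add: nth_append)
  next
    case False
    then have "Suc i = length vs" using i by simp
    then show ?thesis using assms i by (simp add: nth_append hd_conv_nth)
  qed
qed

lemma doubled_cycle_iff: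
  fixes G :: "'a mgraph"
  shows "doubled_cycle G \<longleftrightarrow> (\<exists>vs. distinct vs \<and> length vs \<ge> 2 \<and> verts G = set vs \<and>
     edges G = path_edges (vs @ [hd vs]) + path_edges (vs @ [hd vs]))"
  (is "?L \<longleftrightarrow> ?R")
proof
  assume ?L
  then obtain C :: "'a mgraph" and vs where vs: "distinct vs" "length vs \<ge> 2" "verts C = set vs"
    "edges C = {#{vs ! i, vs ! (Suc i mod length vs)}. i \<in># mset [0..<length vs]#}"
    "verts G = verts C" "edges G = edges C + edges C"
    unfolding doubled_cycle_def cycle_graph_def by blast
  then have "vs \<noteq> []" by auto
  then have "edges C = path_edges (vs @ [hd vs])" unfolding vs(4) by (rule cycle_edges_conv)
  then show ?R using vs by (intro exI[of _ vs]) simp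
next
  assume ?R
  then obtain vs where vs: "distinct vs" "length vs \<ge> 2" "verts G = set vs"
     "edges G = path_edges (vs @ [hd vs]) + path_edges (vs @ [hd vs])" by blast
  then have "vs \<noteq> []" by auto
  then have "cycle_graph \<lparr>verts = set vs, edges = path_edges (vs @ [hd vs])\<rparr>"
    unfolding cycle_graph_def using vs cycle_edges_conv[of vs] by (intro exI[of _ vs]) simp
  then show ?L
    unfolding doubled_cycle_def using vs
    by (intro exI[of _ "\<lparr>verts = set vs, edges = path_edges (vs @ [hd vs])\<rparr>"]) simp
qed

lemma doubled_cycle_startE:
  assumes "doubled_cycle G" "x \<in> verts G"
  obtains ps where "distinct (x # ps)" "verts G = set (x # ps)"
    "edges G = path_edges (x # ps @ [x]) + path_edges (x # ps @ [x])"
proof -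
  obtain vs where vs: "distinct vs" "verts G = set vs"
     "edges G = path_edges (vs @ [hd vs]) + path_edges (vs @ [hd vs])"
    using assms(1) unfolding doubled_cycle_iff by blast
  obtain as bs where ab: "vs = as @ x # bs" using vs(2) assms(2) by (metis split_list)
  show thesis
  proof (cases as)
    case Nil
    then show thesis using that[of bs] vs ab by simp
  next
    case (Cons a as')
    have 1: "path_edges (vs @ [hd vs]) = path_edges (as @ [x]) + path_edges (x # bs @ [a])"
      using path_edges_append[of as x "bs @ [a]"] ab Cons by simp
    have "path_edges (x # (bs @ as) @ [x]) = path_edges (x # bs @ [a]) + path_edges (as @ [x])"
      using path_edges_append[of "x # bs" a "as' @ [x]"] Cons by simp
    then have "path_edges (x # (bs @ as) @ [x]) = path_edges (vs @ [hd vs])"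
      using 1 by (simp add: union_commute)
    then show thesis using that[of "bs @ as"] vs ab by (auto simp: Un_ac)
  qed
qed

text \<open>Reading the cycle backwards puts the other neighbour of \<open>x\<close> first. With
  three vertices the two neighbours differ, so one of them avoids \<open>y\<close>.\<close>

lemma doubled_cycle_nextE:
  assumes "doubled_cycle G" "x \<in> verts G" "card (verts G) \<ge> 3"
  obtains p r where "distinct (x # p # r)" "verts G = set (x # p # r)" "r \<noteq> []" "p \<noteq> y"
    "edges G = path_edges (x # p # r @ [x]) + path_edges (x # p # r @ [x])"
proof -
  obtain ps where ps: "distinct (x # ps)" "verts G = set (x # ps)"
    "edges G = path_edges (x # ps @ [x]) + path_edges (x # ps @ [x])"
    using doubled_cycle_startE[OF assms(1,2)] .
  have "length (x # ps) \<ge> 3" using ps assms(3) distinct_card[OF ps(1)] by simp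
  then obtain p r where pr: "ps = p # r" "r \<noteq> []"
    by (cases ps; cases "tl ps") auto
  show thesis
  proof (cases "p = y")
    case False
    then show thesis using that[of p r] ps pr by simp
  next
    case True
    obtain r' q where r: "r = r' @ [q]" using pr(2) by (metis rev_exhaust)
    have "path_edges (x # q # (rev r' @ [p]) @ [x]) = path_edges (rev (x # ps @ [x]))"
      using pr r by simp
    then have "path_edges (x # q # (rev r' @ [p]) @ [x]) = path_edges (x # ps @ [x])"
      unfolding path_edges_rev .
    then show thesis using that[of q "rev r' @ [p]"] ps pr r True by auto
  qed
qed

section \<open>Cuts around intervals of a cycle\<close>

definition crossings :: "'a set multiset \<Rightarrow> 'a set \<Rightarrow> nat" where
  "crossings E X = size {#e \<in># E. card (e \<inter> X) = 1#}"

lemma crossings_union: "crossings (E + F) X = crossings E X + crossings F X"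
  unfolding crossings_def by simp

lemma crossings_single_le: "crossings {#e#} X \<le> 1"
  unfolding crossings_def by simp

lemma crossings_add_mset: "crossings (add_mset e E) X = of_bool (card (e \<inter> X) = 1) + crossings E X"
  unfolding crossings_def by simp

lemma crossings_empty: "crossings {#} X = 0"
  unfolding crossings_def by simp

text \<open>\<open>crossings\<close> takes a bare multiset of edges because it is also applied to
  the edges deleted during an immersion.\<close>

lemma cut_degree_crossings: "cut_degree G X = crossings (edges G) X"
  unfolding crossings_def cut_degree_def ..

lemma crossings_path_inside:
  assumes "set xs \<subseteq> X" "distinct xs"
  shows "crossings (path_edges xs) X = 0"
  using assms
  by (induction xs rule: path_edges.induct) (auto simp: crossings_empty crossings_add_mset card_insert_if)

lemma crossings_path_outside:
  assumes "set xs \<inter> X = {}"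
  shows "crossings (path_edges xs) X = 0"
  using assms by (induction xs rule: path_edges.induct) (auto simp: crossings_empty crossings_add_mset)

text \<open>Only the edge entering the interval and the edge leaving it cross. If \<open>A\<close>
  or \<open>B\<close> is empty, one of them is the closing edge of the cycle.\<close>

lemma crossings_interval:
  assumes "distinct I" "I \<noteq> []" "set I \<inter> set A = {}" "set I \<inter> set B = {}" "A \<noteq> [] \<or> B \<noteq> []"
  shows "crossings (path_edges ((A @ I @ B) @ [hd (A @ I @ B)])) (set I) \<le> 2"
proof (cases "A = []")
  case True
  have "crossings (path_edges B) (set I) = 0" "crossings (path_edges I) (set I) = 0"
    by (rule crossings_path_outside, use assms in blast) (rule crossings_path_inside[OF subset_refl
      assms(1)])
  moreover have "path_edges ((A @ I @ B) @ [hd (A @ I @ B)]) =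
      path_edges I + {#{last I, hd B}#} + (path_edges B + {#{last B, hd I}#})"
    using True assms path_edges_join[of I "B @ [hd I]"] path_edges_join[of B "[hd I]"] by auto
  ultimately show ?thesis
    using crossings_single_le[of "{last I, hd B}" "set I"] crossings_single_le[of "{last B, hd I}" "set I"]
    by (simp only: crossings_union)
next
  case False
  have "hd A \<in> set A" using False by simp
  have "crossings (path_edges A) (set I) = 0" "crossings (path_edges I) (set I) = 0"
    "crossings (path_edges (B @ [hd A])) (set I) = 0"
    by (rule crossings_path_outside, use assms in blast)
      (rule crossings_path_inside[OF subset_refl assms(1)],
        rule crossings_path_outside, use assms \<open>hd A \<in> set A\<close> in auto)
  moreover have "path_edges ((A @ I @ B) @ [hd (A @ I @ B)]) =
      path_edges A + {#{last A, hd I}#} + (path_edges I + {#{last I, hd (B @ [hd A])}#} + path_edges (B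
        @ [hd A]))"
    using False assms path_edges_join[of A "I @ B @ [hd A]"] path_edges_join[of I "B @ [hd A]"] by auto
  ultimately show ?thesis
    using crossings_single_le[of "{last A, hd I}" "set I"]
      crossings_single_le[of "{last I, hd (B @ [hd A])}" "set I"]
    by (simp only: crossings_union)
qed

lemma cut_degree_doubled_interval:
  assumes "distinct I" "I \<noteq> []" "set I \<inter> set A = {}" "set I \<inter> set B = {}" "A \<noteq> [] \<or> B \<noteq> []"
    and "edges G = path_edges ((A @ I @ B) @ [hd (A @ I @ B)]) + path_edges ((A @ I @ B) @ [hd (A @ I @
      B)])"
  shows "cut_degree G (set I) \<le> 4"
  using crossings_interval[OF assms(1-5)] unfolding cut_degree_crossings assms(6) crossings_union by simp

lemma three_connected_degree:
  assumes "three_connected G" "x \<in> verts G" "card (verts G) \<ge> 2"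
  shows "cut_degree G {x} \<ge> 3"
  using three_connectedD(3)[OF assms(1), of "{x}"] singleton_neq[OF assms(3)] assms(2) by simp

lemma doubled_cycle_degree:
  assumes "doubled_cycle G" "three_connected G" "x \<in> verts G" "card (verts G) \<ge> 3"
  shows "cut_degree G {x} = 4"
proof -
  obtain p r where pr: "distinct (x # p # r)" "r \<noteq> []"
    "edges G = path_edges (x # p # r @ [x]) + path_edges (x # p # r @ [x])"
    using doubled_cycle_nextE[OF assms(1,3,4)] by metis
  have "cut_degree G (set [x]) \<le> 4"
    using pr by (intro cut_degree_doubled_interval[of "[x]" "[]" "p # r"]) auto
  moreover have "cut_degree G {x} \<ge> 3"
    using assms by (intro three_connected_degree) auto
  moreover have "even (cut_degree G {x})" using even_cut_degree_doubled_cycle[OF assms(1)] .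
  ultimately show ?thesis by simp presburger
qed

text \<open>A neighbour \<open>p\<close> on the cycle makes \<open>{x, p}\<close> an
  interval.\<close>

lemma doubled_cycle_neighbour:
  assumes "doubled_cycle G" "x \<in> verts G" "card (verts G) \<ge> 3"
  obtains p where "p \<in> verts G" "p \<noteq> x" "p \<noteq> y" "cut_degree G {x, p} \<le> 4"
proof -
  obtain p r where pr: "distinct (x # p # r)" "verts G = set (x # p # r)" "r \<noteq> []" "p \<noteq> y"
    "edges G = path_edges (x # p # r @ [x]) + path_edges (x # p # r @ [x])"
    using doubled_cycle_nextE[OF assms] .
  have "cut_degree G (set [x, p]) \<le> 4"
    using pr by (intro cut_degree_doubled_interval[of "[x, p]" "[]" r]) auto
  then show thesis using that[of p] pr by auto
qed

section \<open>Roots that no small cut separates\<close>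

text \<open>The last two conditions exclude 3-cuts around both roots and nontrivial 3-cuts between
  them. Cuts around one root alone may have size three.\<close>

definition well_rooted :: "'a mgraph \<Rightarrow> 'a \<Rightarrow> 'a \<Rightarrow> bool" where
  "well_rooted G s t \<longleftrightarrow> three_connected G \<and> s \<in> verts G \<and> t \<in> verts G \<and> s \<noteq> t \<and>
     card (verts G) \<ge> 4 \<and> cut_degree G {s, t} \<ge> 4 \<and>
     (\<forall>X \<subseteq> verts G. s \<in> X \<and> t \<notin> X \<and> card X \<ge> 2 \<and> card (verts G - X) \<ge> 2 \<longrightarrow> cut_degree G X \<ge> 4)"

lemma well_rooted_sym:
  assumes W: "well_rooted G s t"
  shows "well_rooted G t s"
  unfolding well_rooted_def
proof (intro conjI allI impI)
  have three: "three_connected G" using W unfolding well_rooted_def by simp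
  show "4 \<le> cut_degree G {t, s}" using W unfolding well_rooted_def by (simp add: insert_commute)
  fix X assume X: "X \<subseteq> verts G" "t \<in> X \<and> s \<notin> X \<and> 2 \<le> card X \<and> 2 \<le> card (verts G - X)"
  then have "verts G - (verts G - X) = X" by auto
  then have "4 \<le> cut_degree G (verts G - X)" using X W unfolding well_rooted_def by auto
  then show "4 \<le> cut_degree G X" using cut_degree_compl[OF three_connectedD(1)[OF three]] by simp
qed (use W in \<open>auto simp: well_rooted_def\<close>)

section \<open>Minimal counterexamples\<close>

locale critical =
  fixes G :: "'a mgraph" and s t :: 'a
  assumes wr: "well_rooted G s t"
    and no_D3: "\<not> has_D3 G s t"
    and not_doubled: "\<not> doubled_cycle G"
    and smaller: "\<And>(G' :: 'a mgraph) s' t'. card (verts G') + size (edges G') < card (verts G) + size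
      (edges G) \<Longrightarrow>
      well_rooted G' s' t' \<Longrightarrow> has_D3 G' s' t' \<or> doubled_cycle G'"
begin

lemma three: "three_connected G" and st: "s \<in> verts G" "t \<in> verts G" "s \<noteq> t"
  and card4: "card (verts G) \<ge> 4" and dst: "cut_degree G {s, t} \<ge> 4"
  using wr unfolding well_rooted_def by auto

lemmas G = three_connectedD(1)[OF three] and fin = three_connectedD(2)[OF three]

lemma sep_cut:
  "X \<subseteq> verts G \<Longrightarrow> s \<in> X \<Longrightarrow> t \<notin> X \<Longrightarrow> card X \<ge> 2 \<Longrightarrow> card (verts G - X) \<ge> 2 \<Longrightarrow> cut_degree G X \<ge> 4"
  using wr unfolding well_rooted_def by auto

text \<open>\<open>smaller\<close> ranges over all pairs of roots, which makes the locale symmetric;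
  each result about \<open>s\<close> is available for \<open>t\<close>.\<close>

lemma critical_sym: "critical G t s"
proof
  show "well_rooted G t s" by (rule well_rooted_sym[OF wr])
  show "\<not> has_D3 G t s" using no_D3 has_D3_sym[of G t s] by blast
  show "\<not> doubled_cycle G" by (rule not_doubled)
qed (rule smaller)

lemma sep_cut':
  assumes "X \<subseteq> verts G" "t \<in> X" "s \<notin> X" "card X \<ge> 2" "card (verts G - X) \<ge> 2"
  shows "cut_degree G X \<ge> 4"
  using critical.sep_cut[OF critical_sym assms] .

lemma reduces_to_doubled:
  assumes "immerses G G'" "well_rooted G' s t"
    and "card (verts G') + size (edges G') < card (verts G) + size (edges G)"
  shows "doubled_cycle G'"
  using smaller[OF assms(3,2)] no_D3 has_D3_immerses[OF assms(1)] by blast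

lemma contract_smaller:
  assumes "b \<in> B" "B \<subseteq> verts G" "card B \<ge> 2"
  shows "card (verts (contract B b G)) + size (edges (contract B b G)) < card (verts G) + size (edges G)"
  using card_verts_contract[OF fin assms(2,1)] card_mono[OF fin assms(2)] assms(3)
    size_edges_contract[of B b G]
  by linarith

text \<open>Contracting a rootless 3-cut would give a smaller well-rooted graph, hence a doubled
  cycle, but with a vertex of degree three.\<close>

lemma rootless_cut:
  assumes B: "B \<subseteq> verts G - {s, t}" "card B \<ge> 2"
  shows "cut_degree G B \<ge> 4"
proof (rule ccontr)
  assume c: "\<not> 4 \<le> cut_degree G B"
  have "B \<noteq> {}" using B(2) by auto
  then obtain b where b: "b \<in> B" by blast
  have BV: "B \<subseteq> verts G" "s \<notin> B" "t \<notin> B" "B \<noteq> verts G" using B st by auto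
  have "cut_degree G B \<ge> 3" using BV b by (intro three_connectedD(3)[OF three]) auto
  then have c3: "cut_degree G B = 3" using c by simp
  \<comment> \<open>The cut around all inner vertices has size at least four, so \<open>B\<close>
    misses some inner vertex \<open>m\<close>. It secures four vertices after the
    contraction.\<close>
  have "cut_degree G (verts G - {s, t}) \<ge> 4" using dst cut_degree_compl[OF G] by simp
  then have "B \<noteq> verts G - {s, t}" using c3 by auto
  then obtain m where m: "m \<in> verts G" "m \<noteq> s" "m \<noteq> t" "m \<notin> B" using B(1) by blast
  let ?G = "contract B b G"
  have finV: "finite (verts ?G)" using fin by simp
  have bst: "b \<noteq> s" "b \<noteq> t" using b BV by auto
  have "{s, t} - B = {s, t}" using BV by auto
  then have d: "cut_degree ?G {s, t} = cut_degree G {s, t}"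
    using cut_degree_contract[OF G b, of "{s, t}"] bst by simp
  have "well_rooted ?G s t" unfolding well_rooted_def
  proof (intro conjI allI impI)
    show "three_connected ?G" using contract_three_connected[OF three b BV(1)] .
    show "s \<in> verts ?G" "t \<in> verts ?G" "s \<noteq> t" using st BV by auto
    have "{s, t, b, m} \<subseteq> verts ?G" using m st BV by auto
    moreover have "b \<noteq> m" using b m by auto
    then have "card {s, t, b, m} = 4" using m(2,3) bst st(3) by simp
    ultimately show "4 \<le> card (verts ?G)" using card_mono[OF finV] by metis
    show "4 \<le> cut_degree ?G {s, t}" using d dst by simp
    fix X assume X: "X \<subseteq> verts ?G" "s \<in> X \<and> t \<notin> X \<and> 2 \<le> card X \<and> 2 \<le> card (verts ?G - X)"
    let ?C = "if b \<in> X then X \<union> B else X - B"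
    have finX: "finite X" using X(1) finV finite_subset by auto
    have C: "?C \<subseteq> verts G" "s \<in> ?C" "t \<notin> ?C" using X BV b by auto
    have "X \<subseteq> ?C" using X(1) by auto
    then have "card ?C \<ge> 2" using X(2) card_mono[of ?C X] C(1) fin finite_subset by fastforce
    moreover have "verts ?G - X \<subseteq> verts G - ?C" using BV b by auto
    then have "card (verts G - ?C) \<ge> 2" using X(2) card_mono[of "verts G - ?C" "verts ?G - X"] fin by auto
    ultimately show "4 \<le> cut_degree ?G X"
      unfolding cut_degree_contract[OF G b] using C by (intro sep_cut)
  qed
  then have "doubled_cycle ?G"
    using reduces_to_doubled[OF immerses_contract_three[OF three b BV(1,4) c3]]
      contract_smaller[OF b BV(1) B(2)] by blast
  moreover have "{b} \<union> B = B" using b by auto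
  then have "cut_degree ?G {b} = 3" using cut_degree_contract[OF G b, of "{b}"] c3 by simp
  ultimately show False using even_cut_degree_doubled_cycle[of ?G "{b}"] by simp
qed

lemma internally: "internally_four_connected G"
  unfolding internally_four_connected_def
proof (intro conjI three allI impI)
  fix X assume X: "X \<subseteq> verts G" "2 \<le> card X \<and> 2 \<le> card (verts G - X)"
  show "4 \<le> cut_degree G X"
  proof (cases "s \<in> X"; cases "t \<in> X")
    assume "s \<in> X" "t \<in> X"
    then have "4 \<le> cut_degree G (verts G - X)" using X by (intro rootless_cut) auto
    then show ?thesis using cut_degree_compl[OF G, of X] by simp
  next
    assume "s \<notin> X" "t \<notin> X"
    then show ?thesis using X by (intro rootless_cut) auto
  qed (use X sep_cut sep_cut' in auto)
qed

lemma card5: "card (verts G) \<ge> 5"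
proof (rule ccontr)
  assume "\<not> 5 \<le> card (verts G)"
  then have "card (verts G) = 4" using card4 by simp
  then show False
    using internally_four_connected_four[OF internally] completes_has_D3[of G s t] st no_D3 not_doubled
      by auto
qed

lemma degree_ge3: "x \<in> verts G \<Longrightarrow> cut_degree G {x} \<ge> 3"
  using three_connected_degree[OF three, of x] card4 by simp

lemma not_both_cubic: "cut_degree G {s} \<ge> 4 \<or> cut_degree G {t} \<ge> 4"
proof (rule ccontr)
  assume "\<not> ?thesis"
  then have "cut_degree G {s} = 3" "cut_degree G {t} = 3"
    using degree_ge3[OF st(1)] degree_ge3[OF st(2)] by auto
  then obtain X where "X \<subseteq> verts G" "s \<in> X" "t \<notin> X" "card X \<ge> 2" "card (verts G - X) \<ge> 2" "cut_degree G
    X = 3"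
    using cubic_roots[OF three st] no_D3 card4 by auto
  then show False using sep_cut[of X] by simp
qed

text \<open>A cut of size four need not be minimum, so Menger's condition has to be checked:
  \<open>{t}\<close> is covered by the degree of \<open>t\<close>, larger sets by
  \<open>sep_cut'\<close>. Three vertices in \<open>X\<close> leave four after the
  contraction.\<close>

lemma doubled_contract:
  assumes X: "X \<subseteq> verts G" "s \<in> X" "t \<notin> X" "card X \<ge> 3" "card (verts G - X) \<ge> 2" "cut_degree G X = 4"
    and dt: "cut_degree G {t} \<ge> 4"
  shows "doubled_cycle (contract (verts G - X) t G)" "three_connected (contract (verts G - X) t G)"
    "verts (contract (verts G - X) t G) = insert t X" "card (insert t X) \<ge> 4"
proof -
  let ?Y = "verts G - X" and ?G = "contract (verts G - X) t G"
  have tY: "t \<in> ?Y" using X st by auto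
  have finX: "finite X" using X(1) fin finite_subset by auto
  have V: "verts ?G = insert t X" using X(1) by auto
  have cV: "card (insert t X) \<ge> 4" using X finX by simp
  have three': "three_connected ?G" using contract_three_connected[OF three tY] by simp
  have imm: "immerses G ?G"
  proof (rule immerses_contract[OF G _ tY])
    fix Z assume Z: "t \<in> Z" "Z \<subseteq> ?Y"
    have "cut_degree G Z \<ge> 4"
    proof (cases "Z = {t}")
      case False
      have "finite Z" using Z(2) fin finite_subset by blast
      moreover have "{t} \<subset> Z" using False Z(1) by auto
      ultimately have "card Z \<ge> 2" using psubset_card_mono[of Z "{t}"] by simp
      moreover have "X \<subseteq> verts G - Z" using X(1) Z(2) by auto
      then have "card (verts G - Z) \<ge> 2" using card_mono[of "verts G - Z" X] fin X(4) by simp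
      ultimately show ?thesis using Z X(2) by (intro sep_cut') auto
    qed (use dt in simp)
    then show "cut_degree G ?Y \<le> cut_degree G Z" using X(6) cut_degree_compl[OF G, of X] by simp
  qed simp
  have "well_rooted ?G s t" unfolding well_rooted_def V
  proof (intro conjI allI impI)
    show "s \<in> insert t X" "t \<in> insert t X" "s \<noteq> t" using X st by auto
    \<comment> \<open>The cut around both roots of the contraction is the cut around
      \<open>X - {s}\<close>, a rootless set with at least two vertices.\<close>
    have "{s, t} \<union> ?Y = verts G - (X - {s})" using X st by auto
    then have "cut_degree ?G {s, t} = cut_degree G (X - {s})"
      using cut_degree_contract[OF G tY, of "{s, t}"] cut_degree_compl[OF G, of "X - {s}"] by simp
    moreover have "cut_degree G (X - {s}) \<ge> 4"
      using X finX by (intro rootless_cut) (auto simp: card_Diff_singleton)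
    ultimately show "4 \<le> cut_degree ?G {s, t}" by simp
    fix Y assume Y: "Y \<subseteq> insert t X" "s \<in> Y \<and> t \<notin> Y \<and> 2 \<le> card Y \<and> 2 \<le> card (insert t X - Y)"
    have YX: "Y - ?Y = Y" "Y \<subseteq> X" using Y by auto
    have "insert t X - Y \<subseteq> verts G - Y" using X st by auto
    then have "card (verts G - Y) \<ge> 2" using card_mono[of "verts G - Y" "insert t X - Y"] fin Y by simp
    then have "cut_degree G Y \<ge> 4" using Y YX X(1) by (intro sep_cut) auto
    then show "4 \<le> cut_degree ?G Y" using cut_degree_contract[OF G tY, of Y] Y YX(1) by simp
  qed (use three' cV in auto)
  then show "doubled_cycle ?G"
    using reduces_to_doubled[OF imm] contract_smaller[OF tY _ X(5)] by simp
  show "three_connected ?G" "verts ?G = insert t X" "card (insert t X) \<ge> 4" by fact+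
qed

text \<open>In the contracted doubled cycle let \<open>p\<close> be a neighbour of the new vertex
  other than \<open>s\<close>. Moving \<open>p\<close> across the cut leaves an interval of the
  cycle on the side of \<open>t\<close>, hence again a cut of size four.\<close>

lemma large_four_cut:
  assumes X: "X \<subseteq> verts G" "s \<in> X" "t \<notin> X" "card X \<ge> 3" "card (verts G - X) \<ge> 2" "cut_degree G X = 4"
    and dt: "cut_degree G {t} \<ge> 4"
  obtains p where "p \<in> X - {s}" "cut_degree G (X - {p}) = 4" "cut_degree G {s} = 4"
proof -
  let ?Y = "verts G - X" and ?G = "contract (verts G - X) t G"
  note D = doubled_contract[OF X dt]
  have tY: "t \<in> ?Y" and sY: "s \<notin> ?Y" using X st by auto
  have "cut_degree ?G {s} = 4"
    using D X by (intro doubled_cycle_degree) auto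
  moreover have "{s} - ?Y = {s}" using X by auto
  ultimately have ds: "cut_degree G {s} = 4"
    using cut_degree_contract[OF G tY, of "{s}"] st by simp
  obtain p where p: "p \<in> insert t X" "p \<noteq> t" "p \<noteq> s" "cut_degree ?G {t, p} \<le> 4"
    using doubled_cycle_neighbour[OF D(1), of t s] D(3,4) by auto
  have pX: "p \<in> X" using p by auto
  have "{t, p} \<union> ?Y = verts G - (X - {p})" using X(1,3) pX st by auto
  then have le: "cut_degree G (X - {p}) \<le> 4"
    using cut_degree_contract[OF G tY, of "{t, p}"] cut_degree_compl[OF G, of "X - {p}"] p(4) by simp
  have finX: "finite X" using X(1) fin finite_subset by auto
  have "card (X - {p}) \<ge> 2" using X finX pX by (simp add: card_Diff_singleton)
  moreover have "verts G - X \<subseteq> verts G - (X - {p})" by blast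
  then have "card (verts G - X) \<le> card (verts G - (X - {p}))" by (rule card_mono[rotated]) (use fin in simp)
  then have "card (verts G - (X - {p})) \<ge> 2" using X(5) by linarith
  ultimately have "cut_degree G (X - {p}) \<ge> 4" using X p by (intro sep_cut) auto
  then show thesis using that[of p] le ds pX p by simp
qed

text \<open>Repeat \<open>large_four_cut\<close> until a single vertex besides \<open>s\<close>
  remains.\<close>

lemma small_four_cut:
  assumes X: "X \<subseteq> verts G" "s \<in> X" "t \<notin> X" "card X \<ge> 2" "card (verts G - X) \<ge> 2" "cut_degree G X = 4"
    and dt: "cut_degree G {t} \<ge> 4"
  obtains w where "w \<in> verts G" "w \<noteq> s" "w \<noteq> t" "cut_degree G {s, w} = 4"
  using X
proof (induction "card X" arbitrary: X thesis rule: less_induct)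
  case less
  have finX: "finite X" using less.prems(2) fin finite_subset by auto
  show ?case
  proof (cases "card X = 2")
    case True
    then obtain a b where ab: "X = {a, b}" "a \<noteq> b" by (auto simp: card_2_iff)
    then obtain w where "X = {s, w}" "w \<noteq> s" using less.prems(3)
      by (metis insertE insert_commute singletonD)
    then show ?thesis using less.prems by auto
  next
    case False
    then have c3: "card X \<ge> 3" using less.prems by simp
    obtain p where p: "p \<in> X - {s}" "cut_degree G (X - {p}) = 4"
      using large_four_cut[OF less.prems(2-4) c3 less.prems(6,7) dt] .
    have c: "card (X - {p}) = card X - 1" using p finX by (simp add: card_Diff_singleton)
    have "verts G - X \<subseteq> verts G - (X - {p})" by blast
    then have "card (verts G - X) \<le> card (verts G - (X - {p}))"
      by (rule card_mono[rotated]) (use fin in simp)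
    then have VX: "card (verts G - (X - {p})) \<ge> 2" using less.prems(6) by linarith
    show ?thesis
    proof (rule less.hyps[of "X - {p}"])
      show "card (X - {p}) < card X" "2 \<le> card (X - {p})" using c c3 by simp_all
      show "X - {p} \<subseteq> verts G" "s \<in> X - {p}" "t \<notin> X - {p}" using less.prems(2-4) p by auto
      show "cut_degree G (X - {p}) = 4" by (rule p(2))
    qed (rule less.prems(1), assumption+, rule VX)
  qed
qed

end

lemma between_contract:
  assumes G: "multigraph G" and AC: "A \<inter> C = {}"
  shows "between (contract B b G) A C = between G {x. collapse B b x \<in> A} {x. collapse B b x \<in> C}"
proof -
  have *: "(collapse B b ` e \<inter> A \<noteq> {} \<and> collapse B b ` e \<inter> C \<noteq> {}) \<and> \<not> e \<subseteq> B \<longleftrightarrow>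
      e \<inter> {x. collapse B b x \<in> A} \<noteq> {} \<and> e \<inter> {x. collapse B b x \<in> C} \<noteq> {}" for e
  proof -
    have "b \<in> A \<inter> C" if "e \<subseteq> B" "x \<in> e" "collapse B b x \<in> A" "y \<in> e" "collapse B b y \<in> C" for x y
      using that unfolding collapse_def by auto
    then show ?thesis using AC by blast
  qed
  have "between (contract B b G) A C =
      size {#e \<in># edges G. (collapse B b ` e \<inter> A \<noteq> {} \<and> collapse B b ` e \<inter> C \<noteq> {}) \<and> \<not> e \<subseteq> B#}"
    unfolding between_def contract_def
    by (simp add: filter_mset_image_mset filter_filter_mset conj_commute)
  then show ?thesis unfolding * between_def .
qed

context critical
begin

text \<open>Two contractions determine \<open>G\<close>. Contracting \<open>{s, w}\<close> gives a
  doubled cycle that shows everything but the edges at \<open>w\<close>; contracting all vertices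
  except \<open>s\<close>, \<open>w\<close> and a cycle neighbour \<open>p\<close> of
  \<open>s\<close> gives a doubled 4-cycle that shows how \<open>w\<close> is attached. Together
  they put \<open>w\<close> next to \<open>s\<close> on the cycle, so \<open>G\<close> is a doubled
  cycle.\<close>

lemma no_small_four_cut:
  assumes w: "w \<in> verts G" "w \<noteq> s" "w \<noteq> t" and d4: "cut_degree G {s, w} = 4"
    and ds: "cut_degree G {s} \<ge> 4" and dt: "cut_degree G {t} \<ge> 4"
  shows False
proof -
  let ?G2 = "contract {s, w} s G"
  have X': "verts G - (verts G - {s, w}) = {s, w}" using w st by auto
  have cX': "card (verts G - {s, w}) \<ge> 3" using card5 w st fin by (simp add: card_Diff_subset)
  have dX': "cut_degree G (verts G - {s, w}) = 4" using d4 cut_degree_compl[OF G] by simp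
  have D2: "doubled_cycle ?G2" "three_connected ?G2"
    using critical.doubled_contract[OF critical_sym, of "verts G - {s, w}"] X' cX' dX' w st ds
    by simp_all
  have V2: "verts ?G2 = verts G - {w}" using st w by auto
  have cV2: "card (verts ?G2) \<ge> 3" unfolding V2 using card5 w fin by simp
  obtain p r where pr: "distinct (s # p # r)" "verts ?G2 = set (s # p # r)" "r \<noteq> []" "p \<noteq> t"
    and E2: "edges ?G2 = path_edges (s # p # r @ [s]) + path_edges (s # p # r @ [s])"
    using doubled_cycle_nextE[OF D2(1) _ cV2, of s t] by auto
  define Y where "Y = set r"
  have pV: "p \<in> verts G" "p \<noteq> s" "p \<noteq> w" using pr V2 by auto
  have Y: "Y = verts G - {s, w, p}" unfolding Y_def using pr V2 w by auto
  have tY: "t \<in> Y" using Y st w pr(4) by auto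
  have V: "verts G = insert w (set (s # p # r))" using pr(2) V2 w by auto
  have dist: "distinct [p, s, w, t]" using pV w st pr(4) by auto
  have swp: "{s, w, p} \<subseteq> verts G" "card {s, w, p} = 3" using st w pV by auto
  have cY: "card (verts G - {s, w, p}) \<ge> 2"
    using card5 card_Diff_subset[OF _ swp(1)] swp(2) by simp
  \<comment> \<open>\<open>{s, p}\<close> is an interval of the cycle \<open>?G2\<close>, which
    makes \<open>{s, w, p}\<close> a 4-cut of \<open>G\<close>.\<close>
  have "cut_degree ?G2 (set [s, p]) \<le> 4"
    using pr(1) E2 by (intro cut_degree_doubled_interval[of "[s, p]" "[]" r]) (use pr(3) in auto)
  moreover have "{s, p} \<union> {s, w} = {s, w, p}" by auto
  ultimately have "cut_degree G {s, w, p} \<le> 4"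
    using cut_degree_contract[OF G, of s "{s, w}" "{s, p}"] by simp
  moreover have "cut_degree G {s, w, p} \<ge> 4"
    using swp cY dist by (intro sep_cut) auto
  ultimately have "cut_degree G {s, w, p} = 4" by simp
  then have D4: "doubled_cycle (contract Y t G)" "verts (contract Y t G) = {t, s, w, p}"
    unfolding Y using doubled_contract[of "{s, w, p}"] swp cY dist dt by auto
  let ?G4 = "contract Y t G"
  have m4: "multigraph ?G4" using contract_multigraph[OF G tY] Y by auto
  have c4: "card (verts ?G4) = 4" unfolding D4 using dist by auto
  have p4: "p \<in> verts ?G4" unfolding D4(2) by simp
  have c3: "3 \<le> card (verts ?G4)" using c4 by simp
  obtain b1 r4 where r4: "distinct (p # b1 # r4)" "verts ?G4 = set (p # b1 # r4)" "r4 \<noteq> []" "b1 \<noteq> t"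
    "edges ?G4 = path_edges (p # b1 # r4 @ [p]) + path_edges (p # b1 # r4 @ [p])"
    using doubled_cycle_nextE[OF D4(1) p4 c3] .
  have "length r4 = 2" using distinct_card[OF r4(1)] r4(2) c4 by simp
  then obtain b2 b3 where b: "r4 = [b2, b3]" by (auto simp: length_Suc_conv numeral_2_eq_2)
  have cnt4: "count (edges ?G4) {x, y} = between G (if x = t then Y else {x}) (if y = t then Y else {y})"
    if "x \<noteq> y" "x \<in> {s, w, p, t}" "y \<in> {s, w, p, t}" for x y
  proof -
    have "{z. collapse Y t z \<in> {x}} = (if x = t then Y else {x})"
      "{z. collapse Y t z \<in> {y}} = (if y = t then Y else {y})"
      using that tY Y dist unfolding collapse_def by (auto split: if_splits)
    then show ?thesis
      using between_singletons[OF m4 that(1)] between_contract[OF G, of "{x}" "{y}" Y t] that(1) by simp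
  qed
  \<comment> \<open>The vertex after \<open>p\<close> on the cycle \<open>?G2\<close> lies in
    \<open>Y\<close>. The edge to it avoids \<open>s\<close>, so it is an edge of \<open>G\<close>,
    and it makes \<open>p\<close> adjacent to \<open>t\<close> in \<open>?G4\<close>.\<close>
  have "{p, hd r} \<in># edges ?G2" unfolding E2 using pr(3) by (cases r) auto
  then obtain e where e: "e \<in># edges G" "collapse {s, w} s ` e = {p, hd r}"
    unfolding contract_def by auto
  have "hd r \<noteq> s" "hd r \<in> Y" using pr(1) hd_in_set[OF pr(3)] unfolding Y_def by auto
  have col: "x = y" if "collapse {s, w} s x = y" "y \<noteq> s" for x y
    using that unfolding collapse_def by (simp split: if_splits)
  obtain x y where xy: "e = {x, y}" using multigraph_edgeE[OF G e(1)] by metis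
  have "e = {p, hd r}"
    using e(2) col[of x p] col[of y p] col[of x "hd r"] col[of y "hd r"] pV(2) \<open>hd r \<noteq> s\<close>
    unfolding xy image_insert image_empty doubleton_eq_iff by blast
  then have "between G {p} Y > 0" using between_edge_pos[OF G, of p "hd r"] e(1) \<open>hd r \<in> Y\<close> by simp
  then have pt: "count (edges ?G4) {p, t} > 0" using cnt4[of p t] dist by simp
  have E4: "edges ?G4 = path_edges [p, b1, b2, b3, p] + path_edges [p, b1, b2, b3, p]"
    using r4(5) b by simp
  \<comment> \<open>The orientation was chosen with \<open>b1\<close> different from
    \<open>t\<close>, so the neighbour \<open>t\<close> of \<open>p\<close> comes last; only the
    order of \<open>s\<close> and \<open>w\<close> stays open.\<close>
  have "b3 = t"
  proof (rule ccontr)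
    assume "b3 \<noteq> t"
    then have "{p, t} \<notin># edges ?G4"
      unfolding E4 using r4(1,4) b dist by (auto simp: doubleton_eq_iff)
    then show False using pt by (simp add: count_eq_zero_iff)
  qed
  then have bs: "b1 = w \<and> b2 = s \<or> b1 = s \<and> b2 = w"
    using r4 b D4(2) by auto
  \<comment> \<open>If the edges at \<open>w\<close> are two to \<open>s\<close> and two to
    \<open>x\<close>, then \<open>G\<close> arises from \<open>?G2\<close> by subdividing a doubled
    edge \<open>sx\<close> with \<open>w\<close>; \<open>cyc\<close> asks for the resulting
    cycle.\<close>
  have finish: False
    if x: "x \<in> set (p # r)" "count (edges G) {s, w} = 2" "count (edges G) {w, x} = 2"
      "\<And>y. {w, y} \<in># edges G \<Longrightarrow> y = s \<or> y = x"
      and cyc: "\<And>E. edges ?G2 = E + {#{s, x}, {s, x}#} \<Longrightarrow>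
        \<exists>vs. distinct vs \<and> length vs \<ge> 2 \<and> set vs = verts G \<and>
          E + {#{s, w}, {s, w}, {w, x}, {w, x}#}
            = path_edges (vs @ [hd vs]) + path_edges (vs @ [hd vs])" for x
  proof -
    have xs: "x \<noteq> s" "x \<noteq> w" using x(1) pr(1) pV V2 pr(2) by auto
    have Ew: "{#e \<in># edges G. w \<in> e#} = {#{s, w}, {s, w}, {w, x}, {w, x}#}"
    proof (rule multiset_eqI)
      fix e
      show "count {#e \<in># edges G. w \<in> e#} e = count {#{s, w}, {s, w}, {w, x}, {w, x}#} e"
      proof (cases "e = {s, w} \<or> e = {w, x}")
        case True
        then show ?thesis using x xs w by (auto simp: doubleton_eq_iff)
      next
        case False
        have "e \<notin># {#e \<in># edges G. w \<in> e#}"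
        proof
          assume "e \<in># {#e \<in># edges G. w \<in> e#}"
          then have e: "e \<in># edges G" "w \<in> e" by auto
          obtain a c where "e = {a, c}" "a \<noteq> c" using multigraph_edgeE[OF G e(1)] by metis
          then obtain y where "e = {w, y}" using e(2) by auto
          then show False using x(4)[of y] e(1) False by (auto simp: insert_commute)
        qed
        then have "count {#e \<in># edges G. w \<in> e#} e = 0" by (metis count_eq_zero_iff)
        moreover have "count {#{s, w}, {s, w}, {w, x}, {w, x}#} e = 0" using False by auto
        ultimately show ?thesis by (simp only:)
      qed
    qed
    define E0 where "E0 = {#e \<in># edges G. w \<notin> e#}"
    have E: "edges G = {#{s, w}, {s, w}, {w, x}, {w, x}#} + E0"
      using multiset_partition[of "edges G" "\<lambda>e. w \<in> e"] unfolding Ew E0_def .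
    have 0: "\<not> e \<subseteq> {s, w}" "collapse {s, w} s ` e = e" if e: "e \<in># E0" for e
    proof -
      have e': "e \<in># edges G" "w \<notin> e" using e unfolding E0_def by auto
      then obtain a c where "e = {a, c}" "a \<noteq> c" using multigraph_edgeE[OF G e'(1)] by metis
      then show "\<not> e \<subseteq> {s, w}" using e'(2) by auto
      show "collapse {s, w} s ` e = e" using e'(2) unfolding collapse_def by (auto simp: image_iff)
    qed
    have "{#e \<in># E0. \<not> e \<subseteq> {s, w}#} = E0" using 0(1) by (intro filter_mset_id) auto
    moreover have "image_mset ((`) (collapse {s, w} s)) E0 = E0"
      using 0(2) by (metis image_mset_cong multiset.map_ident)
    moreover have "collapse {s, w} s ` {w, x} = {s, x}" using xs unfolding collapse_def by auto
    ultimately have "edges ?G2 = E0 + {#{s, x}, {s, x}#}"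
      unfolding contract_def E using xs by simp
    from cyc[OF this] show False
      using not_doubled E unfolding doubled_cycle_iff by (metis union_commute)
  qed
  from bs show False
  proof
    assume b12: "b1 = w \<and> b2 = s"
    then have E4': "edges ?G4 = {#{p, w}, {w, s}, {s, t}, {t, p}, {p, w}, {w, s}, {s, t}, {t, p}#}"
      unfolding E4 using \<open>b3 = t\<close> by simp
    have c: "count (edges ?G4) {s, w} = 2" "count (edges ?G4) {w, p} = 2" "count (edges ?G4) {w, t} = 0"
      unfolding E4' using dist by (auto simp: doubleton_eq_iff)
    have sw: "count (edges G) {s, w} = 2" and wp: "count (edges G) {w, p} = 2" and wY: "between G {w} Y = 0"
      using c cnt4[of s w] cnt4[of w p] cnt4[of w t] dist between_singletons[OF G, of s w]
        between_singletons[OF G, of w p]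
      by auto
    show False
    proof (rule finish[of p])
      show "y = s \<or> y = p" if y: "{w, y} \<in># edges G" for y
      proof (rule ccontr)
        assume "\<not> ?thesis"
        then have "y \<in> Y" using multigraph_pairD[OF G y] Y by auto
        then show False using between_edge_pos[OF G y, of "{w}" Y] wY by simp
      qed
      fix E assume "edges ?G2 = E + {#{s, p}, {s, p}#}"
      then have "E = path_edges (p # r @ [s]) + path_edges (p # r @ [s])"
        using E2 by simp
      then show "\<exists>vs. distinct vs \<and> length vs \<ge> 2 \<and> set vs = verts G \<and>
          E + {#{s, w}, {s, w}, {w, p}, {w, p}#} = path_edges (vs @ [hd vs]) + path_edges (vs @ [hd vs])"
        using pr(1) V V2 pr(2) w by (intro exI[of _ "s # w # p # r"]) auto
    qed (use sw wp in auto)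
  next
    assume b12: "b1 = s \<and> b2 = w"
    then have E4': "edges ?G4 = {#{p, s}, {s, w}, {w, t}, {t, p}, {p, s}, {s, w}, {w, t}, {t, p}#}"
      unfolding E4 using \<open>b3 = t\<close> by simp
    have c: "count (edges ?G4) {s, w} = 2" "count (edges ?G4) {w, p} = 0" "count (edges ?G4) {w, t} = 2"
      unfolding E4' using dist by (auto simp: doubleton_eq_iff)
    have sw: "count (edges G) {s, w} = 2" and wp: "count (edges G) {w, p} = 0" and wY: "between G {w} Y = 2"
      using c cnt4[of s w] cnt4[of w p] cnt4[of w t] dist between_singletons[OF G, of s w]
        between_singletons[OF G, of w p]
      by auto
    \<comment> \<open>\<open>q\<close> is the other cycle neighbour of \<open>s\<close>. Contracting
      \<open>{s, w}\<close> turns edges at \<open>w\<close> into edges at \<open>s\<close>, so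
      \<open>q\<close> is the only possible neighbour of \<open>w\<close> in
      \<open>Y\<close>.\<close>
    define q where "q = last r"
    have qY: "q \<in> Y" unfolding q_def Y_def using pr(3) by simp
    have pe: "path_edges (s # p # r @ [s]) = path_edges (s # p # r) + {#{q, s}#}"
      using path_edges_join[of "s # p # r" "[s]"] pr(3) unfolding q_def by simp
    have nbr: "y = s \<or> y = q" if y: "{w, y} \<in># edges G" for y
    proof (rule ccontr)
      assume ny: "\<not> ?thesis"
      have "y \<noteq> p" using y wp by (metis count_eq_zero_iff)
      moreover have "y \<noteq> w" "y \<in> verts G" using multigraph_pairD[OF G y] by auto
      moreover have "collapse {s, w} s ` {w, y} = {s, y}" using ny \<open>y \<noteq> w\<close> unfolding collapse_def by auto
      then have "{s, y} \<in># edges ?G2"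
        using y ny \<open>y \<noteq> w\<close> unfolding contract_def by (auto intro!: image_eqI[of _ _ "{w, y}"])
      then have "{s, y} \<in># path_edges (s # p # r) + {#{q, s}#}" unfolding E2 pe by auto
      then have "{s, y} \<in># path_edges (p # r)"
        using ny \<open>y \<noteq> p\<close> by (auto simp: doubleton_eq_iff)
      then show False using path_edges_subset[of "{s, y}" "p # r"] pr(1) by auto
    qed
    have "Y = {q} \<union> (Y - {q})" using qY by auto
    moreover have "between G {w} ({q} \<union> (Y - {q})) = between G {w} {q} + between G {w} (Y - {q})"
      using Y qY by (intro between_Un[OF G]) auto
    moreover have "between G {w} (Y - {q}) = 0"
      using nbr Y by (subst between_eq_0_iff[OF G]) auto
    moreover have "w \<noteq> q" using qY Y by auto
    ultimately have wq: "count (edges G) {w, q} = 2" using wY between_singletons[OF G, of w q] by simp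
    show False
    proof (rule finish[of q])
      show "y = s \<or> y = q" if "{w, y} \<in># edges G" for y using nbr[OF that] .
      fix E assume "edges ?G2 = E + {#{s, q}, {s, q}#}"
      then have "E = path_edges (s # p # r) + path_edges (s # p # r)"
        unfolding E2 pe by (simp add: insert_commute)
      moreover have "path_edges ((s # p # r @ [w]) @ [s]) = path_edges (s # p # r) + {#{q, w}, {w, s}#}"
        using path_edges_join[of "s # p # r" "[w, s]"] pr(3) unfolding q_def by simp
      ultimately show "\<exists>vs. distinct vs \<and> length vs \<ge> 2 \<and> set vs = verts G \<and>
          E + {#{s, w}, {s, w}, {w, q}, {w, q}#} = path_edges (vs @ [hd vs]) + path_edges (vs @ [hd vs])"
        using pr(1) V V2 pr(2) w
        by (intro exI[of _ "s # p # r @ [w]"]) (auto simp: insert_commute)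
    qed (use sw wq qY Y_def in auto)
  qed
qed

end

text \<open>Parts may be empty, which covers partitions into three sets as well.\<close>

lemma cut_degree_partition:
  assumes "multigraph G" and "verts G = A \<union> (B \<union> (C \<union> D))"
    and "A \<inter> (B \<union> (C \<union> D)) = {}" "B \<inter> (C \<union> D) = {}" "C \<inter> D = {}"
  shows "cut_degree G A = between G A B + between G A C + between G A D"
proof -
  have "verts G - A = B \<union> (C \<union> D)" using assms(2,3) by auto
  then have "cut_degree G A = between G A (B \<union> (C \<union> D))" using cut_degree_eq_between[OF assms(1), of A]
    by simp
  also have "\<dots> = between G A B + between G A (C \<union> D)" using assms by (intro between_Un) auto
  also have "between G A (C \<union> D) = between G A C + between G A D" using assms by (intro between_Un) auto
  finally show ?thesis by simp
qed

section \<open>Tight cuts and deletable edges of a minimal counterexample\<close>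

context critical
begin

text \<open>If \<open>s\<close> had degree at least four, shrinking the cut would end in
  \<open>no_small_four_cut\<close>. If it has degree three, \<open>large_four_cut\<close> forbids a
  third vertex in \<open>X\<close>.\<close>

lemma tight_cut:
  assumes X: "X \<subseteq> verts G" "s \<in> X" "t \<notin> X" "card X \<ge> 2" "card (verts G - X) \<ge> 2" "cut_degree G X = 4"
    and dt: "cut_degree G {t} \<ge> 4"
  obtains w where "X = {s, w}" "w \<noteq> s" "w \<noteq> t" "w \<in> verts G" "cut_degree G {s} = 3"
proof -
  have ds: "cut_degree G {s} = 3"
  proof (rule ccontr)
    assume "cut_degree G {s} \<noteq> 3"
    then have "cut_degree G {s} \<ge> 4" using degree_ge3[OF st(1)] by simp
    then show False using small_four_cut[OF X dt] no_small_four_cut dt by metis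
  qed
  have "card X = 2"
  proof (rule ccontr)
    assume "card X \<noteq> 2"
    then have "card X \<ge> 3" using X(4) by simp
    then show False using large_four_cut[OF X(1-3) _ X(5,6) dt] ds
      by (metis numeral_eq_iff semiring_norm(88,89))
  qed
  then obtain a b where ab: "X = {a, b}" "a \<noteq> b" by (auto simp: card_2_iff)
  then obtain w where "X = {s, w}" "w \<noteq> s" using X(2) by blast
  then show thesis using that[of w] ds X by auto
qed

text \<open>The hypotheses keep the graph well-rooted when \<open>uv\<close> is deleted; by
  minimality a doubled cycle results, whose degrees are all four. By \<open>tight_cut\<close>,
  separating 4-cuts have the form \<open>{s, w}\<close>, and \<open>light\<close> lets the deletion
  touch such a \<open>w\<close> only if \<open>w\<close> is suppressed. \<open>root\<close> and
  \<open>inner\<close> reserve a fifth edge for the cut around the roots when \<open>uv\<close>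
  crosses it.\<close>

lemma reducible_edge:
  assumes dt: "cut_degree G {t} \<ge> 4" and uv: "{u, v} \<in># edges G"
    and sdeg: "s \<in> {u, v} \<Longrightarrow> cut_degree G {s} \<ge> 4"
    and light: "\<And>w. w \<in> {u, v} - {s, t} \<Longrightarrow> cut_degree G {s} = 3 \<Longrightarrow> cut_degree G {s, w} = 4
      \<Longrightarrow> cut_degree G {w} = 3"
    and root: "{u, v} \<inter> {s, t} \<noteq> {} \<Longrightarrow> cut_degree G {s, t} \<ge> 5"
    and inner: "\<And>a. {u, v} \<inter> {s, t} = {} \<Longrightarrow> a \<in> {u, v} \<Longrightarrow> cut_degree G {a} = 3 \<Longrightarrow> cut_degree G {s, t, a} \<ge> 5"
    and size: "card (verts G - {w \<in> {u, v} - {s, t}. cut_degree G {w} = 3}) \<ge> 4"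
  shows "cut_degree G {s} \<ge> 4" "\<And>x. x \<in> verts G - {s, t} \<Longrightarrow> odd (cut_degree G {x}) \<longleftrightarrow> x \<in> {u, v}"
proof -
  let ?S = "{w \<in> {u, v} - {s, t}. cut_degree G {w} = 3}"
  have uv': "u \<noteq> v" "u \<in> verts G" "v \<in> verts G" using multigraph_pairD[OF G uv] by auto
  obtain G' where R: "edge_reduction G u v ?S G'"
    using reduce_edge[OF internally card4 uv, of "{s, t}"] dt sdeg by auto
  note G' = edge_reductionD(1-4)[OF R] and ex = edge_reductionD(5)[OF R]
    and le = edge_reductionD(6)[OF R] and par = edge_reductionD(7)[OF R]
  have V': "verts G' \<subseteq> verts G" and st': "s \<in> verts G'" "t \<in> verts G'" using st G'(3) by auto
  have card4': "card (verts G') \<ge> 4" using size unfolding G'(3) .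
  have "well_rooted G' s t" unfolding well_rooted_def
  proof (intro conjI allI impI)
    obtain A where A: "A \<subseteq> ?S" "cut_degree G' {s, t} + of_bool ((u \<in> {s, t} \<union> A) \<noteq> (v \<in> {s, t} \<union> A))
      = cut_degree G ({s, t} \<union> A)"
      using ex[of "{s, t}"] st' by auto
    have "finite (verts G')" using V' fin finite_subset by auto
    then have cM: "card (verts G' - {s, t}) \<ge> 2" using card4' st' st(3) by (simp add: card_Diff_subset)
    have "verts G' - {s, t} \<subseteq> verts G - ({s, t} \<union> A)" using A(1) G'(3) by auto
    then have "card (verts G - ({s, t} \<union> A)) \<ge> 2"
      using cM card_mono[of "verts G - ({s, t} \<union> A)" "verts G' - {s, t}"] fin by simp
    then have "cut_degree G (verts G - ({s, t} \<union> A)) \<ge> 4" by (intro rootless_cut) auto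
    then have ge: "cut_degree G ({s, t} \<union> A) \<ge> 4" using cut_degree_compl[OF G] by metis
    show "4 \<le> cut_degree G' {s, t}"
    proof (cases "(u \<in> {s, t} \<union> A) \<noteq> (v \<in> {s, t} \<union> A)")
      case False
      then show ?thesis using A(2) ge by simp
    next
      case True
      have "cut_degree G ({s, t} \<union> A) \<ge> 5"
      \<comment> \<open>If both ends are inner and the deleted edge crosses, exactly one end
        \<open>a\<close> was added in lifting the cut to \<open>G\<close>.\<close>
      proof (cases "{u, v} \<inter> {s, t} = {}")
        case in_M: True
        have "A \<subseteq> {u, v}" using A(1) by auto
        then obtain a where "A = {a}" "a \<in> {u, v}" using True in_M by auto
        then show ?thesis using inner[OF in_M, of a] A(1) by (simp add: insert_commute)
      next
        case False
        then have "A = {}" using True A(1) uv' by auto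
        then show ?thesis using root[OF False] by simp
      qed
      then show ?thesis using A(2) True by simp
    qed
    fix B assume B: "B \<subseteq> verts G'" "s \<in> B \<and> t \<notin> B \<and> 2 \<le> card B \<and> 2 \<le> card (verts G' - B)"
    obtain A where A: "A \<subseteq> ?S" "cut_degree G' B + of_bool ((u \<in> B \<union> A) \<noteq> (v \<in> B \<union> A))
      = cut_degree G (B \<union> A)"
      using ex[OF B(1)] by auto
    let ?C = "B \<union> A"
    have C: "?C \<subseteq> verts G" "s \<in> ?C" "t \<notin> ?C" using A(1) B V' uv' by auto
    have finC: "finite ?C" using C(1) fin finite_subset by auto
    have cC: "card ?C \<ge> 2" using B card_mono[OF finC, of B] by simp
    have "verts G' - B \<subseteq> verts G - ?C" using A(1) G'(3) by auto
    then have cC': "card (verts G - ?C) \<ge> 2" using B card_mono[of "verts G - ?C" "verts G' - B"] fin by simp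
    have ge: "cut_degree G ?C \<ge> 4" using C cC cC' by (intro sep_cut)
    show "4 \<le> cut_degree G' B"
    proof (cases "cut_degree G ?C = 4")
      case True
      \<comment> \<open>\<open>B\<close> must already be \<open>{s, w}\<close>, so \<open>w\<close>
        is not suppressed, and \<open>light\<close> shows that it is no end of
        \<open>uv\<close>.\<close>
      then obtain w where w: "?C = {s, w}" "w \<noteq> s" "w \<noteq> t" "w \<in> verts G" "cut_degree G {s} = 3"
        using tight_cut[OF C cC cC' _ dt] by metis
      have "B = {s, w}"
      proof (rule card_subset_eq)
        show "B \<subseteq> {s, w}" using w(1) by auto
        then show "card B = card {s, w}" using B w(2) card_mono[of "{s, w}" B] by simp
      qed simp
      then have "w \<in> verts G'" using B by auto
      then have "w \<notin> ?S" unfolding G'(3) by auto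
      moreover have "cut_degree G {s, w} = 4" using True w(1) by simp
      ultimately have "w \<notin> {u, v}" using light[of w] w(2,3,5) by auto
      moreover have "s \<notin> {u, v}" using sdeg w(5) by auto
      ultimately have "\<not> ((u \<in> ?C) \<noteq> (v \<in> ?C))" using w(1) by auto
      then show ?thesis using A(2) ge by simp
    next
      case False
      then show ?thesis using A(2) ge by (auto simp: of_bool_def split: if_splits)
    qed
  qed (use G' st' st(3) card4' in auto)
  moreover have "card (verts G') \<le> card (verts G)" using card_mono[OF fin V'] .
  ultimately have DC: "doubled_cycle G'"
    using reduces_to_doubled[OF G'(1)] G'(4) by auto
  have d4: "cut_degree G' {x} = 4" if "x \<in> verts G'" for x
    using doubled_cycle_degree[OF DC G'(2) that] card4' by simp
  show "cut_degree G {s} \<ge> 4" using le[of "{s}"] d4[OF st'(1)] st' by auto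
  fix x assume x: "x \<in> verts G - {s, t}"
  show "odd (cut_degree G {x}) \<longleftrightarrow> x \<in> {u, v}"
  proof (cases "x \<in> ?S")
    case True
    then have "cut_degree G {x} = 3" "x \<in> {u, v}" by auto
    then show ?thesis by simp
  next
    case False
    then have "x \<in> verts G'" using x G'(3) by auto
    then show ?thesis using par[of "{x}"] d4[of x] uv'(1) by (auto simp: of_bool_def split: if_splits)
  qed
qed

lemma card_Diff_ge4:
  assumes "S \<subseteq> {w}"
  shows "card (verts G - S) \<ge> 4"
proof -
  have "card (verts G - {w}) \<ge> 4" using card5 fin
    by (cases "w \<in> verts G") (simp_all add: card_Diff_singleton)
  moreover have "verts G - {w} \<subseteq> verts G - S" using assms by auto
  ultimately show ?thesis using card_mono[of "verts G - S" "verts G - {w}"] fin by simp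
qed

lemma card_inner: "card (verts G - {s, t}) \<ge> 3"
  using card5 st fin by (simp add: card_Diff_subset)

text \<open>An edge at a root can be deleted only if the cut around both roots has an edge to spare.
  With at least five edges there, root edges are used; with exactly four, only edges between inner
  vertices.\<close>

lemma root_degree_ge4_imp_False:
  assumes dt: "cut_degree G {t} \<ge> 4"
  shows False
proof -
  let ?M = "verts G - {s, t}"
  have finM: "finite ?M" using fin by simp
  have dM: "cut_degree G ?M = cut_degree G {s, t}" using cut_degree_compl[OF G] .
  have sub_M: "cut_degree G (?M - {x}) \<ge> 4" if "x \<in> ?M" for x
    using card_inner that finM by (intro rootless_cut) (auto simp: card_Diff_singleton)
  have dst_eq: "cut_degree G {s, t} + 2 * between G {s} {t} = cut_degree G {s} + cut_degree G {t}"
    using cut_degree_Un[OF G, of "{s}" "{t}"] st by (simp add: insert_commute)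
  have dsw: "cut_degree G {s, w} + 2 * between G {s} {w} = cut_degree G {s} + cut_degree G {w}"
    if "w \<noteq> s" for w
    using cut_degree_Un[OF G, of "{s}" "{w}"] that by (simp add: insert_commute)
  show False
  proof (cases "cut_degree G {s, t} \<ge> 5")
    case d5: True
    have root_edge: "cut_degree G {s} \<ge> 4 \<and> (\<forall>x \<in> ?M. odd (cut_degree G {x}) \<longleftrightarrow> x \<in> {r, w})"
      if e: "{r, w} \<in># edges G" "r \<in> {s, t}" "w \<in> ?M" and rs: "r = s \<Longrightarrow> cut_degree G {s} \<ge> 4"
        and light: "cut_degree G {s} = 3 \<Longrightarrow> cut_degree G {s, w} = 4 \<Longrightarrow> cut_degree G {w} = 3" for r w
    proof -
      have "{w' \<in> {r, w} - {s, t}. cut_degree G {w'} = 3} \<subseteq> {w}" using e by auto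
      then have "card (verts G - {w' \<in> {r, w} - {s, t}. cut_degree G {w'} = 3}) \<ge> 4" by (rule card_Diff_ge4)
      note R = reducible_edge[OF dt e(1) _ _ d5 _ this]
      have 1: "s \<in> {r, w} \<Longrightarrow> cut_degree G {s} \<ge> 4" using rs e by auto
      have 2: "w' \<in> {r, w} - {s, t} \<Longrightarrow> cut_degree G {s} = 3 \<Longrightarrow> cut_degree G {s, w'} = 4
        \<Longrightarrow> cut_degree G {w'} = 3" for w'
        using light e by auto
      have 3: "{r, w} \<inter> {s, t} = {} \<Longrightarrow> cut_degree G {s, t, a} \<ge> 5" for a using e(2) by auto
      show ?thesis using R[OF 1 2 3] by blast
    qed
    show False
    proof (cases "cut_degree G {s} = 3")
      case ds: True
      \<comment> \<open>Deleting \<open>ty\<close> would force \<open>s\<close> to have degree four,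
        so the condition \<open>light\<close> must fail at \<open>y\<close>.\<close>
      have heavy: "cut_degree G {s, y} = 4 \<and> cut_degree G {y} \<ge> 4" if y: "{t, y} \<in># edges G" "y \<in> ?M" for y
      proof -
        have "cut_degree G {s, y} = 4 \<and> cut_degree G {y} \<noteq> 3"
          using root_edge[of t y] y ds st(3) by auto
        then show ?thesis using degree_ge3[of y] y by auto
      qed
      have "between G {t} ?M \<noteq> 0"
      proof
        assume "between G {t} ?M = 0"
        moreover have "cut_degree G {t} = between G {t} {s} + between G {t} ?M + between G {t} {}"
          using st by (intro cut_degree_partition[OF G]) auto
        moreover have "cut_degree G {s} = between G {s} {t} + between G {s} ?M + between G {s} {}"
          using st by (intro cut_degree_partition[OF G]) auto
        moreover have "between G {t} {} = 0" unfolding between_def by simp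
        ultimately show False using dt ds between_commute[of G "{s}" "{t}"] by simp
      qed
      then obtain h where h: "{t, h} \<in># edges G" "h \<in> ?M"
        using between_pos_edge[OF G, of "{t}" ?M] by auto
      let ?Z = "?M - {h}"
      have V: "verts G = {s} \<union> ({t} \<union> ({h} \<union> ?Z))" using st h by auto
      have part_s: "cut_degree G {s} = between G {s} {t} + between G {s} {h} + between G {s} ?Z"
        using V h st by (intro cut_degree_partition[OF G]) auto
      have part_t: "cut_degree G {t} = between G {t} {s} + between G {t} {h} + between G {t} ?Z"
        using V h st by (intro cut_degree_partition[OF G]) auto
      have part_h: "cut_degree G {h} = between G {h} {s} + between G {h} {t} + between G {h} ?Z"
        using V h st by (intro cut_degree_partition[OF G]) auto
      have part_Z: "cut_degree G ?Z = between G ?Z {s} + between G ?Z {t} + between G ?Z {h}"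
        using V h st by (intro cut_degree_partition[OF G]) auto
      have heavy_mult: "between G {s} {y} \<ge> 2" if "{t, y} \<in># edges G" "y \<in> ?M" for y
        using heavy[OF that] dsw[of y] ds that by auto
      \<comment> \<open>A second such neighbour of \<open>t\<close> would bring the degree of
        \<open>s\<close> to at least four.\<close>
      have "between G {t} ?Z = 0"
      proof (rule ccontr)
        assume "between G {t} ?Z \<noteq> 0"
        then obtain y where y: "{t, y} \<in># edges G" "y \<in> ?Z"
          using between_pos_edge[OF G, of "{t}" ?Z] by auto
        have "?Z = {y} \<union> (?Z - {y})" using y by auto
        moreover have "between G {s} ({y} \<union> (?Z - {y})) = between G {s} {y} + between G {s} (?Z - {y})"
          using y by (intro between_Un[OF G]) auto
        ultimately have "between G {s} ?Z \<ge> between G {s} {y}" by simp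
        then show False using heavy_mult[OF h] heavy_mult[of y] y part_s ds by auto
      qed
      moreover have "cut_degree G ?Z \<ge> 3" using sub_M[OF h(2)] by simp
      moreover have "cut_degree G {s, h} = 4" "h \<noteq> s" using heavy[OF h] h by auto
      \<comment> \<open>The cut of \<open>{s, h}\<close> has four edges. All edges at
        \<open>t\<close> cross it, which are at least four already, and so do the at least three
        edges of the cut of \<open>?Z\<close>.\<close>
      ultimately show False
        using part_s part_t part_h part_Z dt ds dsw[of h] between_commute[of G "{t}" "{s}"]
          between_commute[of G "{h}" "{s}"] between_commute[of G "{h}" "{t}"] between_commute[of G ?Z "{s}"]
          between_commute[of G ?Z "{t}"] between_commute[of G ?Z "{h}"]
        by linarith
    next
      case False
      then have ds: "cut_degree G {s} \<ge> 4" using degree_ge3[OF st(1)] by simp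
      \<comment> \<open>Each edge from a root to an inner vertex makes that vertex the only odd
        inner one; so all such edges share one inner end \<open>w\<close>.\<close>
      have odd: "odd (cut_degree G {x}) \<longleftrightarrow> x = w"
        if "{r, w} \<in># edges G" "r \<in> {s, t}" "w \<in> ?M" "x \<in> ?M" for r w x
        using root_edge[of r w] that ds by auto
      have nz: "between G {s, t} ?M \<noteq> 0" using cut_degree_eq_between[OF G, of "{s, t}"] d5 by simp
      have "{s, t} \<inter> ?M = {}" by auto
      then obtain r w where rw: "{r, w} \<in># edges G" "r \<in> {s, t}" "w \<in> ?M"
        using between_pos_edge[OF G _ nz] by metis
      let ?Z = "?M - {w}"
      have no_root: "between G {s, t} ?Z = 0"
      proof (rule ccontr)
        assume "between G {s, t} ?Z \<noteq> 0"
        moreover have "{s, t} \<inter> ?Z = {}" by auto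
        ultimately obtain r' w' where "{r', w'} \<in># edges G" "r' \<in> {s, t}" "w' \<in> ?Z"
          using between_pos_edge[OF G] by metis
        then show False using odd[of r' w' w'] odd[OF rw, of w'] by auto
      qed
      have V: "verts G = {s, t} \<union> ({w} \<union> (?Z \<union> {}))" using st rw by auto
      have e0: "between G A {} = 0" for A unfolding between_def by simp
      have "cut_degree G {s, t} = between G {s, t} {w} + between G {s, t} ?Z + between G {s, t} {}"
        using V rw by (intro cut_degree_partition[OF G]) auto
      moreover have "cut_degree G {w} = between G {w} {s, t} + between G {w} ?Z + between G {w} {}"
        using V rw by (intro cut_degree_partition[OF G]) auto
      moreover have "cut_degree G ?Z = between G ?Z {s, t} + between G ?Z {w} + between G ?Z {}"
        using V rw by (intro cut_degree_partition[OF G]) auto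
      ultimately have dw: "cut_degree G {w} \<ge> 5" and wZ: "between G {w} ?Z \<noteq> 0"
        using no_root d5 e0 sub_M[OF rw(3)] between_commute[of G "{s, t}" "{w}"]
          between_commute[of G ?Z "{s, t}"] between_commute[of G ?Z "{w}"] by auto
      \<comment> \<open>Deleting \<open>wz\<close> would make \<open>z\<close> odd too. As
        \<open>w\<close> has degree at least five, only \<open>z\<close> can be suppressed.\<close>
      obtain z where z: "{w, z} \<in># edges G" "z \<in> ?Z"
        using between_pos_edge[OF G, of "{w}" ?Z] wZ by auto
      have "?Z = {z} \<union> (?Z - {z})" using z by auto
      moreover have "between G {s, t} ({z} \<union> (?Z - {z}))
        = between G {s, t} {z} + between G {s, t} (?Z - {z})"
        using z by (intro between_Un[OF G]) auto
      ultimately have "between G {s, t} {z} = 0" using no_root by simp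
      then have dstz: "cut_degree G {s, t, z} = cut_degree G {s, t} + cut_degree G {z}"
        using cut_degree_Un[OF G, of "{s, t}" "{z}"] z by (simp add: insert_commute)
      have "{w' \<in> {w, z} - {s, t}. cut_degree G {w'} = 3} \<subseteq> {z}" using dw by auto
      then have c: "card (verts G - {w' \<in> {w, z} - {s, t}. cut_degree G {w'} = 3}) \<ge> 4"
        by (rule card_Diff_ge4)
      have "odd (cut_degree G {z}) \<longleftrightarrow> z \<in> {w, z}"
      proof (rule reducible_edge(2)[OF dt z(1)])
        show "cut_degree G {s, t, a} \<ge> 5" if "a \<in> {w, z}" "cut_degree G {a} = 3" for a
          using that dw dstz d5 by auto
      qed (use rw z ds c in auto)
      then show False using odd[OF rw, of z] z by auto
    qed
  next
    case False
    then have d4: "cut_degree G {s, t} = 4" using dst by simp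
    \<comment> \<open>If \<open>s\<close> is cubic, the degree of \<open>t\<close> and parity force
      two edges \<open>st\<close>, which leaves at most one edge \<open>sw\<close>.\<close>
    have light: "cut_degree G {w} = 3" if "w \<in> ?M" "cut_degree G {s} = 3" "cut_degree G {s, w} = 4" for w
    proof -
      have "cut_degree G {s} = between G {s} {t} + between G {s} {w} + between G {s} (?M - {w})"
        using that st by (intro cut_degree_partition[OF G]) auto
      moreover have "between G {s} {t} \<ge> 2" using dst_eq d4 dt that(2) by presburger
      moreover have "4 + 2 * between G {s} {w} = 3 + cut_degree G {w}" using dsw[of w] that by auto
      ultimately have "cut_degree G {w} \<le> 3" using that(2) by linarith
      then show ?thesis using degree_ge3[of w] that by auto
    qed
    \<comment> \<open>This cut is odd, since it differs from 4 + 3 by an even number, and it is at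
      least four.\<close>
    have inner: "cut_degree G {s, t, a} \<ge> 5" if "a \<in> ?M" "cut_degree G {a} = 3" for a
    proof -
      have "verts G - {s, t, a} = ?M - {a}" by auto
      then have "cut_degree G {s, t, a} \<ge> 4"
        using sub_M[OF that(1)] cut_degree_compl[OF G, of "{s, t, a}"] by simp
      moreover have "cut_degree G {s, t, a} + 2 * between G {s, t} {a} = 7"
        using cut_degree_Un[OF G, of "{s, t}" "{a}"] that d4 by (simp add: insert_commute)
      ultimately show ?thesis by presburger
    qed
    have avail: "odd (cut_degree G {x}) \<longleftrightarrow> x \<in> {u, v}"
      if "{u, v} \<in># edges G" "u \<in> ?M" "v \<in> ?M" "x \<in> ?M"
        and c: "card (verts G - {w \<in> {u, v} - {s, t}. cut_degree G {w} = 3}) \<ge> 4" for u v x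
      by (rule reducible_edge(2)[OF dt that(1)]) (use that light inner in auto)
    \<comment> \<open>If an inner edge \<open>uv\<close> leaves four vertices, then \<open>u\<close>
      and \<open>v\<close> have no other inner neighbours, and the cut around all inner vertices
      would have at least 4 + 3 edges. Too few remain only if both ends are suppressed and there are
      just three inner vertices.\<close>
    have none: "cut_degree G {u} = 3 \<and> card ?M = 3" if uv: "{u, v} \<in># edges G" "u \<in> ?M" "v \<in> ?M" for u v
    proof (rule ccontr)
      assume no: "\<not> ?thesis"
      have uvn: "u \<noteq> v" using multigraph_pairD[OF G uv(1)] by simp
      let ?S = "{w \<in> {u, v} - {s, t}. cut_degree G {w} = 3}"
      have c: "card (verts G - ?S) \<ge> 4"
      proof (cases "cut_degree G {u} = 3")
        case False
        then have "?S \<subseteq> {v}" by auto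
        then show ?thesis by (rule card_Diff_ge4)
      next
        case True
        then have "card ?M \<ge> 4" using no card_inner by simp
        moreover have "card (verts G) = card ?M + 2"
          using st fin card5 by (simp add: card_Diff_subset)
        moreover have "card (verts G) - card ?S \<le> card (verts G - ?S)" by (rule diff_card_le_card_Diff) auto
        moreover have "card ?S \<le> card {u, v}" by (rule card_mono) auto
        ultimately show ?thesis using uvn by simp
      qed
      let ?Z = "?M - {u, v}"
      have "card ?Z \<ge> 1" using card_inner uv uvn finM by (simp add: card_Diff_subset)
      then have Zne: "?Z \<noteq> {}" by (metis card.empty not_one_le_zero)
      have "between G {u, v} ?Z = 0"
      proof (rule ccontr)
        assume "between G {u, v} ?Z \<noteq> 0"
        then obtain a z where az: "a \<in> {u, v}" "z \<in> ?Z" "{a, z} \<in># edges G"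
          using between_pos_edge[OF G, of "{u, v}" ?Z] by auto
        have ev: "even (cut_degree G {z})" using avail[OF uv _ c, of z] az(2) by auto
        then have "{w \<in> {a, z} - {s, t}. cut_degree G {w} = 3} \<subseteq> {a}" by auto
        then have "card (verts G - {w \<in> {a, z} - {s, t}. cut_degree G {w} = 3}) \<ge> 4" by (rule card_Diff_ge4)
        then have "odd (cut_degree G {z})" using avail[OF az(3), of z] az uv by auto
        then show False using ev by simp
      qed
      then have "cut_degree G ({u, v} \<union> ?Z) = cut_degree G {u, v} + cut_degree G ?Z"
        using cut_degree_Un[OF G, of "{u, v}" ?Z] by auto
      moreover have "{u, v} \<union> ?Z = ?M" using uv by auto
      moreover have "cut_degree G {u, v} \<ge> 4" using uv uvn by (intro rootless_cut) auto
      moreover have "cut_degree G ?Z \<ge> 3" using Zne st by (intro three_connectedD(3)[OF three]) auto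
      ultimately show False using dM d4 by simp
    qed
    have all: "cut_degree G {x} = 3 \<and> card ?M = 3" if x: "x \<in> ?M" for x
    proof -
      have "between G {x} (?M - {x}) \<noteq> 0"
      proof
        assume "between G {x} (?M - {x}) = 0"
        then have "cut_degree G ({x} \<union> (?M - {x})) = cut_degree G {x} + cut_degree G (?M - {x})"
          using cut_degree_Un[OF G, of "{x}" "?M - {x}"] by auto
        moreover have "{x} \<union> (?M - {x}) = ?M" using x by auto
        ultimately show False using sub_M[OF x] degree_ge3[of x] x dM d4 by auto
      qed
      then obtain z where "{x, z} \<in># edges G" "z \<in> ?M"
        using between_pos_edge[OF G, of "{x}" "?M - {x}"] by auto
      then show ?thesis using none x by blast
    qed
    have "?M \<noteq> {}" using card_inner by (metis card.empty not_numeral_le_zero)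
    then have "card ?M = 3" using all by blast
    then obtain x y z where M: "?M = {x, y, z}" and xyz: "x \<noteq> y" "y \<noteq> z" "x \<noteq> z" unfolding card_3_iff
      by metis
    then have "x \<in> ?M" "y \<in> ?M" "z \<in> ?M" by auto
    then have d: "cut_degree G {x} = 3" "cut_degree G {y} = 3" "cut_degree G {z} = 3" using all by blast+
    \<comment> \<open>Three inner degrees of three have an odd sum, but the cut around the inner
      vertices is four.\<close>
    have "cut_degree G ({y} \<union> {z}) + 2 * between G {y} {z} = 6"
      using cut_degree_Un[OF G, of "{y}" "{z}"] xyz d by simp
    moreover have "cut_degree G ({x} \<union> ({y} \<union> {z})) + 2 * between G {x} ({y} \<union> {z})
      = 3 + cut_degree G ({y} \<union> {z})"
      using cut_degree_Un[OF G, of "{x}" "{y} \<union> {z}"] xyz d by simp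
    moreover have "{x} \<union> ({y} \<union> {z}) = ?M" unfolding M by auto
    then have "cut_degree G ({x} \<union> ({y} \<union> {z})) = 4" using dM d4 by simp
    moreover have False if "a + 2 * b = 6" "4 + 2 * c = 3 + a" for a b c :: nat using that by presburger
    ultimately show False by metis
  qed
qed

end

theorem well_rooted_D3_or_doubled_cycle:
  assumes "well_rooted G s t"
  shows "has_D3 G s t \<or> doubled_cycle G"
  using assms
proof (induction "card (verts G) + size (edges G)" arbitrary: G s t rule: less_induct)
  case less
  show ?case
  proof (rule ccontr)
    assume no: "\<not> ?thesis"
    have crit: "critical G s t"
    proof
      fix G' :: "'a mgraph" and s' t'
      assume "card (verts G') + size (edges G') < card (verts G) + size (edges G)" "well_rooted G' s' t'"
      then show "has_D3 G' s' t' \<or> doubled_cycle G'" by (rule less.hyps)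
    qed (use less.prems no in auto)
    show False
      using critical.not_both_cubic[OF crit] critical.root_degree_ge4_imp_False[OF crit]
        critical.root_degree_ge4_imp_False[OF critical.critical_sym[OF crit]] by blast
  qed
qed

section \<open>Segmentations from the absence of an immersion\<close>

lemma immerses_contract_no_D3:
  assumes "three_connected G" "b \<in> B" "B \<subseteq> verts G" "B \<noteq> verts G" "cut_degree G B = 3" "\<not> has_D3 G s t"
  shows "three_connected (contract B b G)" "\<not> has_D3 (contract B b G) s t"
  using contract_three_connected[OF assms(1-3)]
    has_D3_immerses[OF immerses_contract_three[OF assms(1-5)]] assms(6) by blast+

text \<open>Contract \<open>X\<close> to \<open>s\<close> and the outside of \<open>Y\<close> to
  \<open>t\<close>. Both roots become cubic, and two vertices in between give the four that
  \<open>cubic_roots\<close> needs; its cut is nontrivial, hence strictly between.\<close>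

lemma refine_three_cuts:
  assumes three: "three_connected G" and noD3: "\<not> has_D3 G s t"
    and X: "s \<in> X" "cut_degree G X = 3" and XY: "X \<subseteq> Y"
    and Y: "Y \<subseteq> verts G" "t \<in> verts G - Y" "cut_degree G Y = 3" and card: "card (Y - X) \<ge> 2"
  obtains Z where "X \<subset> Z" "Z \<subset> Y" "cut_degree G Z = 3"
proof -
  note G = three_connectedD(1)[OF three] and fin = three_connectedD(2)[OF three]
  have XV: "X \<subseteq> verts G" "X \<noteq> verts G" using XY Y by auto
  let ?G1 = "contract X s G"
  note G1 = immerses_contract_no_D3[OF three X(1) XV X(2) noD3]
  note m1 = three_connectedD(1)[OF G1(1)]
  define B where "B = verts G - Y"
  have B: "t \<in> B" "s \<notin> B" "B \<inter> X = {}" "B - X = B" using X XY Y unfolding B_def by auto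
  have V1: "verts ?G1 = insert s (verts G - X)" by simp
  have BV1: "B \<subseteq> verts ?G1" "B \<noteq> verts ?G1" using XY B unfolding B_def by auto
  have "cut_degree G B = 3" unfolding B_def using Y(3) cut_degree_compl[OF G] by simp
  then have dB: "cut_degree ?G1 B = 3" using cut_degree_contract[OF G X(1), of B] B by simp
  let ?G2 = "contract B t ?G1"
  note G2 = immerses_contract_no_D3[OF G1(1) B(1) BV1 dB G1(2)]
  have V2: "verts ?G2 = insert s (insert t (Y - X))" using XY Y X B unfolding B_def by auto
  have d2: "cut_degree ?G2 Z = cut_degree G (Z \<union> X)" if "s \<in> Z" "Z \<subseteq> verts ?G2" "t \<notin> Z" for Z
  proof -
    have "Z - B = Z" using that(2,3) B(1) by auto
    then show ?thesis
      using cut_degree_contract[OF m1 B(1), of Z] cut_degree_contract[OF G X(1), of Z] that by simp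
  qed
  have st: "s \<in> verts ?G2" "t \<in> verts ?G2" "s \<noteq> t" using V2 B by auto
  have "{s} \<union> X = X" using X by auto
  then have ds: "cut_degree ?G2 {s} = 3" using d2[of "{s}"] st X(2) by simp
  have "{t} \<union> B = B" using B by auto
  then have dt: "cut_degree ?G2 {t} = 3" using cut_degree_contract[OF m1 B(1), of "{t}"] dB by simp
  have "card (Y - X) + 2 = card (verts ?G2)"
  proof -
    have "finite (Y - X)" using Y(1) fin finite_subset by blast
    moreover have "s \<notin> Y - X" "t \<notin> Y - X" using X Y by auto
    ultimately show ?thesis unfolding V2 using st(3) by simp
  qed
  then have "card (verts ?G2) \<ge> 4" using card by simp
  then obtain X2 where X2: "X2 \<subseteq> verts ?G2" "s \<in> X2" "t \<notin> X2" "card X2 \<ge> 2"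
    "card (verts ?G2 - X2) \<ge> 2" "cut_degree ?G2 X2 = 3"
    using cubic_roots[OF G2(1) st ds dt G2(2)] by auto
  have "cut_degree G (X2 \<union> X) = 3" using d2[OF X2(2,1,3)] X2(6) by simp
  moreover have "X \<subset> X2 \<union> X"
  proof -
    have "\<not> X2 \<subseteq> {s}" using X2(4) card_mono[of "{s}" X2] by auto
    then obtain a where "a \<in> X2" "a \<noteq> s" by auto
    then have "a \<in> X2" "a \<notin> X" using X2 V2 by auto
    then show ?thesis by auto
  qed
  moreover have "X2 \<union> X \<subset> Y"
  proof -
    have "\<not> verts ?G2 - X2 \<subseteq> {t}" using X2(5) card_mono[of "{t}" "verts ?G2 - X2"] by auto
    then obtain a where "a \<in> verts ?G2 - X2" "a \<noteq> t" by auto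
    then have a: "a \<in> Y" "a \<notin> X" "a \<notin> X2" using X2(2) V2 by auto
    have "X2 \<subseteq> Y" using X2(1,3) V2 X(1) XY by auto
    then show ?thesis using a XY by auto
  qed
  ultimately show thesis using that by blast
qed

abbreviation extends_by_one :: "'a set \<Rightarrow> 'a set \<Rightarrow> bool" where
  "extends_by_one A B \<equiv> A \<subset> B \<and> card (B - A) = 1"

text \<open>The intermediate cut may lie anywhere in the gap, so the gap is bisected and the two
  chains are joined at their common set \<open>Z\<close>.\<close>

lemma chain_of_three_cuts:
  assumes three: "three_connected G" and noD3: "\<not> has_D3 G s t"
    and "s \<in> X" "cut_degree G X = 3" "X \<subseteq> Y"
    and "Y \<subseteq> verts G" "t \<in> verts G - Y" "cut_degree G Y = 3"
  shows "\<exists>Xs. Xs \<noteq> [] \<and> hd Xs = X \<and> last Xs = Y \<and> (\<forall>Z \<in> set Xs. Z \<subseteq> Y \<and> cut_degree G Z = 3) \<and>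
    successively extends_by_one Xs"
  using assms(3-)
proof (induction "card (Y - X)" arbitrary: X Y rule: less_induct)
  case less
  note prems = less.prems
  have fin: "finite (Y - X)" "finite Y"
    using three_connectedD(2)[OF three] prems(4) by (auto intro: finite_subset)
  consider "card (Y - X) = 0" | "card (Y - X) = 1" | "card (Y - X) \<ge> 2" by linarith
  then show ?case
  proof cases
    case 1
    then have "X = Y" using fin prems(3) by auto
    then show ?thesis using prems by (intro exI[of _ "[X]"]) auto
  next
    case 2
    then have "X \<subset> Y" using prems(3) by auto
    then show ?thesis using prems 2 by (intro exI[of _ "[X, Y]"]) auto
  next
    case 3
    then obtain Z where Z: "X \<subset> Z" "Z \<subset> Y" "cut_degree G Z = 3"
      using refine_three_cuts[OF three noD3 prems(1-6)] by metis
    have "card (Z - X) < card (Y - X)" "card (Y - Z) < card (Y - X)"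
      using Z fin by (auto intro!: psubset_card_mono)
    note IH = less.hyps[OF this(1) prems(1,2) _ _ _ Z(3)] less.hyps[OF this(2) _ Z(3) _ prems(4-6)]
    obtain Xs where Xs: "Xs \<noteq> []" "hd Xs = X" "last Xs = Z"
      "\<forall>W \<in> set Xs. W \<subseteq> Z \<and> cut_degree G W = 3" "successively extends_by_one Xs"
      using IH(1) Z prems by blast
    obtain Ys where Ys: "Ys \<noteq> []" "hd Ys = Z" "last Ys = Y"
      "\<forall>W \<in> set Ys. W \<subseteq> Y \<and> cut_degree G W = 3" "successively extends_by_one Ys"
      using IH(2) Z prems by blast
    obtain Ys' where Ys': "Ys = Z # Ys'" using Ys by (cases Ys) auto
    have "Ys' \<noteq> []" using Ys(3) Ys' Z by auto
    then have "last (Xs @ Ys') = Y" using Ys(3) Ys' by simp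
    moreover have "successively extends_by_one (Xs @ Ys')"
      using Xs(3,5) Ys(5) \<open>Ys' \<noteq> []\<close> unfolding Ys'
      by (auto simp: successively_append_iff successively_Cons)
    moreover have "\<forall>W \<in> set (Xs @ Ys'). W \<subseteq> Y \<and> cut_degree G W = 3"
      using Xs(4) Ys(4) Ys' Z(2) by auto
    ultimately show ?thesis using Xs(1,2) by (intro exI[of _ "Xs @ Ys'"]) auto
  qed
qed

text \<open>If the cut of \<open>X - {s}\<close> had four edges, contracting the outside of
  \<open>X\<close> to \<open>t\<close> would give a well-rooted graph by minimality of
  \<open>X\<close>, hence a doubled cycle, although \<open>t\<close> has degree three. The lemma
  removes a root from an end with three or more vertices.\<close>

lemma large_end:
  assumes three: "three_connected G" and noD3: "\<not> has_D3 G s t"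
    and X: "X \<subseteq> verts G" "s \<in> X" "t \<in> verts G - X" "cut_degree G X = 3" "card X \<ge> 3"
    and min: "\<And>Z. Z \<subset> X \<Longrightarrow> s \<in> Z \<Longrightarrow> cut_degree G Z \<noteq> 3"
  shows "cut_degree G (X - {s}) = 3"
proof (rule ccontr)
  assume no: "cut_degree G (X - {s}) \<noteq> 3"
  note G = three_connectedD(1)[OF three] and fin = three_connectedD(2)[OF three]
  let ?B = "verts G - X" and ?G = "contract (verts G - X) t G"
  have B: "t \<in> ?B" "?B \<subseteq> verts G" "?B \<noteq> verts G" "cut_degree G ?B = 3"
    using X cut_degree_compl[OF G] by auto
  note G1 = immerses_contract_no_D3[OF three B noD3]
  have V1: "verts ?G = insert t X" using X(1) by auto
  have finX: "finite X" using X(1) fin finite_subset by auto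
  have "\<not> X \<subseteq> {s}" using X(5) card_mono[of "{s}" X] by auto
  then have "cut_degree G (X - {s}) \<ge> 3" using X by (intro three_connectedD(3)[OF three]) auto
  then have ge4: "cut_degree G (X - {s}) \<ge> 4" using no by simp
  have "well_rooted ?G s t" unfolding well_rooted_def V1
  proof (intro conjI allI impI)
    show "three_connected ?G" by (rule G1(1))
    show "s \<in> insert t X" "t \<in> insert t X" "s \<noteq> t" using X by auto
    show "4 \<le> card (insert t X)" using X finX by simp
    have "{s, t} \<union> ?B = verts G - (X - {s})" using X by auto
    then show "4 \<le> cut_degree ?G {s, t}"
      using cut_degree_contract[OF G B(1), of "{s, t}"] cut_degree_compl[OF G, of "X - {s}"] ge4 by simp
    fix Z assume Z: "Z \<subseteq> insert t X" "s \<in> Z \<and> t \<notin> Z \<and> 2 \<le> card Z \<and> 2 \<le> card (insert t X - Z)"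
    have ZX: "Z \<subseteq> X" "Z - ?B = Z" using Z by auto
    have "Z \<noteq> X"
    proof
      assume "Z = X"
      then have "insert t X - Z \<subseteq> {t}" by auto
      then show False using Z(2) card_mono[of "{t}" "insert t X - Z"] by simp
    qed
    then have "Z \<subset> X" using ZX by auto
    then have "cut_degree G Z \<noteq> 3" using min Z(2) by auto
    moreover have "cut_degree G Z \<ge> 3" using \<open>Z \<subset> X\<close> Z(2) X(1) by (intro three_connectedD(3)[OF three]) auto
    ultimately show "4 \<le> cut_degree ?G Z"
      using cut_degree_contract[OF G B(1), of Z] ZX(2) Z(2) by simp
  qed
  from well_rooted_D3_or_doubled_cycle[OF this] have "doubled_cycle ?G" using G1(2) by simp
  moreover have "{t} \<union> ?B = ?B" using B(1) by auto
  then have "cut_degree ?G {t} = 3" using cut_degree_contract[OF G B(1), of "{t}"] B(4) by simp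
  ultimately show False using even_cut_degree_doubled_cycle[of ?G "{t}"] by simp
qed

lemma segmentation_iff:
  "segmentation G X Y Xs \<longleftrightarrow> X \<subseteq> verts G \<and> Y \<subseteq> verts G \<and> X \<inter> Y = {} \<and>
    Xs \<noteq> [] \<and> (\<forall>Z \<in> set Xs. Z \<subseteq> verts G) \<and> hd Xs = X \<and> verts G - last Xs = Y \<and>
    successively extends_by_one Xs"
  unfolding segmentation_def successively_conv_nth by simp

text \<open>A 3-cut around both roots is a segmentation by itself. Otherwise some 3-cut separates
  the roots, or \<open>well_rooted_D3_or_doubled_cycle\<close> would apply. A chain runs from a
  smallest such set \<open>A\<close> to a largest one \<open>B\<close> above it, and
  \<open>large_end\<close> adds one set at either end that would be large and contain a
  root.\<close>

lemma exists_segmentation: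
  assumes three: "three_connected G" and noD3: "\<not> has_D3 G s t" and noDC: "\<not> doubled_cycle G"
    and st: "s \<in> verts G" "t \<in> verts G" "s \<noteq> t" and card4: "card (verts G) \<ge> 4"
  shows "\<exists>X0 X1 Xs. segmentation G X0 X1 Xs \<and> has_width G Xs 3 \<and>
      (\<forall>X \<in> {X0, X1}. card X \<ge> 3 \<longrightarrow> s \<notin> X \<and> t \<notin> X)"
proof -
  note G = three_connectedD(1)[OF three] and fin = three_connectedD(2)[OF three]
  show ?thesis
  proof (cases "cut_degree G {s, t} \<ge> 4")
    case False
    have "{s, t} \<noteq> verts G" using card4 st(3) by (metis card_2_iff numeral_le_iff semiring_norm(69,71))
    then have "cut_degree G {s, t} \<ge> 3" using st by (intro three_connectedD(3)[OF three]) auto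
    then have "cut_degree G {s, t} = 3" using False by simp
    then have "segmentation G {s, t} (verts G - {s, t}) [{s, t}]" "has_width G [{s, t}] 3"
      unfolding segmentation_def has_width_def using st by auto
    moreover have "card {s, t} < 3" using st(3) by simp
    ultimately show ?thesis
      by (intro exI[of _ "{s, t}"] exI[of _ "verts G - {s, t}"] exI[of _ "[{s, t}]"]) auto
  next
    case True
    define sep where "sep X \<longleftrightarrow> X \<subseteq> verts G \<and> s \<in> X \<and> t \<notin> X \<and> cut_degree G X = 3" for X
    have "\<exists>X. sep X"
    proof (rule ccontr)
      assume no: "\<not> ?thesis"
      have "well_rooted G s t" unfolding well_rooted_def
      proof (intro conjI allI impI three st True card4)
        fix X assume X: "X \<subseteq> verts G" "s \<in> X \<and> t \<notin> X \<and> 2 \<le> card X \<and> 2 \<le> card (verts G - X)"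
        then have "cut_degree G X \<ge> 3" using st by (intro three_connectedD(3)[OF three]) auto
        moreover have "cut_degree G X \<noteq> 3" using no X unfolding sep_def by blast
        ultimately show "4 \<le> cut_degree G X" by simp
      qed
      from well_rooted_D3_or_doubled_cycle[OF this] show False using noD3 noDC by simp
    qed
    then obtain A where A: "sep A" "\<And>Z. sep Z \<Longrightarrow> card A \<le> card Z"
      using ex_has_least_nat[of sep _ card] by blast
    have "\<forall>Z. sep Z \<and> A \<subseteq> Z \<longrightarrow> card Z < Suc (card (verts G))"
      unfolding sep_def using card_mono[OF fin] by (simp add: le_imp_less_Suc)
    then obtain B where B: "sep B" "A \<subseteq> B" "\<And>Z. sep Z \<Longrightarrow> A \<subseteq> Z \<Longrightarrow> card Z \<le> card B"
      using ex_has_greatest_nat[of "\<lambda>Z. sep Z \<and> A \<subseteq> Z" A card "Suc (card (verts G))"] A(1) by auto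
    have sA: "A \<subseteq> verts G" "s \<in> A" "t \<notin> A" "cut_degree G A = 3" using A(1) unfolding sep_def by auto
    have sB: "B \<subseteq> verts G" "s \<in> B" "t \<notin> B" "cut_degree G B = 3" using B(1) unfolding sep_def by auto
    have finAB: "finite A" "finite B" using sA(1) sB(1) fin finite_subset by auto
    let ?C = "verts G - B"
    have left: "cut_degree G (A - {s}) = 3" if "card A \<ge> 3"
    proof (rule large_end[OF three noD3 sA(1,2) _ sA(4) that])
      show "t \<in> verts G - A" using sA st by auto
      fix Z assume Z: "Z \<subset> A" "s \<in> Z"
      then have "card Z < card A" using finAB psubset_card_mono by blast
      then have "\<not> sep Z" using A(2) by fastforce
      then show "cut_degree G Z \<noteq> 3" using Z sA unfolding sep_def by auto
    qed
    have right: "cut_degree G (insert t B) = 3" if "card ?C \<ge> 3"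
    proof -
      have "cut_degree G (?C - {t}) = 3"
      proof (rule large_end[OF three _ _ _ _ _ that])
        show "\<not> has_D3 G t s" using noD3 has_D3_sym[of G t s] by blast
        show "?C \<subseteq> verts G" "t \<in> ?C" "s \<in> verts G - ?C" using sB st by auto
        show "cut_degree G ?C = 3" using sB(4) cut_degree_compl[OF G] by simp
        fix Z assume Z: "Z \<subset> ?C" "t \<in> Z"
        then have W: "B \<subset> verts G - Z" using sB(1) by auto
        then have "card B < card (verts G - Z)" using fin by (intro psubset_card_mono) auto
        then have "\<not> sep (verts G - Z)" using B(2) B(3)[of "verts G - Z"] W by fastforce
        moreover have "s \<in> verts G - Z" "t \<notin> verts G - Z" using W sB Z by auto
        ultimately have "cut_degree G (verts G - Z) \<noteq> 3" unfolding sep_def by auto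
        then show "cut_degree G Z \<noteq> 3" using cut_degree_compl[OF G] by simp
      qed
      moreover have "verts G - insert t B = ?C - {t}" by auto
      ultimately show ?thesis using cut_degree_compl[OF G, of "insert t B"] by simp
    qed
    have tB: "t \<in> verts G - B" using sB st by auto
    obtain Xs where Xs: "Xs \<noteq> []" "hd Xs = A" "last Xs = B"
      "\<forall>Z \<in> set Xs. Z \<subseteq> B \<and> cut_degree G Z = 3" "successively extends_by_one Xs"
      using chain_of_three_cuts[OF three noD3 sA(2,4) B(2) sB(1) tB sB(4)] by blast
    define pre where "pre = (if card A \<ge> 3 then [A - {s}] else [])"
    define post where "post = (if card ?C \<ge> 3 then [insert t B] else [])"
    let ?Ys = "pre @ Xs @ post"
    have hd: "hd ?Ys = (if card A \<ge> 3 then A - {s} else A)"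
      unfolding pre_def using Xs by simp
    have last: "last ?Ys = (if card ?C \<ge> 3 then insert t B else B)"
      unfolding post_def using Xs by simp
    have cuts: "\<forall>Z \<in> set ?Ys. Z \<subseteq> verts G \<and> cut_degree G Z = 3"
      using Xs(4) left right sA sB st unfolding pre_def post_def by auto
    have e1: "extends_by_one (A - {s}) A" using sA by (auto simp: Diff_Diff_Int)
    have e2: "extends_by_one B (insert t B)" using sB by (auto simp: insert_Diff_if)
    have "successively extends_by_one (Xs @ post)"
      using Xs e2 unfolding post_def by (auto simp: successively_append_iff)
    then have succ: "successively extends_by_one ?Ys"
      using Xs e1 unfolding pre_def by (auto simp: successively_Cons)
    have "segmentation G (hd ?Ys) (verts G - last ?Ys) ?Ys"
      unfolding segmentation_iff
    proof (intro conjI succ refl)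
      show "?Ys \<noteq> []" using Xs by simp
      show "\<forall>Z \<in> set ?Ys. Z \<subseteq> verts G" using cuts by blast
      show "hd ?Ys \<subseteq> verts G" "hd ?Ys \<inter> (verts G - last ?Ys) = {}"
        unfolding hd last using sA B(2) by auto
    qed auto
    moreover have "has_width G ?Ys 3" unfolding has_width_def using cuts by blast
    moreover have "s \<notin> hd ?Ys \<and> t \<notin> hd ?Ys" if "card (hd ?Ys) \<ge> 3"
      using that sA unfolding hd by (auto split: if_splits)
    moreover have "s \<notin> verts G - last ?Ys \<and> t \<notin> verts G - last ?Ys" if "card (verts G - last ?Ys) \<ge> 3"
      using that sB unfolding last by (auto split: if_splits)
    ultimately show ?thesis
      by (intro exI[of _ "hd ?Ys"] exI[of _ "verts G - last ?Ys"] exI[of _ ?Ys]) blast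
  qed
qed

section \<open>Obstructions\<close>

text \<open>
  Splitting off and deleting edges loses, besides the deleted edges \<open>D\<close>, an even number of edges
  of every cut.
\<close>

lemma immersion_step_crossings:
  assumes "immersion_step G G'" "multigraph G"
  shows "\<exists>D. (\<forall>e \<in># D. card e = 2) \<and>
    (\<forall>X. \<exists>k. crossings (edges G) X = crossings (edges G') X + crossings D X + 2 * k)"
  using assms(1)
proof (cases rule: immersion_step.cases)
  case (split_off x y z)
  obtain N where N: "edges G = add_mset {x, y} (add_mset {y, z} N)"
    using subseteq_mset_pairE[OF split_off(2)] by metis
  have ne: "x \<noteq> y" "y \<noteq> z"
    using multigraph_pairD[OF assms(2), of x y] multigraph_pairD[OF assms(2), of y z] N by auto
  have "\<exists>k. crossings (edges G) X = crossings (edges G') X + crossings {#} X + 2 * k" for X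
  proof -
    have "crossings (edges G) X =
        of_bool ((x \<in> X) \<noteq> (y \<in> X)) + (of_bool ((y \<in> X) \<noteq> (z \<in> X)) + crossings N X)"
      unfolding N crossings_add_mset card_pair_Int_eq_1[OF ne(1)] card_pair_Int_eq_1[OF ne(2)] ..
    moreover have "edges G' = (if x = z then N else add_mset {x, z} N)"
      using split_off(1) N by simp
    then have "crossings (edges G') X = of_bool ((x \<in> X) \<noteq> (z \<in> X)) + crossings N X"
      using crossings_add_mset[of "{x, z}" N X] card_pair_Int_eq_1[of x z X] by (cases "x = z") simp_all
    ultimately show ?thesis
      unfolding crossings_empty
      by (intro exI[of _ "of_bool ((x \<in> X) \<noteq> (y \<in> X) \<and> (y \<in> X) \<noteq> (z \<in> X))"])
        (cases "x \<in> X"; cases "y \<in> X"; cases "z \<in> X"; simp)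
  qed
  then show ?thesis by (intro exI[of _ "{#}"]) simp
next
  case (delete_edge e)
  then obtain N where N: "edges G = add_mset e N" by (metis insert_DiffM)
  have "\<exists>k. crossings (edges G) X = crossings (edges G') X + crossings {#e#} X + 2 * k" for X
    using delete_edge N by (intro exI[of _ 0]) (simp add: crossings_add_mset crossings_empty)
  then show ?thesis
    using multigraph.edge_ends[OF assms(2) delete_edge(2)] by (intro exI[of _ "{#e#}"]) simp
next
  case (delete_vertex v)
  let ?D = "{#e \<in># edges G. v \<in> e#}"
  have E: "edges G = ?D + edges G'" using multiset_partition[of "edges G" "\<lambda>e. v \<in> e"] delete_vertex by simp
  have "crossings (edges G) X = crossings (edges G') X + crossings ?D X + 2 * 0" for X
    using arg_cong[OF E, of "\<lambda>E. crossings E X"] unfolding crossings_union by linarith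
  moreover have "\<forall>e \<in># ?D. card e = 2" using multigraph.edge_ends[OF assms(2)] by auto
  ultimately show ?thesis by blast
qed

lemma immerses_crossings:
  assumes "immerses G G'" "multigraph G"
  shows "\<exists>D. (\<forall>e \<in># D. card e = 2) \<and>
    (\<forall>X. \<exists>k. crossings (edges G) X = crossings (edges G') X + crossings D X + 2 * k)"
  using assms
proof (induction rule: rtranclp_induct)
  case base
  show ?case by (intro exI[of _ "{#}"]) (simp add: crossings_empty)
next
  case (step G1 G2)
  obtain D1 where D1: "\<forall>e \<in># D1. card e = 2"
    "\<And>X. \<exists>k. crossings (edges G) X = crossings (edges G1) X + crossings D1 X + 2 * k"
    using step.IH step.prems by blast
  obtain D2 where D2: "\<forall>e \<in># D2. card e = 2"
    "\<And>X. \<exists>k. crossings (edges G1) X = crossings (edges G2) X + crossings D2 X + 2 * k"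
    using immersion_step_crossings[OF step.hyps(2) immerses_multigraph[OF step.hyps(1) step.prems]] by blast
  have "\<exists>k. crossings (edges G) X = crossings (edges G2) X + crossings (D1 + D2) X + 2 * k" for X
  proof -
    obtain k1 k2 where "crossings (edges G) X = crossings (edges G1) X + crossings D1 X + 2 * k1"
      "crossings (edges G1) X = crossings (edges G2) X + crossings D2 X + 2 * k2"
      using D1(2)[of X] D2(2)[of X] by blast
    then show ?thesis by (intro exI[of _ "k1 + k2"]) (simp add: crossings_union)
  qed
  then show ?case using D1(1) D2(1) by (intro exI[of _ "D1 + D2"]) auto
qed

text \<open>The values are 0, 3, 4, 3, 0: only a balanced split has more than three edges.\<close>

lemma crossings_complete_four:
  assumes dist: "distinct [a, b, c, d]" and V: "V = {a, b, c, d}"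
  defines "n \<equiv> \<lambda>X. card (X \<inter> {a, b, c, d})"
  shows "crossings (edges (complete_graph V)) X = n X * (4 - n X)"
proof -
  have n: "n X = of_bool (a \<in> X) + of_bool (b \<in> X) + of_bool (c \<in> X) + of_bool (d \<in> X)"
    using dist unfolding n_def by (auto simp: Int_insert_right card_insert_if)
  show ?thesis
    unfolding n V complete_graph_four[OF dist] four_graph_def using dist
    by (simp add: crossings_add_mset crossings_empty card_pair_Int_eq_1)
qed

text \<open>Along the chain the number of branch vertices grows by at most one per step and never
  equals two, as that needs four crossings. It starts with at most two, so it stays at most one; the
  other end holds at most two, which is one short of four.\<close>

lemma segmentation_no_D3:
  assumes G: "multigraph G" and seg: "segmentation G X0 X1 Xs" and width: "has_width G Xs 3"
    and roots: "\<forall>X \<in> {X0, X1}. card X \<ge> 3 \<longrightarrow> s \<notin> X \<and> t \<notin> X"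
  shows "\<not> has_D3 G s t"
proof
  assume "has_D3 G s t"
  then obtain y z where yz: "distinct [s, t, y, z]" and imm: "immerses G (complete_graph {s, t, y, z})"
    unfolding has_D3_def by blast
  define W where "W = {s, t, y, z}"
  have W: "finite W" "card W = 4" "W \<subseteq> verts G"
    using yz immerses_verts[OF imm] unfolding W_def complete_graph_def by auto
  have fin: "finite (verts G)" using multigraph.finite_verts[OF G] .
  have not2: "card (Z \<inter> W) \<noteq> 2" if "Z \<in> set Xs" for Z
  proof
    assume "card (Z \<inter> W) = 2"
    then have "crossings (edges (complete_graph {s, t, y, z})) Z = 4"
      using crossings_complete_four[OF yz refl, of Z] unfolding W_def by simp
    moreover have "crossings (edges G) Z = 3"
      using width that unfolding has_width_def cut_degree_crossings by auto
    moreover obtain D k where "crossings (edges G) Z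
      = crossings (edges (complete_graph {s, t, y, z})) Z + crossings D Z + 2 * k"
      using immerses_crossings[OF imm G] by blast
    ultimately show False by simp
  qed
  \<comment> \<open>An end with three or more vertices contains no root, so at most \<open>y\<close>
    and \<open>z\<close>.\<close>
  have small: "card (X \<inter> W) \<le> 2" if X: "X \<in> {X0, X1}" for X
  proof (cases "card X \<ge> 3")
    case True
    then have "X \<inter> W \<subseteq> {y, z}" using roots X unfolding W_def by auto
    then show ?thesis using card_mono[of "{y, z}" "X \<inter> W"] card_insert_le_m1[of 2 "{z}" y]
      by (auto simp: card_insert_if split: if_splits)
  next
    case False
    have "X \<subseteq> verts G" using seg X unfolding segmentation_def by auto
    then have "finite X" using fin finite_subset by auto
    then show ?thesis using False card_mono[of X "X \<inter> W"] by auto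
  qed
  have Xs: "Xs \<noteq> []" "hd Xs = X0" "verts G - last Xs = X1"
    and next_set: "\<And>i. Suc i < length Xs \<Longrightarrow> Xs ! i \<subset> Xs ! Suc i \<and> card (Xs ! Suc i - Xs ! i) = 1"
    using seg unfolding segmentation_def by auto
  have "card (Xs ! i \<inter> W) \<le> 1" if "i < length Xs" for i
    using that
  proof (induction i)
    case 0
    have "Xs ! 0 \<in> set Xs" using 0 by simp
    moreover have "Xs ! 0 = X0" using Xs by (simp add: hd_conv_nth)
    ultimately show ?case using small[of X0] not2[of X0] by auto
  next
    case (Suc i)
    have IH: "card (Xs ! i \<inter> W) \<le> 1" using Suc by simp
    obtain v where v: "Xs ! Suc i - Xs ! i = {v}" using next_set[OF Suc.prems]
      by (auto simp: card_1_singleton_iff)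
    then have "Xs ! Suc i \<inter> W \<subseteq> insert v (Xs ! i \<inter> W)" by auto
    then have "card (Xs ! Suc i \<inter> W) \<le> card (insert v (Xs ! i \<inter> W))" using W(1) by (intro card_mono) auto
    also have "\<dots> \<le> Suc (card (Xs ! i \<inter> W))" using W(1) by (simp add: card_insert_if)
    finally show ?case using IH not2[of "Xs ! Suc i"] Suc.prems by simp
  qed
  from this[of "length Xs - 1"] have last1: "card (last Xs \<inter> W) \<le> 1" using Xs(1)
    by (simp add: last_conv_nth)
  have "W = (last Xs \<inter> W) \<union> (X1 \<inter> W)" using W(3) Xs(3) by auto
  then have "card W \<le> card (last Xs \<inter> W) + card (X1 \<inter> W)" using card_Un_le by metis
  then show False using last1 small[of X1] W(2) by simp
qed

text \<open>Each interval contains two branch vertices, and K4 needs all four edges of its cut, so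
  no deleted edge crosses either interval, nor therefore their intersection. There K4 has three
  crossings and splits lose an even number, so the cut would be odd.\<close>

lemma doubled_cycle_no_D3:
  assumes G: "multigraph G" and DC: "doubled_cycle G"
  shows "\<not> has_D3 G s t"
proof
  assume "has_D3 G s t"
  then obtain y z where yz: "distinct [s, t, y, z]" and imm: "immerses G (complete_graph {s, t, y, z})"
    unfolding has_D3_def by blast
  define W where "W = {s, t, y, z}"
  obtain vs where vs: "distinct vs" "verts G = set vs"
    "edges G = path_edges (vs @ [hd vs]) + path_edges (vs @ [hd vs])"
    using DC unfolding doubled_cycle_iff by blast
  have W: "finite W" "card W = 4" "W \<subseteq> set vs"
    using yz immerses_verts[OF imm] vs(2) unfolding W_def complete_graph_def by auto
  let ?ws = "filter (\<lambda>v. v \<in> W) vs"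
  have set_ws: "set ?ws = W" using W(3) by auto
  have "distinct ?ws" using vs(1) by simp
  then have "length ?ws = 4" using distinct_card[of ?ws] set_ws W(2) by simp
  then obtain a b c d where ws: "?ws = [a, b, c, d]" by (auto simp: length_Suc_conv eval_nat_numeral)
  obtain A1 R1 where 1: "vs = A1 @ a # R1" "\<forall>v\<in>set A1. v \<notin> W" "filter (\<lambda>v. v \<in> W) R1 = [b, c, d]"
    using ws by (auto dest!: filter_eq_ConsD)
  obtain A2 R2 where 2: "R1 = A2 @ b # R2" "\<forall>v\<in>set A2. v \<notin> W" "filter (\<lambda>v. v \<in> W) R2 = [c, d]"
    using 1(3) by (auto dest!: filter_eq_ConsD)
  obtain A3 R3 where 3: "R2 = A3 @ c # R3" "\<forall>v\<in>set A3. v \<notin> W" "filter (\<lambda>v. v \<in> W) R3 = [d]"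
    using 2(3) by (auto dest!: filter_eq_ConsD)
  obtain A4 R4 where 4: "R3 = A4 @ d # R4" "\<forall>v\<in>set A4. v \<notin> W"
    using 3(3) by (auto dest!: filter_eq_ConsD)
  have Wabcd: "W = {a, b, c, d}" using set_ws ws by simp
  have dist: "distinct [a, b, c, d]" using \<open>distinct ?ws\<close> unfolding ws .
  \<comment> \<open>The intervals meet in the stretch from \<open>b\<close> to just before
    \<open>c\<close>, whose only branch vertex is \<open>b\<close>.\<close>
  define I1 where "I1 = a # A2 @ b # A3"
  define I2 where "I2 = b # A3 @ c # A4"
  have vs_eq: "vs = A1 @ a # A2 @ b # A3 @ c # A4 @ d # R4" using 1 2 3 4 by simp
  have dist_vs: "distinct (A1 @ a # A2 @ b # A3 @ c # A4 @ d # R4)" using vs(1) unfolding vs_eq .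
  have c1: "crossings (edges G) (set I1) \<le> 4"
    unfolding cut_degree_crossings[symmetric]
    by (rule cut_degree_doubled_interval[of I1 A1 "c # A4 @ d # R4"])
      (use dist_vs vs(3) in \<open>auto simp: I1_def vs_eq\<close>)
  have c2: "crossings (edges G) (set I2) \<le> 4"
    unfolding cut_degree_crossings[symmetric]
    by (rule cut_degree_doubled_interval[of I2 "A1 @ a # A2" "d # R4"])
      (use dist_vs vs(3) in \<open>auto simp: I2_def vs_eq\<close>)
  obtain D where D: "\<forall>e \<in># D. card e = 2"
    "\<And>X. \<exists>k. crossings (edges G) X = crossings (edges (complete_graph W)) X + crossings D X + 2 * k"
    using immerses_crossings[OF imm G] unfolding W_def by blast
  note K = crossings_complete_four[OF dist Wabcd]
  have i1: "set I1 \<inter> {a, b, c, d} = {a, b}" using dist_vs unfolding I1_def by auto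
  have i2: "set I2 \<inter> {a, b, c, d} = {b, c}" using dist_vs unfolding I2_def by auto
  have i3: "set I1 \<inter> set I2 \<inter> {a, b, c, d} = {b}" using i1 i2 dist by auto
  have k1: "crossings (edges (complete_graph W)) (set I1) = 4" unfolding K i1 using dist by simp
  have k2: "crossings (edges (complete_graph W)) (set I2) = 4" unfolding K i2 using dist by simp
  have k3: "crossings (edges (complete_graph W)) (set I1 \<inter> set I2) = 3" unfolding K i3 by simp
  have "crossings D (set I1) = 0" "crossings D (set I2) = 0"
    using D(2)[of "set I1"] D(2)[of "set I2"] k1 k2 c1 c2 by auto
  then have "crossings D (set I1 \<inter> set I2) = 0"
  proof -
    assume 0: "crossings D (set I1) = 0" "crossings D (set I2) = 0"
    have "card (e \<inter> (set I1 \<inter> set I2)) \<noteq> 1" if e: "e \<in># D" for e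
    proof -
      obtain p q where pq: "e = {p, q}" "p \<noteq> q" using D(1) e by (auto simp: card_2_iff)
      have "card (e \<inter> set I1) \<noteq> 1" "card (e \<inter> set I2) \<noteq> 1"
        using 0 e unfolding crossings_def by auto
      then show ?thesis unfolding pq(1) card_pair_Int_eq_1[OF pq(2)] by auto
    qed
    then show ?thesis unfolding crossings_def by auto
  qed
  moreover have "even (crossings (edges G) (set I1 \<inter> set I2))"
    using even_cut_degree_doubled_cycle[OF DC] unfolding cut_degree_crossings .
  ultimately show False using D(2)[of "set I1 \<inter> set I2"] k3 by auto
qed

section \<open>Rooted immersions of \<open>D3\<close>\<close>

lemma image_complete_graph_four:
  assumes "distinct [a, b, c, d]" "distinct [f a, f b, f c, f d]"
  shows "image_mset (\<lambda>e. f ` e) (edges (complete_graph {a, b, c, d}))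
    = edges (complete_graph {f a, f b, f c, f d})"
  unfolding complete_graph_four[OF assms(1)] complete_graph_four[OF assms(2)] four_graph_def by simp

lemma rooted_immersion_D3_iff:
  assumes G: "multigraph G"
  shows "rooted_immersion (G, s, t) D3 \<longleftrightarrow> has_D3 G s t"
proof
  assume "has_D3 G s t"
  then obtain y z where yz: "distinct [s, t, y, z]" and imm: "immerses G (complete_graph {s, t, y, z})"
    unfolding has_D3_def by blast
  \<comment> \<open>Vertices outside the four also receive 3; injectivity concerns only the vertices
    of the immersed K4.\<close>
  define f :: "'a \<Rightarrow> nat" where "f = (\<lambda>v. if v = s then 0 else if v = t then 1 else if v = y then 2 else 3)"
  have f: "f s = 0" "f t = 1" "f y = 2" "f z = 3" using yz unfolding f_def by auto
  have "graph_iso f (complete_graph {s, t, y, z}) (complete_graph {0, 1, 2, 3})"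
    unfolding graph_iso_def
  proof
    show "image_mset (\<lambda>e. f ` e) (edges (complete_graph {s, t, y, z}))
      = edges (complete_graph {0, 1, 2, 3})"
      using image_complete_graph_four[OF yz, of f] f by simp
    show "bij_betw f (verts (complete_graph {s, t, y, z})) (verts (complete_graph {0, 1, 2, 3}))"
      unfolding complete_graph_def bij_betw_def inj_on_def using f yz by auto
  qed
  then show "rooted_immersion (G, s, t) D3"
    unfolding D3_def rooted_immersion.simps using imm f
    by (intro exI[of _ "complete_graph {s, t, y, z}"] exI[of _ f]) (auto simp: complete_graph_def)
next
  assume "rooted_immersion (G, s, t) D3"
  then obtain G' f where imm: "immerses G G'" and iso: "graph_iso f G' (complete_graph {0, 1, 2, 3 :: nat})"
    and st: "s \<in> verts G'" "t \<in> verts G'" "f s = 0" "f t = 1"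
    unfolding D3_def rooted_immersion.simps by blast
  have bij: "bij_betw f (verts G') {0, 1, 2, 3}"
    and E: "image_mset (\<lambda>e. f ` e) (edges G') = edges (complete_graph {0, 1, 2, 3})"
    using iso unfolding graph_iso_def complete_graph_def by auto
  have m: "multigraph G'" using immerses_multigraph[OF imm G] .
  define g where "g = inv_into (verts G') f"
  have gf: "g (f v) = v" if "v \<in> verts G'" for v
    using that bij unfolding g_def bij_betw_def by simp
  have bij_g: "bij_betw g {0, 1, 2, 3} (verts G')" unfolding g_def by (rule bij_betw_inv_into[OF bij])
  have V: "verts G' = {g 0, g 1, g 2, g 3}" using bij_g unfolding bij_betw_def by auto
  have dist: "distinct [g 0, g 1, g 2, g 3]" using bij_g unfolding bij_betw_def inj_on_def by auto
  have "image_mset (\<lambda>e. g ` e) (image_mset (\<lambda>e. f ` e) (edges G')) = image_mset (\<lambda>e. e) (edges G')"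
    unfolding image_mset.compositionality
  proof (rule image_mset_cong)
    fix e assume "e \<in># edges G'"
    then have "e \<subseteq> verts G'" using multigraph.edge_ends[OF m] by auto
    then show "((\<lambda>e. g ` e) \<circ> (\<lambda>e. f ` e)) e = e" using gf by (force simp: image_iff)
  qed
  then have "edges G' = edges (complete_graph {g 0, g 1, g 2, g 3})"
    unfolding E using image_complete_graph_four[of 0 1 2 "3::nat" g, OF _ dist] by simp
  then have "G' = complete_graph {g 0, g 1, g 2, g 3}" using V by (cases G') (simp add: complete_graph_def)
  moreover have "g 0 = s" "g 1 = t" using gf[OF st(1)] gf[OF st(2)] st(3,4) by auto
  ultimately show "has_D3 G s t" unfolding has_D3_def using imm dist by auto
qed

lemma three_connectedI:
  assumes "multigraph G" "edge_connected 3 G"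
  shows "three_connected G"
  unfolding three_connected_def
  using assms edge_connectedD[OF assms(2) multigraph.finite_verts[OF assms(1)]] by auto

theorem corollary2p7:
  fixes G :: "'a mgraph" and x0 x1 :: 'a
  assumes "multigraph G"
    and "edge_connected 3 G"
    and "x0 \<in> verts G" and "x1 \<in> verts G" and "x0 \<noteq> x1"
    and "card (verts G) \<ge> 4"
  shows "\<not> rooted_immersion (G, x0, x1) D3 \<longleftrightarrow>
    doubled_cycle G \<or>
    (\<exists>X0 X1 Xs. segmentation G X0 X1 Xs \<and> has_width G Xs 3 \<and>
      (\<forall>X \<in> {X0, X1}. card X \<ge> 3 \<longrightarrow> x0 \<notin> X \<and> x1 \<notin> X))"
  unfolding rooted_immersion_D3_iff[OF assms(1)]
  using exists_segmentation[OF three_connectedI[OF assms(1,2)] _ _ assms(3-6)]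
    doubled_cycle_no_D3[OF assms(1)] segmentation_no_D3[OF assms(1)] by blast

end
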